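(* Let $(R,\mathfrak m)$ be a Noetherian regular (or weakly $F$-regular) local ring of characteristic $p>0$, let $I$ be a proper ideal of $R$, let $n=\mu(I)$ be its minimal number of generators, and let $w$ be any nonnegative integer. Then \[(I^{n+w})^{-\mathrm{sp}}\subseteq\mathfrak m I^{w+1}.\]
   Context: $\overline{A}$ denotes the integral closure of an ideal $A$. The special part of the integral closure of an ideal $J$ is $J^{-\mathrm{sp}}:=\{x\in R : \exists\, s\ge1 \text{ such that } x^s\in\overline{\mathfrak m J^s}\}$. A Noetherian ring of characteristic $p$ is weakly $F$-regular if every ideal equals its tight closure, where the tight closure $A^*$ of an ideal $A$ consists of the $x$ for which there is $c\in R$, not in any minimal prime of $R$, with $cx^q\in A^{[q]}$ for all $q=p^e\gg0$ ($A^{[q]}$ being the ideal generated by $q$-th powers of elements of $A$).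
   Formalization: The case I = 0, w = 0 is excluded by requiring n + w > 0: there I^{n+w} = I^0 = R has special part 𝔪, while 𝔪I^{w+1} = 0, so the inclusion fails unless R is a field. *)

theory Defs
  imports
    "HOL-Algebra.Algebra"
    "HOL-Library.Extended_Nat"
    "HOL-Computational_Algebra.Primes"
begin

locale noetherian_local_ring = cring R + noetherian_ring R + maximalideal \<mm> R
  for R (structure) and \<mm> +
  assumes unique_maximal: "maximalideal M R \<Longrightarrow> M = \<mm>"

text \<open>Ideals form a monoid under multiplication, with unit the whole ring; in particular the
  zeroth power of any ideal, including the zero ideal, is the whole ring.\<close>

abbreviation ideal_pow :: "('a, 'b) ring_scheme \<Rightarrow> 'a set \<Rightarrow> nat \<Rightarrow> 'a set" where
  "ideal_pow R I n \<equiv> I [^]\<^bsub>ideals_set R\<^esub> n"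

definition min_num_gens :: "('a, 'b) ring_scheme \<Rightarrow> 'a set \<Rightarrow> nat" where
  "min_num_gens R I =
     (LEAST k. \<exists>A. A \<subseteq> carrier R \<and> finite A \<and> card A = k \<and> I = Idl\<^bsub>R\<^esub> A)"

definition krull_dim :: "('a, 'b) ring_scheme \<Rightarrow> enat" where
  "krull_dim R =
     Sup {enat n | n. \<exists>P. (\<forall>i\<le>n. primeideal (P i) R) \<and> (\<forall>i<n. P i \<subset> P (Suc i))}"

definition regular_local_ring :: "('a, 'b) ring_scheme \<Rightarrow> 'a set \<Rightarrow> bool" where
  "regular_local_ring R \<mm> \<longleftrightarrow>
     noetherian_local_ring R \<mm> \<and> krull_dim R = enat (min_num_gens R \<mm>)"

definition has_characteristic :: "('a, 'b) ring_scheme \<Rightarrow> nat \<Rightarrow> bool" where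
  "has_characteristic R p \<longleftrightarrow> (\<forall>n::nat. add_pow R n \<one>\<^bsub>R\<^esub> = \<zero>\<^bsub>R\<^esub> \<longleftrightarrow> p dvd n)"

text \<open>An element \<open>x\<close> is integral over the ideal \<open>A\<close> if it satisfies an equation
  \<open>x^k + a\<^sub>1 x^(k-1) + \<dots> + a\<^sub>k = 0\<close> with \<open>k \<ge> 1\<close> and \<open>a\<^sub>i \<in> A^i\<close>.\<close>

definition integral_closure :: "('a, 'b) ring_scheme \<Rightarrow> 'a set \<Rightarrow> 'a set" where
  "integral_closure R A =
     {x \<in> carrier R. \<exists>k::nat. \<exists>a. 1 \<le> k \<and> (\<forall>i\<in>{1..k}. a i \<in> ideal_pow R A i) \<and>
        x [^]\<^bsub>R\<^esub> k \<oplus>\<^bsub>R\<^esub> (\<Oplus>\<^bsub>R\<^esub>i\<in>{1..k}. a i \<otimes>\<^bsub>R\<^esub> x [^]\<^bsub>R\<^esub> (k - i)) = \<zero>\<^bsub>R\<^esub>}"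

definition special_part :: "('a, 'b) ring_scheme \<Rightarrow> 'a set \<Rightarrow> 'a set \<Rightarrow> 'a set" where
  "special_part R \<mm> J =
     {x \<in> carrier R. \<exists>s::nat. 1 \<le> s \<and>
        x [^]\<^bsub>R\<^esub> s \<in> integral_closure R (\<mm> \<cdot>\<^bsub>R\<^esub> ideal_pow R J s)}"

definition minimal_prime :: "('a, 'b) ring_scheme \<Rightarrow> 'a set \<Rightarrow> bool" where
  "minimal_prime R P \<longleftrightarrow>
     primeideal P R \<and> (\<forall>Q. primeideal Q R \<and> Q \<subseteq> P \<longrightarrow> Q = P)"

definition frobenius_power :: "('a, 'b) ring_scheme \<Rightarrow> 'a set \<Rightarrow> nat \<Rightarrow> 'a set" where
  "frobenius_power R A q = Idl\<^bsub>R\<^esub> ((\<lambda>a. a [^]\<^bsub>R\<^esub> q) ` A)"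

definition tight_closure :: "('a, 'b) ring_scheme \<Rightarrow> nat \<Rightarrow> 'a set \<Rightarrow> 'a set" where
  "tight_closure R p A =
     {x \<in> carrier R. \<exists>c\<in>carrier R. (\<forall>P. minimal_prime R P \<longrightarrow> c \<notin> P) \<and>
        (\<exists>e\<^sub>0. \<forall>e\<ge>e\<^sub>0. c \<otimes>\<^bsub>R\<^esub> x [^]\<^bsub>R\<^esub> (p ^ e) \<in> frobenius_power R A (p ^ e))}"

definition weakly_F_regular :: "('a, 'b) ring_scheme \<Rightarrow> nat \<Rightarrow> bool" where
  "weakly_F_regular R p \<longleftrightarrow>
     cring R \<and> noetherian_ring R \<and> has_characteristic R p \<and>
     (\<forall>A. ideal A R \<longrightarrow> tight_closure R p A = A)"

end

theory Submission
  imports Defs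
begin

text \<open>
  Let \<open>A = I\<^bsup>w+1\<^esup>\<close>. If \<open>x\<^sup>s\<close> is integral over \<open>\<mm> I\<^bsup>(n+w)s\<^esup>\<close>, there is \<open>d \<noteq> 0\<close> such that
  \<open>d x\<^bsup>Qq\<^esup> \<in> \<mm>\<^sup>N I\<^bsup>(n+w)Qq\<^esup>\<close> for all powers \<open>q\<close> of \<open>p\<close>, where \<open>Q\<close> is a fixed power of \<open>p\<close> so large that
  \<open>N = \<lfloor>Qq / s\<rfloor> \<ge> \<mu>(\<mm>) q\<close>. By the pigeonhole principle the right-hand side lies in
  \<open>(\<mm> A\<^bsup>[Q]\<^esup>)\<^bsup>[q]\<^esup>\<close>, and as ideals are tightly closed, \<open>x\<^sup>Q \<in> \<mm> A\<^bsup>[Q]\<^esup>\<close>. Were \<open>x\<close> a minimal generator of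
  \<open>A\<close>, say \<open>A = B + (x)\<close> with \<open>x \<notin> B\<close>, Nakayama's lemma would give \<open>x\<^sup>Q \<in> B\<^bsup>[Q]\<^esup>\<close> and hence \<open>x \<in> B\<close>.

  That ideals of a regular local ring are tightly closed is shown by Gorenstein duality over
  \<open>R / (x\<^sub>1\<^sup>t, \<dots>, x\<^sub>d\<^sup>t)\<close> for a regular system of parameters. That the parameters form a regular sequence
  follows from Krull's principal ideal theorem.
\<close>

section \<open>Ideals and saturation at a prime\<close>

text \<open>The factor \<open>\<mm>\<close> forces the detour through \<open>Q\<close>: each power
  of \<open>x\<close> gains only \<open>1/s\<close> of a factor of \<open>\<mm>\<close>, so with
  \<open>Q = 1\<close> the power of \<open>\<mm>\<close> may be too small to lie in the
  \<open>q\<close>-th Frobenius power of \<open>\<mm>\<close>. A large fixed \<open>Q\<close>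
  repairs this, at the price of a descent from \<open>x^Q\<close> to \<open>x\<close> in which the
  factor \<open>\<mm>\<close> must survive; hence the argument with a minimal generator. The
  multiplier is \<open>d = g (f g)^k\<close> for some nonzero \<open>f\<close> in \<open>I\<close>:
  the power \<open>(f g)^k\<close> absorbs an equation of integral dependence of degree
  \<open>k\<close>, and \<open>g = f^((n+w)s)\<close> pays for the remainder of \<open>Qq\<close>
  modulo \<open>s\<close>. Any nonzero \<open>d\<close> must be admissible, so \<open>R\<close> has
  to be a domain; for weakly F-regular rings this takes an argument of its own. Quotients and
  localizations are expressed inside \<open>R\<close>: a statement about \<open>R/K\<close> concerns
  ideals containing \<open>K\<close>, a local one concerns saturated ideals. The length function
  built on saturated ideals serves twice, at a prime \<open>P\<close> for Krull's theorem and at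
  \<open>\<mm>\<close> for duality.\<close>

lemma (in ring) ideal_add_closed: "\<lbrakk>ideal J R; a \<in> J; b \<in> J\<rbrakk> \<Longrightarrow> a \<oplus> b \<in> J"
  by (meson additive_subgroup.a_closed ideal.axioms(1))

lemma (in ring) ideal_zero_closed: "ideal J R \<Longrightarrow> \<zero> \<in> J"
  by (meson additive_subgroup.zero_closed ideal.axioms(1))

lemma (in ring) ideal_inv_closed: "\<lbrakk>ideal J R; a \<in> J\<rbrakk> \<Longrightarrow> \<ominus> a \<in> J"
  by (meson additive_subgroup.a_inv_closed ideal.axioms(1))

lemma (in ring) ideal_minus_closed: "\<lbrakk>ideal J R; a \<in> J; b \<in> J\<rbrakk> \<Longrightarrow> a \<ominus> b \<in> J"
  by (simp add: a_minus_def ideal_add_closed ideal_inv_closed)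

lemmas (in ring) ideal_closed =
  ideal_add_closed ideal_zero_closed ideal_inv_closed ideal_minus_closed
  ideal.I_l_closed ideal.I_r_closed

lemma (in ring) ideal_subset_carrier: "ideal J R \<Longrightarrow> J \<subseteq> carrier R"
  using ideal.Icarr by fastforce

lemma (in ring) ideal_add_cancel:
  assumes "ideal J R" "a \<in> carrier R" "b \<in> J"
  shows "a \<oplus> b \<in> J \<longleftrightarrow> a \<in> J"
proof
  have b: "b \<in> carrier R" using assms ideal.Icarr by fast
  assume "a \<oplus> b \<in> J"
  hence "(a \<oplus> b) \<ominus> b \<in> J" using assms ideal_minus_closed by blast
  moreover have "(a \<oplus> b) \<ominus> b = a" using assms b by algebra
  ultimately show "a \<in> J" by simp
qed (use assms ideal_add_closed in blast)

lemma (in ring) ideal_minus_cancel: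
  assumes "ideal J R" "a \<in> carrier R" "b \<in> J"
  shows "a \<ominus> b \<in> J \<longleftrightarrow> a \<in> J"
  unfolding a_minus_def using assms by (simp add: ideal_add_cancel ideal_inv_closed)

lemma (in ring) Idl_ideal: "ideal J R \<Longrightarrow> Idl J = J"
  by (simp add: genideal_minimal genideal_self ideal_subset_carrier subset_antisym)

lemma (in cring) ideal_adjoin:
  assumes J: "ideal J R" and z: "z \<in> carrier R"
  shows "ideal {k \<oplus> a \<otimes> z | k a. k \<in> J \<and> a \<in> carrier R} R" (is "ideal ?A R")
proof (rule idealI[OF ring_axioms])
  note c = ideal.Icarr[OF J]
  show "subgroup ?A (add_monoid R)"
  proof (rule add.subgroupI)
    show "?A \<subseteq> carrier R" using c z by auto
    have "\<zero> \<oplus> \<zero> \<otimes> z \<in> ?A" using ideal_zero_closed[OF J] by blast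
    thus "?A \<noteq> {}" by blast
    fix a assume "a \<in> ?A"
    then obtain k r where a: "a = k \<oplus> r \<otimes> z" "k \<in> J" "r \<in> carrier R" by blast
    hence "\<ominus> a = \<ominus> k \<oplus> (\<ominus> r) \<otimes> z" using c z by (simp add: minus_add l_minus)
    thus "\<ominus> a \<in> ?A" using a ideal_inv_closed[OF J] by blast
    fix b assume "b \<in> ?A"
    then obtain k' r' where b: "b = k' \<oplus> r' \<otimes> z" "k' \<in> J" "r' \<in> carrier R" by blast
    have "a \<oplus> b = (k \<oplus> k') \<oplus> (r \<oplus> r') \<otimes> z" using a b c z by (simp add: ring_simprules)
    thus "a \<oplus> b \<in> ?A" using a b ideal_add_closed[OF J] by blast
  qed
  fix a x assume "a \<in> ?A" and x: "x \<in> carrier R"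
  then obtain k r where a: "a = k \<oplus> r \<otimes> z" "k \<in> J" "r \<in> carrier R" by blast
  have "x \<otimes> a = (x \<otimes> k) \<oplus> (x \<otimes> r) \<otimes> z" using a x c z by (simp add: ring_simprules)
  thus 1: "x \<otimes> a \<in> ?A" using a x ideal.I_l_closed[OF J] by blast
  have "a \<otimes> x = x \<otimes> a" using a x c z m_comm by simp
  thus "a \<otimes> x \<in> ?A" using 1 by simp
qed

lemma (in cring) mem_Idl_insert:
  assumes z: "z \<in> carrier R" and S: "S \<subseteq> carrier R"
  shows "r \<in> Idl (insert z S) \<longleftrightarrow> (\<exists>k\<in>Idl S. \<exists>a\<in>carrier R. r = k \<oplus> a \<otimes> z)"
proof -
  have iS: "ideal (Idl S) R" using S by (rule genideal_ideal)
  have i: "ideal (Idl (insert z S)) R" using assms by (intro genideal_ideal) auto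
  have sub: "insert z S \<subseteq> Idl (insert z S)" using assms by (intro genideal_self) auto
  have "Idl (insert z S) \<subseteq> {k \<oplus> a \<otimes> z | k a. k \<in> Idl S \<and> a \<in> carrier R}" (is "_ \<subseteq> ?A")
  proof (rule genideal_minimal[OF ideal_adjoin[OF iS z]])
    have "\<zero> \<oplus> \<one> \<otimes> z \<in> ?A" using ideal_zero_closed[OF iS] by blast
    hence "z \<in> ?A" using z by simp
    moreover have "k \<in> ?A" if "k \<in> S" for k
    proof -
      have "k \<oplus> \<zero> \<otimes> z \<in> ?A" using that genideal_self[OF S] by blast
      moreover have "k \<oplus> \<zero> \<otimes> z = k" using that S z by auto
      ultimately show ?thesis by simp
    qed
    ultimately show "insert z S \<subseteq> ?A" by blast
  qed
  moreover have "?A \<subseteq> Idl (insert z S)"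
  proof
    have "Idl S \<subseteq> Idl (insert z S)" using assms by (intro subset_Idl_subset) auto
    moreover fix r assume "r \<in> ?A"
    ultimately show "r \<in> Idl (insert z S)" using sub i by (auto simp: ideal_closed z)
  qed
  ultimately show ?thesis by blast
qed

lemma (in cring) mem_ideal_insert:
  assumes "z \<in> carrier R" and "ideal J R"
  shows "r \<in> Idl (insert z J) \<longleftrightarrow> (\<exists>k\<in>J. \<exists>a\<in>carrier R. r = k \<oplus> a \<otimes> z)"
  using mem_Idl_insert[OF assms(1) ideal_subset_carrier[OF assms(2)]] Idl_ideal[OF assms(2)] by simp

lemma (in ring) Idl_mono: "\<lbrakk>S \<subseteq> T; T \<subseteq> carrier R\<rbrakk> \<Longrightarrow> Idl S \<subseteq> Idl T"
  by (rule subset_Idl_subset)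

lemma (in ring) ideal_insert:
  assumes "z \<in> carrier R" and "ideal J R"
  shows "ideal (Idl (insert z J)) R" "J \<subseteq> Idl (insert z J)" "z \<in> Idl (insert z J)"
proof -
  have 1: "insert z J \<subseteq> carrier R" using assms ideal_subset_carrier by blast
  show "ideal (Idl (insert z J)) R" "J \<subseteq> Idl (insert z J)" "z \<in> Idl (insert z J)"
    using genideal_ideal[OF 1] genideal_self[OF 1] by auto
qed

lemma (in ring) Idl_Un_Idl:
  assumes "S \<subseteq> carrier R" "T \<subseteq> carrier R"
  shows "Idl (Idl S \<union> T) = Idl (S \<union> T)"
proof (rule subset_antisym)
  have S: "ideal (Idl S) R" "S \<subseteq> Idl S"
    using genideal_ideal[OF assms(1)] genideal_self[OF assms(1)] by auto
  have ST: "ideal (Idl (S \<union> T)) R" "S \<union> T \<subseteq> Idl (S \<union> T)"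
    using assms genideal_ideal[of "S \<union> T"] genideal_self[of "S \<union> T"] by blast+
  have "Idl S \<subseteq> Idl (S \<union> T)" using ST by (intro genideal_minimal) auto
  thus "Idl (Idl S \<union> T) \<subseteq> Idl (S \<union> T)"
    using ST by (intro genideal_minimal) auto
  show "Idl (S \<union> T) \<subseteq> Idl (Idl S \<union> T)"
    using S ideal_subset_carrier[OF S(1)] assms by (intro Idl_mono) auto
qed

section \<open>Noetherian induction on ideals\<close>

locale noetherian_cring = cring R + noetherian_ring R for R (structure)

sublocale noetherian_local_ring \<subseteq> noetherian_cring ..

text \<open>A nonempty chain of ideals in a Noetherian ring has its union as a member, so Zorn's
  lemma applies to every family. Many arguments below start from such an extremal choice.\<close>

lemma (in noetherian_ring) maximal_ideal_in_family:
  assumes "F \<noteq> {}" and "\<And>J. J \<in> F \<Longrightarrow> ideal J R"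
  obtains M where "M \<in> F" "\<And>J. \<lbrakk>J \<in> F; M \<subseteq> J\<rbrakk> \<Longrightarrow> J = M"
proof -
  have "\<exists>M\<in>F. \<forall>J\<in>F. M \<subseteq> J \<longrightarrow> J = M"
  proof (rule subset_Zorn_nonempty[OF assms(1)])
    fix C assume C: "C \<noteq> {}" "subset.chain F C"
    hence CF: "C \<subseteq> F" unfolding subset_chain_def by simp
    hence "subset.chain {I. ideal I R} C" using C(2) assms(2) unfolding subset_chain_def by auto
    from ideal_chain_is_trivial[OF C(1) this] CF show "\<Union> C \<in> F" by blast
  qed
  then obtain M where "M \<in> F" "\<forall>J\<in>F. M \<subseteq> J \<longrightarrow> J = M" by (elim bexE)
  thus ?thesis by (intro that[of M]) auto
qed

text \<open>The larger ideal counts as the smaller one in this order, so an induction may assume its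
  claim for all strictly larger ideals.\<close>

lemma (in noetherian_ring) wf_ideals: "wf {(J', J). ideal J R \<and> ideal J' R \<and> J \<subset> J'}"
proof (rule wfI_min)
  fix x :: "'a set" and F assume x: "x \<in> F"
  show "\<exists>z\<in>F. \<forall>y. (y, z) \<in> {(J', J). ideal J R \<and> ideal J' R \<and> J \<subset> J'} \<longrightarrow> y \<notin> F"
  proof (cases "\<exists>J\<in>F. ideal J R")
    case True
    hence ne: "{J\<in>F. ideal J R} \<noteq> {}" by blast
    obtain M where M: "M \<in> {J\<in>F. ideal J R}" "\<And>J. \<lbrakk>J \<in> {J\<in>F. ideal J R}; M \<subseteq> J\<rbrakk> \<Longrightarrow> J = M"
      by (rule maximal_ideal_in_family[OF ne]) auto
    show ?thesis
    proof (intro bexI[of _ M] allI impI notI)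
      fix y assume y: "(y, M) \<in> {(J', J). ideal J R \<and> ideal J' R \<and> J \<subset> J'}" "y \<in> F"
      hence "y = M" using M(2)[of y] by auto
      thus False using y by simp
    qed (use M in simp)
  qed (use x in blast)
qed

text \<open>Ideals are localized at a prime \<open>P\<close> without forming fractions: a \<open>P\<close>-saturated ideal is the
  contraction of an ideal of the local ring at \<open>P\<close>.\<close>

definition (in ring) saturation :: "'a set \<Rightarrow> 'a set \<Rightarrow> 'a set" where
  "saturation P J = {r \<in> carrier R. \<exists>s\<in>carrier R - P. s \<otimes> r \<in> J}"

definition (in ring) saturated :: "'a set \<Rightarrow> 'a set \<Rightarrow> bool" where
  "saturated P J \<longleftrightarrow> (\<forall>s\<in>carrier R - P. \<forall>r\<in>carrier R. s \<otimes> r \<in> J \<longrightarrow> r \<in> J)"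

lemma (in ring) saturatedD:
  "\<lbrakk>saturated P J; s \<in> carrier R; s \<notin> P; r \<in> carrier R; s \<otimes> r \<in> J\<rbrakk> \<Longrightarrow> r \<in> J"
  unfolding saturated_def by simp

lemma primeideal_one_notin: "primeideal P R \<Longrightarrow> \<one>\<^bsub>R\<^esub> \<notin> P"
  by (metis ideal.one_imp_carrier primeideal.I_notcarr primeideal.axioms(1))

lemma primeideal_ideal: "primeideal P R \<Longrightarrow> ideal P R"
  by (rule primeideal.axioms(1))

lemma (in cring) primeideal_compl_mult:
  "\<lbrakk>primeideal P R; s \<in> carrier R; t \<in> carrier R; s \<notin> P; t \<notin> P\<rbrakk> \<Longrightarrow> s \<otimes> t \<notin> P"
  using primeideal.I_prime[of P R s t] by metis

lemma (in cring) saturated_prime: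
  assumes "primeideal Q R" "Q \<subseteq> P" shows "saturated P Q"
  unfolding saturated_def using assms primeideal.I_prime[OF assms(1)] by (meson DiffE subsetD)

lemma (in cring) subset_saturation:
  assumes "ideal J R" "primeideal P R" shows "J \<subseteq> saturation P J"
proof
  fix r assume r: "r \<in> J"
  hence "r \<in> carrier R" using assms ideal.Icarr by fast
  thus "r \<in> saturation P J" unfolding saturation_def
    using r primeideal_one_notin[OF assms(2)] by (auto intro!: bexI[of _ \<one>])
qed

lemma (in cring) saturation_ideal:
  assumes J: "ideal J R" and P: "primeideal P R"
  shows "ideal (saturation P J) R"
proof (rule idealI[OF ring_axioms])
  show "subgroup (saturation P J) (add_monoid R)"
  proof (rule add.subgroupI)
    show "saturation P J \<subseteq> carrier R" unfolding saturation_def by blast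
    show "saturation P J \<noteq> {}" using subset_saturation[OF assms] ideal_zero_closed[OF J] by blast
    fix a assume "a \<in> saturation P J"
    then obtain s where a: "a \<in> carrier R" "s \<in> carrier R" "s \<notin> P" "s \<otimes> a \<in> J"
      unfolding saturation_def by blast
    hence "s \<otimes> (\<ominus> a) \<in> J" using ideal_inv_closed[OF J] by (simp add: r_minus)
    thus "\<ominus> a \<in> saturation P J" using a unfolding saturation_def by blast
    fix b assume "b \<in> saturation P J"
    then obtain t where b: "b \<in> carrier R" "t \<in> carrier R" "t \<notin> P" "t \<otimes> b \<in> J"
      unfolding saturation_def by blast
    have "(s \<otimes> t) \<otimes> (a \<oplus> b) = t \<otimes> (s \<otimes> a) \<oplus> s \<otimes> (t \<otimes> b)" using a b by algebra
    also have "\<dots> \<in> J" using a b J by (simp add: ideal_add_closed ideal.I_l_closed)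
    finally show "a \<oplus> b \<in> saturation P J"
      using a b primeideal_compl_mult[OF P, of s t] unfolding saturation_def by blast
  qed
  fix a x assume "a \<in> saturation P J" and x: "x \<in> carrier R"
  then obtain s where a: "a \<in> carrier R" "s \<in> carrier R" "s \<notin> P" "s \<otimes> a \<in> J"
    unfolding saturation_def by blast
  have "s \<otimes> (x \<otimes> a) = x \<otimes> (s \<otimes> a)" using a x by algebra
  hence "s \<otimes> (x \<otimes> a) \<in> J" using a x ideal.I_l_closed[OF J] by simp
  thus 1: "x \<otimes> a \<in> saturation P J" using a x unfolding saturation_def by blast
  thus "a \<otimes> x \<in> saturation P J" using a x m_comm by simp
qed

lemma (in cring) saturated_saturation:
  assumes P: "primeideal P R"
  shows "saturated P (saturation P J)"
  unfolding saturated_def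
proof (intro ballI impI)
  fix s r assume s: "s \<in> carrier R - P" and r: "r \<in> carrier R" and "s \<otimes> r \<in> saturation P J"
  then obtain t where t: "t \<in> carrier R" "t \<notin> P" "t \<otimes> (s \<otimes> r) \<in> J" unfolding saturation_def by blast
  hence "(t \<otimes> s) \<otimes> r \<in> J" using s r m_assoc by simp
  thus "r \<in> saturation P J" using s t r primeideal_compl_mult[OF P, of t s] unfolding saturation_def by blast
qed

lemma (in ring) saturation_mono: "J \<subseteq> J' \<Longrightarrow> saturation P J \<subseteq> saturation P J'"
  unfolding saturation_def by blast

lemma (in cring) saturation_minimal:
  assumes "saturated P J'" "J \<subseteq> J'" shows "saturation P J \<subseteq> J'"
proof
  fix r assume "r \<in> saturation P J"
  then obtain s where "r \<in> carrier R" "s \<in> carrier R" "s \<notin> P" "s \<otimes> r \<in> J'"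
    using assms(2) unfolding saturation_def by blast
  thus "r \<in> J'" using saturatedD[OF assms(1)] by blast
qed

section \<open>Length and Krull's principal ideal theorem\<close>

context cring begin

lemma ideals_monoid: "Group.comm_monoid (ideals_set R)"
  by (rule ideals_set_is_comm_monoid)

lemma ideals_set_simps [simp]:
  "carrier (ideals_set R) = {I. ideal I R}"
  "I \<otimes>\<^bsub>ideals_set R\<^esub> J = I \<cdot> J"
  "\<one>\<^bsub>ideals_set R\<^esub> = carrier R"
  by (simp_all add: ideals_set_def)

lemma ideal_pow_0 [simp]: "ideal_pow R I 0 = carrier R"
  and ideal_pow_Suc: "ideal_pow R I (Suc k) = ideal_pow R I k \<cdot> I"
  by (simp_all add: nat_pow_def ideals_set_def)

lemma ideal_pow_ideal: "ideal I R \<Longrightarrow> ideal (ideal_pow R I k) R"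
  by (induction k) (simp_all only: ideal_pow_0 ideal_pow_Suc oneideal ideal_prod_is_ideal)

lemma ideal_pow_1: "ideal I R \<Longrightarrow> ideal_pow R I (Suc 0) = I"
  by (simp only: ideal_pow_Suc ideal_pow_0 ideal_prod_commute[OF oneideal] ideal_prod_one)

lemma ideal_pow_add:
  "ideal I R \<Longrightarrow> ideal_pow R I (k + l) = ideal_pow R I k \<cdot> ideal_pow R I l"
  using monoid.nat_pow_mult[OF comm_monoid.axioms(1)[OF ideals_monoid], of I k l] by simp

lemma ideal_pow_mult:
  "ideal I R \<Longrightarrow> ideal_pow R I (k * l) = ideal_pow R (ideal_pow R I k) l"
  using monoid.nat_pow_pow[OF comm_monoid.axioms(1)[OF ideals_monoid], of I k l] by simp

lemma ideal_pow_prod: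
  "\<lbrakk>ideal I R; ideal J R\<rbrakk> \<Longrightarrow> ideal_pow R (I \<cdot> J) k = ideal_pow R I k \<cdot> ideal_pow R J k"
  using comm_monoid.nat_pow_distrib[OF ideals_monoid, of I J k] by simp

lemma ideal_prod_subsetI:
  assumes "ideal K R" and "\<And>a b. \<lbrakk>a \<in> I; b \<in> J\<rbrakk> \<Longrightarrow> a \<otimes> b \<in> K"
  shows "I \<cdot> J \<subseteq> K"
proof
  fix r assume "r \<in> I \<cdot> J" thus "r \<in> K"
    by induction (use assms ideal_add_closed in auto)
qed

lemma ideal_prod_mono: "\<lbrakk>I \<subseteq> I'; J \<subseteq> J'\<rbrakk> \<Longrightarrow> I \<cdot> J \<subseteq> I' \<cdot> J'"
proof
  fix r assume "I \<subseteq> I'" "J \<subseteq> J'" and "r \<in> I \<cdot> J"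
  from this(3,1,2) show "r \<in> I' \<cdot> J'"
    by induction (auto intro: ideal_prod.intros)
qed

lemma ideal_pow_le:
  assumes I: "ideal I R" and "k \<le> l"
  shows "ideal_pow R I l \<subseteq> ideal_pow R I k"
proof -
  from \<open>k \<le> l\<close> have "l = k + (l - k)" by simp
  hence "ideal_pow R I l = ideal_pow R I k \<cdot> ideal_pow R I (l - k)"
    using ideal_pow_add[OF I] by metis
  thus ?thesis using ideal_prod_inter ideal_pow_ideal[OF I] by blast
qed

lemma pow_mem_ideal_pow: "\<lbrakk>ideal I R; a \<in> I\<rbrakk> \<Longrightarrow> a [^] k \<in> ideal_pow R I k"
  by (induction k) (simp_all only: ideal_pow_0 ideal_pow_Suc nat_pow_0 nat_pow_Suc one_closed ideal_prod.prod)

lemma prime_pow_mem: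
  assumes P: "primeideal P R" and "a \<in> carrier R" "a [^] (k::nat) \<in> P"
  shows "a \<in> P"
  using assms(3)
proof (induction k)
  case 0 thus ?case using primeideal_one_notin[OF P] by simp
next
  case (Suc k)
  thus ?case using primeideal.I_prime[OF P, of "a [^] k" a] assms(2) by auto
qed

definition colon :: "'a set \<Rightarrow> 'a \<Rightarrow> 'a set" where
  "colon J u = {a \<in> carrier R. a \<otimes> u \<in> J}"

lemma colon_ideal:
  assumes J: "ideal J R" and u: "u \<in> carrier R"
  shows "ideal (colon J u) R"
proof (rule idealI[OF ring_axioms])
  show "subgroup (colon J u) (add_monoid R)"
  proof (rule add.subgroupI)
    show "colon J u \<subseteq> carrier R" unfolding colon_def by blast
    have "\<zero> \<in> colon J u" using u ideal_zero_closed[OF J] by (simp add: colon_def)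
    thus "colon J u \<noteq> {}" by blast
  qed (use u in \<open>auto simp: colon_def l_minus l_distr ideal_closed[OF J]\<close>)
  fix a x assume a: "a \<in> colon J u" and x: "x \<in> carrier R"
  thus 1: "x \<otimes> a \<in> colon J u"
    using u ideal.I_l_closed[OF J] by (simp add: colon_def m_assoc)
  thus "a \<otimes> x \<in> colon J u" using a x m_comm by (simp add: colon_def)
qed

section \<open>Finite length after localization at a prime\<close>

definition contracted :: "'a set \<Rightarrow> 'a set \<Rightarrow> bool" where
  "contracted P E \<longleftrightarrow> ideal E R \<and> saturated P E"

lemma contracted_ideal: "contracted P E \<Longrightarrow> ideal E R"
  and contracted_saturated: "contracted P E \<Longrightarrow> saturated P E"
  by (simp_all add: contracted_def)

lemma contracted_saturation: "\<lbrakk>ideal J R; primeideal P R\<rbrakk> \<Longrightarrow> contracted P (saturation P J)"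
  by (simp add: contracted_def saturation_ideal saturated_saturation)

lemma contracted_carrier: "contracted P (carrier R)"
  by (simp add: contracted_def saturated_def oneideal)

text \<open>After localization at \<open>P\<close>, the quotient \<open>E' / E\<close> is a simple module.\<close>

definition simple_ext :: "'a set \<Rightarrow> 'a set \<Rightarrow> 'a set \<Rightarrow> bool" where
  "simple_ext P E E' \<longleftrightarrow> E \<subset> E' \<and>
     (\<forall>e\<in>E' - E. \<forall>e'\<in>E'. \<exists>s\<in>carrier R - P. \<exists>r\<in>carrier R. s \<otimes> e' \<ominus> r \<otimes> e \<in> E)"

lemma simple_extD:
  assumes "simple_ext P E E'" "e \<in> E'" "e \<notin> E" "e' \<in> E'"
  obtains s r where "s \<in> carrier R" "s \<notin> P" "r \<in> carrier R" "s \<otimes> e' \<ominus> r \<otimes> e \<in> E"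
  using assms unfolding simple_ext_def by (metis DiffD1 DiffD2 DiffI)

definition simple_rel :: "'a set \<Rightarrow> ('a set \<times> 'a set) set" where
  "simple_rel P = {(E, E'). contracted P E \<and> contracted P E' \<and> simple_ext P E E'}"

end

context noetherian_cring begin

text \<open>A maximal member among the colons \<open>(J : u)\<close> with \<open>u\<close> in
  \<open>F\<close> but not in \<open>J\<close> is prime, because replacing \<open>u\<close> by a
  multiple still outside \<open>J\<close> cannot enlarge the colon. Saturation keeps it inside
  \<open>P\<close>, since nothing outside \<open>P\<close> can carry \<open>u\<close> into
  \<open>J\<close>.\<close>

lemma associated_prime:
  assumes J: "ideal J R" and F: "ideal F R" and "\<not> F \<subseteq> J" and sat: "saturated P J"
  obtains u where "u \<in> F" "u \<notin> J" "primeideal (colon J u) R" "colon J u \<subseteq> P"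
proof -
  have Fc: "u \<in> carrier R" if "u \<in> F" for u using that F ideal.Icarr by fast
  let ?S = "colon J ` (F - J)"
  have ne: "?S \<noteq> {}" using assms(3) by blast
  obtain M where M: "M \<in> ?S" "\<And>K. \<lbrakk>K \<in> ?S; M \<subseteq> K\<rbrakk> \<Longrightarrow> K = M"
    by (rule maximal_ideal_in_family[OF ne]) (use colon_ideal[OF J] Fc in auto)
  then obtain u where u: "u \<in> F" "u \<notin> J" "M = colon J u" by blast
  have uc: "u \<in> carrier R" using u Fc by blast
  have "primeideal (colon J u) R"
  proof (rule primeidealI[OF colon_ideal[OF J uc] is_cring])
    have "\<one> \<notin> colon J u" using u uc by (simp add: colon_def)
    thus "carrier R \<noteq> colon J u" by auto
    fix a b assume a: "a \<in> carrier R" and b: "b \<in> carrier R" and ab: "a \<otimes> b \<in> colon J u"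
    show "a \<in> colon J u \<or> b \<in> colon J u"
    proof (rule disjCI)
      assume "b \<notin> colon J u"
      hence bu: "b \<otimes> u \<in> F - J" using b u ideal.I_l_closed[OF F] by (simp add: colon_def)
      have "colon J u \<subseteq> colon J (b \<otimes> u)"
      proof
        fix c assume c: "c \<in> colon J u"
        hence "c \<otimes> (b \<otimes> u) = b \<otimes> (c \<otimes> u)" using b uc by (simp add: colon_def m_lcomm)
        thus "c \<in> colon J (b \<otimes> u)" using c b ideal.I_l_closed[OF J] by (simp add: colon_def)
      qed
      hence "colon J (b \<otimes> u) = colon J u" using M(2)[of "colon J (b \<otimes> u)"] bu u by blast
      moreover have "a \<in> colon J (b \<otimes> u)" using a b ab uc by (simp add: colon_def m_assoc)
      ultimately show "a \<in> colon J u" by simp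
    qed
  qed
  moreover have "colon J u \<subseteq> P"
    using saturatedD[OF sat _ _ uc] u unfolding colon_def by blast
  ultimately show ?thesis using that u by blast
qed

text \<open>By \<open>min\<close> the prime \<open>(J : u)\<close> found for some \<open>u\<close>
  in \<open>F\<close> can only be \<open>P\<close>, so adjoining \<open>u\<close> adds one copy of
  the residue field at \<open>P\<close>.\<close>

lemma exists_simple_ext:
  assumes P: "primeideal P R" and J: "contracted P J" and F: "contracted P F" and "J \<subset> F"
    and min: "\<And>Q. \<lbrakk>primeideal Q R; J \<subseteq> Q; Q \<subseteq> P\<rbrakk> \<Longrightarrow> Q = P"
  obtains E where "contracted P E" "simple_ext P J E" "E \<subseteq> F"
proof -
  note iJ = contracted_ideal[OF J] and iF = contracted_ideal[OF F]
  have "\<not> F \<subseteq> J" using \<open>J \<subset> F\<close> by blast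
  then obtain u where u: "u \<in> F" "u \<notin> J" "primeideal (colon J u) R" "colon J u \<subseteq> P"
    by (rule associated_prime[OF iJ iF _ contracted_saturated[OF J]])
  have uc: "u \<in> carrier R" using u iF ideal.Icarr by fast
  have "J \<subseteq> colon J u"
    using uc ideal.I_r_closed[OF iJ] ideal.Icarr[OF iJ] by (auto simp: colon_def)
  hence colP: "colon J u = P" using min u by blast
  let ?E = "saturation P (Idl (insert u J))"
  note ins = ideal_insert[OF uc iJ]
  have E: "contracted P ?E" by (rule contracted_saturation[OF ins(1) P])
  note iE = contracted_ideal[OF E]
  have sub: "Idl (insert u J) \<subseteq> ?E" by (rule subset_saturation[OF ins(1) P])
  have "Idl (insert u J) \<subseteq> F"
    by (rule genideal_minimal[OF iF]) (use u \<open>J \<subset> F\<close> in blast)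
  hence "?E \<subseteq> F" by (rule saturation_minimal[OF contracted_saturated[OF F]])
  moreover have "simple_ext P J ?E"
    unfolding simple_ext_def
  proof (intro conjI ballI)
    show "J \<subset> ?E" using sub ins u by blast
    fix e e' assume e: "e \<in> ?E - J" and e': "e' \<in> ?E"
    have ec: "e \<in> carrier R" "e' \<in> carrier R" using e e' ideal.Icarr[OF iE] by blast+
    from e obtain s where s: "s \<in> carrier R" "s \<notin> P" "s \<otimes> e \<in> Idl (insert u J)"
      unfolding saturation_def by blast
    from e' obtain s' where s': "s' \<in> carrier R" "s' \<notin> P" "s' \<otimes> e' \<in> Idl (insert u J)"
      unfolding saturation_def by blast
    from s obtain b r where b: "b \<in> J" "r \<in> carrier R" "s \<otimes> e = b \<oplus> r \<otimes> u"
      unfolding mem_ideal_insert[OF uc iJ] by blast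
    from s' obtain b' r' where b': "b' \<in> J" "r' \<in> carrier R" "s' \<otimes> e' = b' \<oplus> r' \<otimes> u"
      unfolding mem_ideal_insert[OF uc iJ] by blast
    note bc = ideal.Icarr[OF iJ b(1)] ideal.Icarr[OF iJ b'(1)]
    \<comment> \<open>The coefficient of \<open>u\<close> becomes a unit after localization because
      \<open>P\<close> carries \<open>u\<close> into \<open>J\<close>.\<close>
    have rP: "r \<notin> P"
    proof
      assume "r \<in> P"
      hence "r \<otimes> u \<in> J" using colP by (auto simp: colon_def)
      hence "s \<otimes> e \<in> J" using b ideal_add_closed[OF iJ] by simp
      thus False using saturatedD[OF contracted_saturated[OF J] s(1,2) ec(1)] e by blast
    qed
    \<comment> \<open>Cross-multiplication cancels \<open>u\<close> and leaves a combination of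
      \<open>b\<close> and \<open>b'\<close>.\<close>
    have "(r \<otimes> s') \<otimes> e' \<ominus> (r' \<otimes> s) \<otimes> e = r \<otimes> (s' \<otimes> e') \<ominus> r' \<otimes> (s \<otimes> e)"
      using b b' s s' ec by (simp add: m_assoc)
    also have "\<dots> = r \<otimes> b' \<ominus> r' \<otimes> b"
      unfolding b(3) b'(3) using b(2) b'(2) bc uc by algebra
    also have "\<dots> \<in> J" using b b' by (simp add: ideal_closed[OF iJ])
    finally show "\<exists>s\<in>carrier R - P. \<exists>r\<in>carrier R. s \<otimes> e' \<ominus> r \<otimes> e \<in> J"
      using primeideal_compl_mult[OF P b(2) s'(1) rP s'(2)] b(2) b'(2) s s'
      by (intro bexI[of _ "r \<otimes> s'"] bexI[of _ "r' \<otimes> s"]) auto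
  qed
  ultimately show ?thesis using that E by blast
qed

text \<open>Ascending chains stop, so finitely many simple steps lead from \<open>J\<close> to
  \<open>F\<close>; \<open>min\<close> is inherited by larger ideals. The descending chain condition
  needed later is a consequence of this series.\<close>

lemma composition_series:
  assumes P: "primeideal P R" and J: "contracted P J" and F: "contracted P F" and "J \<subseteq> F"
    and min: "\<And>Q. \<lbrakk>primeideal Q R; J \<subseteq> Q; Q \<subseteq> P\<rbrakk> \<Longrightarrow> Q = P"
  shows "(J, F) \<in> (simple_rel P)\<^sup>*"
  using J \<open>J \<subseteq> F\<close> min
proof (induction J rule: wf_induct_rule[OF wf_ideals])
  case (1 J)
  show ?case
  proof (cases "J = F")
    case False
    hence JF: "J \<subset> F" using 1 by blast
    obtain E where E: "contracted P E" "simple_ext P J E" "E \<subseteq> F"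
      by (rule exists_simple_ext[OF P 1(2) F JF]) (rule 1(4))
    hence JE: "J \<subset> E" by (simp add: simple_ext_def)
    have "(E, F) \<in> (simple_rel P)\<^sup>*"
    proof (rule 1(1))
      show "(E, J) \<in> {(J', J). ideal J R \<and> ideal J' R \<and> J \<subset> J'}"
        using JE E(1) 1(2) by (simp add: contracted_def)
      show "Q = P" if "primeideal Q R" "E \<subseteq> Q" "Q \<subseteq> P" for Q
        using 1(4)[of Q] that JE by blast
    qed (use E in auto)
    moreover have "(J, E) \<in> simple_rel P" using 1(2) E by (simp add: simple_rel_def)
    ultimately show ?thesis by (rule converse_rtrancl_into_rtrancl[rotated])
  qed simp
qed

text \<open>The length over \<open>Q\<close> of the localization at \<open>P\<close>: an ideal is measured by the number of its
  jumps along a fixed composition series from \<open>Q\<close> to \<open>R\<close>.\<close>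

lemma exists_length:
  assumes P: "primeideal P R" and Q: "contracted P Q"
    and min: "\<And>Q'. \<lbrakk>primeideal Q' R; Q \<subseteq> Q'; Q' \<subseteq> P\<rbrakk> \<Longrightarrow> Q' = P"
  obtains len :: "'a set \<Rightarrow> nat" where
    "\<And>E E'. \<lbrakk>contracted P E; contracted P E'; Q \<subseteq> E; E \<subset> E'\<rbrakk> \<Longrightarrow> len E < len E'"
    "\<And>E E'. \<lbrakk>contracted P E; contracted P E'; simple_ext P E E'\<rbrakk> \<Longrightarrow> len E' \<le> Suc (len E)"
proof -
  have "(Q, carrier R) \<in> (simple_rel P)\<^sup>*"
    by (rule composition_series[OF P Q contracted_carrier _ min])
       (use ideal_subset_carrier[OF contracted_ideal[OF Q]] in auto)
  then obtain k f where f: "f 0 = Q" "f k = carrier R"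
    and step: "\<And>i. i < k \<Longrightarrow> (f i, f (Suc i)) \<in> simple_rel P"
    unfolding rtrancl_power relpow_fun_conv by blast
  have con: "contracted P (f i)" if "i \<le> k" for i
    using that step[of i] f(2) contracted_carrier by (cases "i = k") (auto simp: simple_rel_def)
  note fid = contracted_ideal[OF con] and fsat = contracted_saturated[OF con]
  have sim: "simple_ext P (f i) (f (Suc i))" if "i < k" for i
    using step[OF that] by (simp add: simple_rel_def)
  have mono: "f i \<subseteq> f j" if "i \<le> j" "j \<le> k" for i j
    using that
  proof (induction j)
    case (Suc j)
    show ?case
    proof (cases "i = Suc j")
      case False
      thus ?thesis using Suc sim[of j] by (auto simp: simple_ext_def)
    qed simp
  qed simp
  \<comment> \<open>After localization the quotient of \<open>f (Suc i)\<close> by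
    \<open>f i\<close> is simple, so the image of \<open>E\<close> in it is zero or everything;
    \<open>c E\<close> collects the indices where it is not zero.\<close>
  define c where "c E = {i. i < k \<and> (\<exists>e\<in>E. e \<in> f (Suc i) \<and> e \<notin> f i)}" for E
  have fin: "finite (c E)" for E unfolding c_def by simp
  show ?thesis
  proof (rule that[of "\<lambda>E. card (c E)"])
    fix E E' assume E: "contracted P E" and E': "contracted P E'" and QE: "Q \<subseteq> E" and EE': "E \<subset> E'"
    note iE = contracted_ideal[OF E] and iE' = contracted_ideal[OF E']
    have sub: "c E \<subseteq> c E'" using EE' unfolding c_def by blast
    \<comment> \<open>The first place where \<open>E'\<close> shows an element outside
      \<open>E\<close>. The step just below is a jump of \<open>E'\<close> only: a jump of
      \<open>E\<close> there would, by simplicity, put a multiple \<open>s \<otimes> e'\<close> with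
      \<open>s\<close> outside \<open>P\<close> into \<open>E\<close>.\<close>
    define j where "j = (LEAST i. f i \<inter> (E' - E) \<noteq> {})"
    have kx: "f k \<inter> (E' - E) \<noteq> {}" using EE' ideal_subset_carrier[OF iE'] f(2) by blast
    have j: "f j \<inter> (E' - E) \<noteq> {}" unfolding j_def by (rule LeastI[of _ k]) (rule kx)
    have jk: "j \<le> k" unfolding j_def by (rule Least_le) (rule kx)
    have "j \<noteq> 0" using j f(1) QE by (metis Diff_disjoint disjoint_iff subsetD DiffD2)
    then obtain i where i: "j = Suc i" by (cases j) auto
    hence ik: "i < k" using jk by simp
    have least: "f i \<inter> (E' - E) = {}"
      using not_less_Least[of i "\<lambda>i. f i \<inter> (E' - E) \<noteq> {}"] i j_def by auto
    from j i obtain e' where e': "e' \<in> f (Suc i)" "e' \<in> E'" "e' \<notin> E" by blast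
    hence e'i: "e' \<notin> f i" using least by blast
    have e'c: "e' \<in> carrier R" using e' ideal.Icarr[OF iE'] by blast
    have "i \<in> c E'" using e' e'i ik unfolding c_def by blast
    moreover have "i \<notin> c E"
    proof
      assume "i \<in> c E"
      then obtain e where e: "e \<in> E" "e \<in> f (Suc i)" "e \<notin> f i" unfolding c_def by blast
      obtain s r where s: "s \<in> carrier R" "s \<notin> P" "r \<in> carrier R" "s \<otimes> e' \<ominus> r \<otimes> e \<in> f i"
        using simple_extD[OF sim[OF ik] e(2,3) e'(1)] .
      have re: "r \<otimes> e \<in> E" using s(3) e(1) ideal.I_l_closed[OF iE] by blast
      have se': "s \<otimes> e' \<in> E'" using s(1) e'(2) ideal.I_l_closed[OF iE'] by blast
      have "s \<otimes> e' \<ominus> r \<otimes> e \<in> E'" using re se' EE' ideal_minus_closed[OF iE'] by blast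
      hence "s \<otimes> e' \<ominus> r \<otimes> e \<in> E" using s(4) least by blast
      hence "s \<otimes> e' \<in> E" using ideal_minus_cancel[OF iE _ re] s(1) e'c by simp
      thus False using saturatedD[OF contracted_saturated[OF E] s(1,2) e'c] e'(3) by blast
    qed
    ultimately have "c E \<subset> c E'" using sub by blast
    thus "card (c E) < card (c E')" by (rule psubset_card_mono[OF fin])
  next
    fix E E' assume E: "contracted P E" and E': "contracted P E'" and S: "simple_ext P E E'"
    note iE = contracted_ideal[OF E] and iE' = contracted_ideal[OF E']
    \<comment> \<open>Two new jumps \<open>i < j\<close> cannot coexist: \<open>d\<close> and
      \<open>d'\<close> are proportional modulo \<open>E\<close>, and as \<open>d\<close> lies in
      \<open>f j\<close>, the element \<open>s \<otimes> d' \<ominus> r \<otimes> d\<close> of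
      \<open>E\<close> would jump at \<open>j\<close> too.\<close>
    have no: False if ij: "i \<in> c E'" "i \<notin> c E" "j \<in> c E'" "j \<notin> c E" "i < j" for i j
    proof -
      from ij(1) obtain d where d: "d \<in> E'" "d \<in> f (Suc i)" "d \<notin> f i" "i < k" unfolding c_def by blast
      from ij(3) obtain d' where d': "d' \<in> E'" "d' \<in> f (Suc j)" "d' \<notin> f j" "j < k" unfolding c_def by blast
      have "d \<notin> E" using d ij(2) unfolding c_def by blast
      then obtain s r where s: "s \<in> carrier R" "s \<notin> P" "r \<in> carrier R" "s \<otimes> d' \<ominus> r \<otimes> d \<in> E"
        using simple_extD[OF S d(1) _ d'(1)] by metis
      have dj: "d \<in> f j" using mono[of "Suc i" j] ij(5) d'(4) d(2) by auto
      note fj = fid[OF less_imp_le[OF d'(4)]] and fj' = fid[OF Suc_leI[OF d'(4)]]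
      have d'c: "d' \<in> carrier R" using d'(1) ideal.Icarr[OF iE'] by blast
      have rd: "r \<otimes> d \<in> f j" using dj s(3) ideal.I_l_closed[OF fj] by blast
      have "s \<otimes> d' \<ominus> r \<otimes> d \<in> f (Suc j)"
        using rd mono[of j "Suc j"] d' s(1) ideal.I_l_closed[OF fj'] ideal_minus_closed[OF fj']
        by (metis Suc_leI le_SucI le_refl subsetD)
      moreover have "s \<otimes> d' \<ominus> r \<otimes> d \<notin> f j"
      proof
        assume "s \<otimes> d' \<ominus> r \<otimes> d \<in> f j"
        hence "s \<otimes> d' \<in> f j" using ideal_minus_cancel[OF fj _ rd] s(1) d'c by simp
        thus False using saturatedD[OF fsat[OF less_imp_le[OF d'(4)]] s(1,2) d'c] d'(3) by blast
      qed
      ultimately have "j \<in> c E" using s(4) d'(4) unfolding c_def by blast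
      thus False using ij(4) by blast
    qed
    have "i = j" if "i \<in> c E' - c E" "j \<in> c E' - c E" for i j
      using no[of i j] no[of j i] that by (metis DiffD1 DiffD2 nat_neq_iff)
    hence "card (c E' - c E) \<le> 1"
      using fin by (simp add: card_le_Suc0_iff_eq)
    moreover have "card (c E') \<le> card (c E \<union> (c E' - c E))" by (rule card_mono) (auto simp: fin)
    moreover have "card (c E \<union> (c E' - c E)) \<le> card (c E) + card (c E' - c E)" by (rule card_Un_le)
    ultimately show "card (c E') \<le> Suc (card (c E))" by linarith
  qed
qed

text \<open>The last hypothesis says \<open>M \<subseteq> saturation P (L + P M)\<close>.\<close>

lemma nakayama:
  assumes P: "primeideal P R" and M: "ideal M R" and L: "ideal L R"
    and step: "\<And>L'. \<lbrakk>ideal L' R; L \<subseteq> L'; \<And>a g. \<lbrakk>a \<in> P; g \<in> M\<rbrakk> \<Longrightarrow> a \<otimes> g \<in> L'\<rbrakk>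
                 \<Longrightarrow> M \<subseteq> saturation P L'"
  shows "M \<subseteq> saturation P L"
proof (rule ccontr)
  assume not: "\<not> M \<subseteq> saturation P L"
  note iP = primeideal_ideal[OF P]
  let ?F = "{L'. ideal L' R \<and> L \<subseteq> L' \<and> \<not> M \<subseteq> saturation P L'}"
  have ne: "?F \<noteq> {}" using not L by blast
  obtain L' where L': "L' \<in> ?F" "\<And>K. \<lbrakk>K \<in> ?F; L' \<subseteq> K\<rbrakk> \<Longrightarrow> K = L'"
    by (rule maximal_ideal_in_family[OF ne]) auto
  have iL': "ideal L' R" and LL': "L \<subseteq> L'" and nM: "\<not> M \<subseteq> saturation P L'" using L'(1) by auto
  note iS = saturation_ideal[OF iL' P]
  have "a \<otimes> g \<in> saturation P L'" if a: "a \<in> P" and g: "g \<in> M" for a g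
  proof (rule ccontr)
    assume na: "a \<otimes> g \<notin> saturation P L'"
    have c: "a \<in> carrier R" "g \<in> carrier R" using a g ideal.Icarr[OF iP] ideal.Icarr[OF M] by blast+
    hence agc: "a \<otimes> g \<in> carrier R" by simp
    have "a \<otimes> g \<notin> L'" using na subset_saturation[OF iL' P] by blast
    hence "L' \<noteq> Idl (insert (a \<otimes> g) L')" using ideal_insert(3)[OF agc iL'] by blast
    hence "M \<subseteq> saturation P (Idl (insert (a \<otimes> g) L'))"
      using L'(2)[of "Idl (insert (a \<otimes> g) L')"] ideal_insert[OF agc iL'] LL' by blast
    then obtain s where s: "s \<in> carrier R" "s \<notin> P" "s \<otimes> g \<in> Idl (insert (a \<otimes> g) L')"
      using g unfolding saturation_def by blast
    then obtain l r where l: "l \<in> L'" "r \<in> carrier R" "s \<otimes> g = l \<oplus> r \<otimes> (a \<otimes> g)"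
      unfolding mem_ideal_insert[OF agc iL'] by blast
    have lc: "l \<in> carrier R" using l ideal.Icarr[OF iL'] by blast
    \<comment> \<open>Since \<open>a\<close> is in \<open>P\<close>, the factor
      \<open>s \<ominus> r \<otimes> a\<close> stays outside \<open>P\<close>; so \<open>g\<close>,
      and with it \<open>a \<otimes> g\<close>, already lies in the saturation of
      \<open>L'\<close>.\<close>
    have "(s \<ominus> r \<otimes> a) \<otimes> g = s \<otimes> g \<ominus> r \<otimes> (a \<otimes> g)" using s(1) l(2) c by algebra
    also have "\<dots> = l" unfolding l(3) using lc l(2) c by algebra
    finally have "(s \<ominus> r \<otimes> a) \<otimes> g \<in> L'" using l by simp
    moreover have "s \<ominus> r \<otimes> a \<notin> P"
      using ideal_minus_cancel[OF iP s(1)] s(2) ideal.I_l_closed[OF iP a l(2)] by blast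
    ultimately have "g \<in> saturation P L'" using s l c unfolding saturation_def by blast
    thus False using na c ideal.I_l_closed[OF iS] by blast
  qed
  hence "M \<subseteq> saturation P (saturation P L')"
    using step[OF iS] LL' subset_saturation[OF iL' P] by blast
  thus False
    using nM saturation_minimal[OF saturated_saturation[OF P] subset_refl] by blast
qed

text \<open>As no prime lies strictly between \<open>A + (x)\<close> and \<open>P\<close>, the localization at \<open>P\<close> has finite
  length modulo \<open>A + (x)\<close>, so the symbolic powers \<open>S n\<close> of \<open>N\<close> stabilize.\<close>

theorem principal_ideal_theorem:
  assumes A: "primeideal A R" and N: "primeideal N R" and P: "primeideal P R"
    and AN: "A \<subset> N" and NP: "N \<subset> P" and x: "x \<in> P" "x \<notin> A"
  obtains Q where "primeideal Q R" "A \<subset> Q" "x \<in> Q" "Q \<subset> P"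
proof (rule ccontr)
  assume contra: "\<not> thesis"
  note iA = primeideal_ideal[OF A] and iN = primeideal_ideal[OF N] and iP = primeideal_ideal[OF P]
  have xc: "x \<in> carrier R" using x ideal.Icarr[OF iP] by blast
  \<comment> \<open>Failure of the claim makes \<open>P\<close> minimal over \<open>A + (x)\<close>,
    while \<open>N\<close> shows that \<open>P\<close> has height at least two over
    \<open>A\<close>.\<close>
  have min: "Q = P" if "primeideal Q R" "A \<subseteq> Q" "x \<in> Q" "Q \<subseteq> P" for Q
  proof -
    have "A \<subset> Q" using that x by blast
    thus ?thesis using contra that(1,3,4) \<open>\<And>Q. \<lbrakk>primeideal Q R; A \<subset> Q; x \<in> Q; Q \<subset> P\<rbrakk> \<Longrightarrow> thesis\<close> by blast
  qed
  have xN: "x \<notin> N" using min[OF N] AN NP by blast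
  define S where "S n = saturation N (Idl (ideal_pow R N n \<union> A))" for n
  have un: "ideal_pow R N n \<union> A \<subseteq> carrier R" for n
    using ideal_subset_carrier[OF ideal_pow_ideal[OF iN]] ideal_subset_carrier[OF iA] by blast
  note gid = genideal_ideal[OF un] and gself = genideal_self[OF un]
  have Scon: "contracted N (S n)" for n unfolding S_def by (rule contracted_saturation[OF gid N])
  note iS = contracted_ideal[OF Scon]
  have genS: "Idl (ideal_pow R N n \<union> A) \<subseteq> S n" for n
    unfolding S_def by (rule subset_saturation[OF gid N])
  have AS: "A \<subseteq> S n" and NS: "ideal_pow R N n \<subseteq> S n" for n using genS[of n] gself[of n] by blast+
  have Sdec: "S (Suc n) \<subseteq> S n" for n
    unfolding S_def using ideal_pow_le[OF iN, of n "Suc n"] un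
    by (intro saturation_mono Idl_mono) auto
  \<comment> \<open>All these contain the saturation of \<open>A + (x)\<close>, above which lengths
    are finite, so this descending sequence cannot decrease strictly forever.\<close>
  define E where "E n = saturation P (Idl (insert x (S n)))" for n
  note ins = ideal_insert[OF xc iS]
  have Econ: "contracted P (E n)" for n unfolding E_def by (rule contracted_saturation[OF ins(1) P])
  have insE: "Idl (insert x (S n)) \<subseteq> E n" for n unfolding E_def by (rule subset_saturation[OF ins(1) P])
  have Edec: "E (Suc n) \<subseteq> E n" for n
    unfolding E_def using Sdec[of n] ideal_subset_carrier[OF iS] xc by (intro saturation_mono Idl_mono) auto
  let ?Q = "saturation P (Idl (insert x A))"
  note insA = ideal_insert[OF xc iA]
  have Q: "contracted P ?Q" by (rule contracted_saturation[OF insA(1) P])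
  have QE: "?Q \<subseteq> E n" for n
    unfolding E_def using AS[of n] ideal_subset_carrier[OF iS] xc by (intro saturation_mono Idl_mono) auto
  have Qmin: "Q' = P" if "primeideal Q' R" "?Q \<subseteq> Q'" "Q' \<subseteq> P" for Q'
    using min[OF that(1)] that insA subset_saturation[OF insA(1) P] by blast
  obtain len :: "'a set \<Rightarrow> nat" where
    len: "\<And>E E'. \<lbrakk>contracted P E; contracted P E'; ?Q \<subseteq> E; E \<subset> E'\<rbrakk> \<Longrightarrow> len E < len E'"
    using exists_length[OF P Q Qmin] by metis
  obtain n where n: "E (Suc n) = E n"
  proof (rule ccontr)
    assume "\<not> thesis"
    hence "E (Suc n) \<subset> E n" for n using Edec that by blast
    hence dec: "len (E (Suc n)) < len (E n)" for n using len[OF Econ Econ QE] by blast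
    have "len (E n) + n \<le> len (E 0)" for n
    proof (induction n)
      case (Suc n) thus ?case using dec[of n] by linarith
    qed simp
    from this[of "Suc (len (E 0))"] show False by linarith
  qed
  have "S n \<subseteq> saturation P (S (Suc n))"
  proof (rule nakayama[OF P iS iS])
    fix L' assume L': "ideal L' R" "S (Suc n) \<subseteq> L'" and PS: "\<And>a g. \<lbrakk>a \<in> P; g \<in> S n\<rbrakk> \<Longrightarrow> a \<otimes> g \<in> L'"
    show "S n \<subseteq> saturation P L'"
    proof
      fix y assume y: "y \<in> S n"
      hence yc: "y \<in> carrier R" using ideal.Icarr[OF iS] by blast
      have "y \<in> E (Suc n)" using y insE[of n] ins(2)[of n] n by blast
      then obtain s where s: "s \<in> carrier R" "s \<notin> P" "s \<otimes> y \<in> Idl (insert x (S (Suc n)))"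
        unfolding E_def saturation_def by blast
      then obtain z r where z: "z \<in> S (Suc n)" "r \<in> carrier R" "s \<otimes> y = z \<oplus> r \<otimes> x"
        unfolding mem_ideal_insert[OF xc iS] by blast
      have zc: "z \<in> carrier R" using z ideal.Icarr[OF iS] by blast
      \<comment> \<open>\<open>S n\<close> is saturated at \<open>N\<close> and \<open>x\<close> is
        not in \<open>N\<close>, so \<open>x\<close> can be cancelled and \<open>r\<close> is in
        \<open>S n\<close>. Hence, locally at \<open>P\<close>, \<open>S n\<close> lies in
        \<open>S (Suc n) + P S n\<close>, as Nakayama requires.\<close>
      have "x \<otimes> r = s \<otimes> y \<ominus> z" unfolding z(3) using z(2) zc xc by algebra
      also have "\<dots> \<in> S n"
        using ideal_minus_closed[OF iS ideal.I_l_closed[OF iS y s(1)] subsetD[OF Sdec z(1)]] .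
      finally have "r \<in> S n" using saturatedD[OF contracted_saturated[OF Scon] xc xN z(2)] by blast
      hence "r \<otimes> x \<in> L'" using PS[OF x(1)] m_comm[OF z(2) xc] by simp
      hence "s \<otimes> y \<in> L'" using z L' ideal_add_closed[OF L'(1)] by auto
      thus "y \<in> saturation P L'" using s yc unfolding saturation_def by blast
    qed
  qed
  also have "\<dots> \<subseteq> S (Suc n)"
  proof (rule saturation_minimal[OF _ subset_refl])
    show "saturated P (S (Suc n))"
      using contracted_saturated[OF Scon] NP unfolding saturated_def by blast
  qed
  finally have stable: "S n \<subseteq> S (Suc n)" .
  \<comment> \<open>Nakayama again, now at \<open>N\<close>: modulo \<open>A\<close> the ideals
    \<open>N^n\<close> and \<open>N^(n+1)\<close> agree locally, so both vanish there. As
    \<open>A\<close> is prime, \<open>N\<close> would be contained in \<open>A\<close>.\<close>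
  have "ideal_pow R N n \<subseteq> saturation N A"
  proof (rule nakayama[OF N ideal_pow_ideal[OF iN] iA])
    fix L' assume L': "ideal L' R" "A \<subseteq> L'"
      and NL: "\<And>a g. \<lbrakk>a \<in> N; g \<in> ideal_pow R N n\<rbrakk> \<Longrightarrow> a \<otimes> g \<in> L'"
    have "ideal_pow R N (Suc n) \<subseteq> L'"
      unfolding ideal_pow_Suc
    proof (rule ideal_prod_subsetI[OF L'(1)])
      fix g a assume g: "g \<in> ideal_pow R N n" and a: "a \<in> N"
      have "g \<in> carrier R" "a \<in> carrier R"
        using a g ideal.Icarr[OF iN] ideal.Icarr[OF ideal_pow_ideal[OF iN]] by blast+
      thus "g \<otimes> a \<in> L'" using NL[OF a g] m_comm by simp
    qed
    hence "Idl (ideal_pow R N (Suc n) \<union> A) \<subseteq> L'" using L' by (intro genideal_minimal) auto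
    hence "S (Suc n) \<subseteq> saturation N L'" unfolding S_def by (rule saturation_mono)
    thus "ideal_pow R N n \<subseteq> saturation N L'" using NS stable by blast
  qed
  also have "\<dots> \<subseteq> A"
    using AN by (intro saturation_minimal saturated_prime[OF A]) auto
  finally have pow: "ideal_pow R N n \<subseteq> A" .
  have "N \<subseteq> A"
  proof
    fix y assume y: "y \<in> N"
    have "y [^] n \<in> A" using pow pow_mem_ideal_pow[OF iN y] by blast
    thus "y \<in> A" using prime_pow_mem[OF A] y ideal.Icarr[OF iN] by blast
  qed
  thus False using AN by blast
qed

end

section \<open>Regular systems of parameters\<close>

definition (in cring) prime_rel :: "('a set \<times> 'a set) set" where
  "prime_rel = {(P, Q). primeideal P R \<and> primeideal Q R \<and> P \<subset> Q}"

lemma (in cring) prime_rel_relpow_prime: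
  assumes "(K, P) \<in> prime_rel ^^ n" "primeideal P R"
  shows "primeideal K R"
proof (cases n)
  case (Suc k)
  then obtain Q where "(K, Q) \<in> prime_rel" using assms(1) relpow_Suc_D2 by metis
  thus ?thesis by (simp add: prime_rel_def)
qed (use assms in simp)

text \<open>The chain is corrected from the top downwards: if \<open>x\<close> is not in the prime
  \<open>N\<close> just below \<open>P\<close>, the principal ideal theorem replaces
  \<open>N\<close> by a prime that contains \<open>x\<close>. Passing from \<open>A\<close> to
  \<open>A + (x)\<close> thus costs at most one step of the chain.\<close>

lemma (in noetherian_cring) prime_chain_through:
  assumes "(A, P) \<in> prime_rel ^^ Suc d" "x \<in> P" "x \<notin> A"
  obtains Q where "(Q, P) \<in> prime_rel ^^ d" "A \<subset> Q" "x \<in> Q"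
proof -
  have "\<exists>Q. (Q, P) \<in> prime_rel ^^ d \<and> A \<subset> Q \<and> x \<in> Q"
    using assms
  proof (induction d arbitrary: P)
    case 0
    thus ?case by (auto simp: prime_rel_def)
  next
    case (Suc d)
    from Suc.prems(1) obtain N where N: "(A, N) \<in> prime_rel ^^ Suc d" "(N, P) \<in> prime_rel"
      by (rule relpow_Suc_E)
    from N(1) obtain M where M: "(A, M) \<in> prime_rel ^^ d" "(M, N) \<in> prime_rel"
      by (rule relpow_Suc_E)
    obtain P' where P': "(A, P') \<in> prime_rel ^^ Suc d" "(P', P) \<in> prime_rel" "x \<in> P'"
    proof (cases "x \<in> N")
      case True
      thus ?thesis using N that by blast
    next
      case False
      have pr: "primeideal M R" "primeideal N R" "primeideal P R" "M \<subset> N" "N \<subset> P"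
        using M N by (simp_all add: prime_rel_def)
      have "x \<notin> M" using False pr(4) by blast
      obtain P' where P': "primeideal P' R" "M \<subset> P'" "x \<in> P'" "P' \<subset> P"
        by (rule principal_ideal_theorem[OF pr(1-5) Suc.prems(2) \<open>x \<notin> M\<close>])
      have "(M, P') \<in> prime_rel" "(P', P) \<in> prime_rel" using P' pr by (simp_all add: prime_rel_def)
      with M(1) P'(3) show ?thesis by (intro that[of P']) (auto intro: relpow_Suc_I)
    qed
    obtain Q where "(Q, P') \<in> prime_rel ^^ d" "A \<subset> Q" "x \<in> Q"
      using Suc.IH[OF P'(1,3) Suc.prems(3)] by metis
    thus ?case using P'(2) by (intro exI[of _ Q]) (auto intro: relpow_Suc_I)
  qed
  thus ?thesis using that by metis
qed

section \<open>Units and Nakayama in a local ring\<close>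

context noetherian_local_ring begin

lemma m_ideal: "ideal \<mm> R"
  using maximalideal_axioms by (rule maximalideal.axioms(1))

lemma m_prime: "primeideal \<mm> R"
  by (rule maximalideal_prime[OF maximalideal_axioms])

lemma one_notin_m: "\<one> \<notin> \<mm>"
  by (rule primeideal_one_notin[OF m_prime])

lemma m_carr: "a \<in> \<mm> \<Longrightarrow> a \<in> carrier R"
  using ideal.Icarr[OF m_ideal] .

lemma unit_of_notin_m:
  assumes a: "a \<in> carrier R" "a \<notin> \<mm>"
  obtains v where "v \<in> carrier R" "v \<otimes> a = \<one>"
proof -
  have "\<one> \<in> Idl (insert a {\<zero>})"
  proof (rule ccontr)
    assume n1: "\<one> \<notin> Idl (insert a {\<zero>})"
    note ins = ideal_insert[OF a(1) zeroideal]
    let ?F = "{J. ideal J R \<and> a \<in> J \<and> \<one> \<notin> J}"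
    have ne: "?F \<noteq> {}" using n1 ins by blast
    obtain M where M: "M \<in> ?F" "\<And>J. \<lbrakk>J \<in> ?F; M \<subseteq> J\<rbrakk> \<Longrightarrow> J = M"
      by (rule maximal_ideal_in_family[OF ne]) auto
    have "maximalideal M R"
    proof (rule maximalidealI)
      show "ideal M R" using M(1) by simp
      show "carrier R \<noteq> M" using M(1) by auto
      fix J assume J: "ideal J R" "M \<subseteq> J" "J \<subseteq> carrier R"
      show "J = M \<or> J = carrier R"
        using M(2)[of J] M(1) J ideal.one_imp_carrier[OF J(1)] by blast
    qed
    hence "M = \<mm>" by (rule unique_maximal)
    thus False using M(1) a(2) by simp
  qed
  then obtain v where "v \<in> carrier R" "\<one> = \<zero> \<oplus> v \<otimes> a"
    unfolding mem_ideal_insert[OF a(1) zeroideal] by auto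
  thus ?thesis using that[of v] a by simp
qed

lemma cancel_unit:
  assumes J: "ideal J R" and s: "s \<in> carrier R" "s \<notin> \<mm>" and r: "r \<in> carrier R" "s \<otimes> r \<in> J"
  shows "r \<in> J"
proof -
  obtain v where v: "v \<in> carrier R" "v \<otimes> s = \<one>" by (rule unit_of_notin_m[OF s])
  have "v \<otimes> (s \<otimes> r) = (v \<otimes> s) \<otimes> r" using v(1) s(1) r(1) by (simp only: m_assoc)
  hence "v \<otimes> (s \<otimes> r) = r" using v r by simp
  thus ?thesis using ideal.I_l_closed[OF J r(2) v(1)] by simp
qed

text \<open>Localizing at \<open>\<mm>\<close> changes nothing, so the machinery for saturated
  ideals applies to all ideals of \<open>R\<close>.\<close>

lemma saturated_m: "ideal J R \<Longrightarrow> saturated \<mm> J"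
  unfolding saturated_def using cancel_unit by blast

lemma contracted_m: "contracted \<mm> J \<longleftrightarrow> ideal J R"
  unfolding contracted_def using saturated_m by blast

lemma saturation_m: "ideal J R \<Longrightarrow> saturation \<mm> J = J"
  using saturation_minimal[OF saturated_m subset_refl] subset_saturation[OF _ m_prime] by blast

lemma proper_ideal_subset_m:
  assumes J: "ideal J R" "\<one> \<notin> J" shows "J \<subseteq> \<mm>"
proof
  fix r assume r: "r \<in> J"
  show "r \<in> \<mm>"
  proof (rule ccontr)
    assume n: "r \<notin> \<mm>"
    have "r \<in> carrier R" using r ideal.Icarr[OF J(1)] by blast
    then show False using cancel_unit[OF J(1) _ n one_closed] r J(2) by simp
  qed
qed

lemma primeideal_subset_m: "primeideal P R \<Longrightarrow> P \<subseteq> \<mm>"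
  by (intro proper_ideal_subset_m primeideal_ideal primeideal_one_notin)

lemma one_minus_notin_m: "a \<in> \<mm> \<Longrightarrow> \<one> \<ominus> a \<notin> \<mm>"
  using ideal_minus_cancel[OF m_ideal one_closed, of a] one_notin_m by blast

lemma nakayama_local:
  assumes "ideal M R" and "ideal L R"
    and step: "\<And>L'. \<lbrakk>ideal L' R; L \<subseteq> L'; \<And>a g. \<lbrakk>a \<in> \<mm>; g \<in> M\<rbrakk> \<Longrightarrow> a \<otimes> g \<in> L'\<rbrakk> \<Longrightarrow> M \<subseteq> L'"
  shows "M \<subseteq> L"
proof -
  have "M \<subseteq> saturation \<mm> L"
  proof (rule nakayama[OF m_prime assms(1,2)])
    fix L' assume "ideal L' R" "L \<subseteq> L'" "\<And>a g. \<lbrakk>a \<in> \<mm>; g \<in> M\<rbrakk> \<Longrightarrow> a \<otimes> g \<in> L'"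
    thus "M \<subseteq> saturation \<mm> L'" using step[of L'] by (simp add: saturation_m)
  qed
  thus ?thesis using saturation_m[OF assms(2)] by simp
qed

text \<open>The quotient \<open>R / K\<close> has a prime chain as long as the number of generators \<open>G\<close> of its
  maximal ideal, so it is regular; the claim is that it is a domain and stays regular modulo
  any \<open>x \<in> G\<close>.\<close>

lemma regular_chain:
  assumes "finite G" "G \<subseteq> carrier R" "ideal K R" "\<mm> = Idl (K \<union> G)" "K \<subseteq> P"
    "(P, \<mm>) \<in> prime_rel ^^ card G"
  shows "P = K \<and> (\<forall>x\<in>G. x \<notin> K \<and> (Idl (insert x K), \<mm>) \<in> prime_rel ^^ (card G - 1))"
  using assms
proof (induction "card G" arbitrary: G K P)
  case 0
  hence "G = {}" by simp
  thus ?case using 0 Idl_ideal by simp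
next
  case (Suc d)
  note K = Suc.prems(3)
  have main: "P = K \<and> x \<notin> K \<and> (Idl (insert x K), \<mm>) \<in> prime_rel ^^ d" if x: "x \<in> G" for x
  proof -
    have xc: "x \<in> carrier R" using x Suc.prems(2) by blast
    note ins = ideal_insert[OF xc K]
    have iK: "insert x K \<subseteq> carrier R" using xc ideal_subset_carrier[OF K] by blast
    have card: "d = card (G - {x})" using Suc.hyps(2) Suc.prems(1) x by simp
    have Gx: "insert x K \<union> (G - {x}) = K \<union> G" using x by blast
    have m: "\<mm> = Idl (Idl (insert x K) \<union> (G - {x}))"
      using Idl_Un_Idl[OF iK, of "G - {x}"] Suc.prems(2,4) Gx by auto
    have xm: "x \<in> \<mm>"
      unfolding Suc.prems(4) using x genideal_self[of "K \<union> G"] ideal_subset_carrier[OF K] Suc.prems(2) by blast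
    \<comment> \<open>The induction hypothesis for \<open>K + (x)\<close> and the remaining
      generators: a prime above this ideal from which \<open>\<mm>\<close> is still \<open>d\<close>
      steps away must be equal to it.\<close>
    have IH: "P' = Idl (insert x K)"
      if "Idl (insert x K) \<subseteq> P'" "(P', \<mm>) \<in> prime_rel ^^ d" for P'
      using Suc.hyps(1)[OF card _ _ ins(1) m that(1)] that(2) card Suc.prems(1,2) by auto
    have prP: "primeideal P R" by (rule prime_rel_relpow_prime[OF Suc.prems(6) m_prime])
    note iP = primeideal_ideal[OF prP]
    have chain: "(P, \<mm>) \<in> prime_rel ^^ Suc d" using Suc.prems(6) Suc.hyps(2) by simp
    \<comment> \<open>Otherwise the next prime \<open>P1\<close> of the chain would lie above
      \<open>K + (x)\<close>, hence equal it, and so be contained in \<open>P\<close>.\<close>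
    have xP: "x \<notin> P"
    proof
      assume xP: "x \<in> P"
      hence sub: "Idl (insert x K) \<subseteq> P" using Suc.prems(5) by (intro genideal_minimal[OF iP]) auto
      obtain P1 where P1: "(P, P1) \<in> prime_rel" "(P1, \<mm>) \<in> prime_rel ^^ d"
        using relpow_Suc_D2[OF chain] by blast
      hence "P \<subset> P1" by (simp add: prime_rel_def)
      thus False using IH[OF _ P1(2)] sub by blast
    qed
    \<comment> \<open>The shortened chain starts above \<open>K + (x)\<close>, so \<open>Q\<close>
      equals this ideal, which is therefore prime.\<close>
    obtain Q where Q: "(Q, \<mm>) \<in> prime_rel ^^ d" "P \<subset> Q" "x \<in> Q"
      by (rule prime_chain_through[OF chain xm xP])
    have iQ: "ideal Q R" by (rule primeideal_ideal[OF prime_rel_relpow_prime[OF Q(1) m_prime]])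
    have "Idl (insert x K) \<subseteq> Q" using Q Suc.prems(5) by (intro genideal_minimal[OF iQ]) auto
    hence QK: "Q = Idl (insert x K)" using IH Q(1) by blast
    \<comment> \<open>\<open>P\<close> lies in \<open>K + (x)\<close> and \<open>x\<close> is not in
      the prime \<open>P\<close>, so each \<open>y\<close> in \<open>P\<close> is
      \<open>k + a x\<close> with \<open>a\<close> in \<open>P\<close>. Thus \<open>P\<close> lies
      in \<open>K + \<mm> P\<close>, and Nakayama applies.\<close>
    have "P \<subseteq> K"
    proof (rule nakayama_local[OF iP K])
      fix L assume L: "ideal L R" "K \<subseteq> L" "\<And>a g. \<lbrakk>a \<in> \<mm>; g \<in> P\<rbrakk> \<Longrightarrow> a \<otimes> g \<in> L"
      show "P \<subseteq> L"
      proof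
        fix y assume y: "y \<in> P"
        hence "y \<in> Idl (insert x K)" using Q(2) QK by blast
        then obtain k a where k: "k \<in> K" "a \<in> carrier R" "y = k \<oplus> a \<otimes> x"
          unfolding mem_ideal_insert[OF xc K] by blast
        have kc: "k \<in> carrier R" "k \<in> P" using k ideal.Icarr[OF K] Suc.prems(5) by blast+
        have "a \<otimes> x \<in> P" using ideal_add_cancel[OF iP _ kc(2), of "a \<otimes> x"] y k xc kc
          by (simp add: a_comm)
        hence "a \<in> P" using primeideal.I_prime[OF prP k(2) xc] xP by blast
        hence "a \<otimes> x \<in> L" using L(3)[OF xm] m_comm[OF k(2) xc] by simp
        thus "y \<in> L" using k L(1,2) ideal_add_closed[OF L(1)] by auto
      qed
    qed
    hence "P = K" using Suc.prems(5) by blast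
    thus ?thesis using xP Q(1) QK by blast
  qed
  obtain x0 where "x0 \<in> G" using Suc.hyps(2) by (metis card.empty ex_in_conv nat.distinct(1))
  show ?case using main[OF \<open>x0 \<in> G\<close>] main Suc.hyps(2)[symmetric] by simp
qed

end

lemma (in noetherian_ring) min_num_gens_generators:
  assumes "ideal I R"
  obtains A where "A \<subseteq> carrier R" "finite A" "card A = min_num_gens R I" "I = Idl A"
proof -
  obtain A where A: "A \<subseteq> carrier R" "finite A" "I = Idl A" using finetely_gen[OF assms] by blast
  have "\<exists>A. A \<subseteq> carrier R \<and> finite A \<and> card A = min_num_gens R I \<and> I = Idl A"
    unfolding min_num_gens_def by (rule LeastI[of _ "card A"]) (use A in blast)
  thus ?thesis using that by blast
qed

text \<open>A finite supremum in \<open>enat\<close> is a maximum; this turns the Krull dimension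
  into an actual chain of primes.\<close>

lemma Sup_enat_mem: "\<lbrakk>S \<noteq> {}; Sup S = enat d\<rbrakk> \<Longrightarrow> enat d \<in> S"
  using Max_in[of S] by (metis Sup_enat_def enat.distinct(1) infinity_ileE order_refl)

text \<open>\<open>G_chain\<close> carries the regularity: it makes zero a prime ideal and the
  dimension at least \<open>card G\<close>.\<close>

locale regular_system = noetherian_local_ring +
  fixes G
  assumes finite_G: "finite G" and G_carrier: "G \<subseteq> carrier R" and m_gen: "\<mm> = Idl G"
    and G_chain: "({\<zero>}, \<mm>) \<in> prime_rel ^^ card G"

lemma (in noetherian_local_ring) regular_systemI:
  assumes "regular_local_ring R \<mm>"
  obtains G where "regular_system R \<mm> G"
proof -
  let ?d = "min_num_gens R \<mm>"
  have dim: "krull_dim R = enat ?d" using assms by (simp add: regular_local_ring_def)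
  obtain G where G: "G \<subseteq> carrier R" "finite G" "card G = ?d" "\<mm> = Idl G"
    by (rule min_num_gens_generators[OF m_ideal])
  let ?S = "{enat n | n. \<exists>P. (\<forall>i\<le>n. primeideal (P i) R) \<and> (\<forall>i<n. P i \<subset> P (Suc i))}"
  have "enat 0 \<in> ?S" using m_prime by auto
  hence "?S \<noteq> {}" by blast
  hence "enat ?d \<in> ?S" using dim unfolding krull_dim_def by (intro Sup_enat_mem)
  then obtain P where P: "\<And>i. i \<le> ?d \<Longrightarrow> primeideal (P i) R" "\<And>i. i < ?d \<Longrightarrow> P i \<subset> P (Suc i)" by auto
  \<comment> \<open>The last prime is only known to lie in \<open>\<mm>\<close>; replacing it by
    \<open>\<mm>\<close> keeps the chain strict and gives it the required endpoint.\<close>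
  define P' where "P' i = (if i = ?d then \<mm> else P i)" for i
  have "(P' i, P' (Suc i)) \<in> prime_rel" if "i < ?d" for i
    using P(1)[of i] P(1)[of "Suc i"] P(2)[OF that] that m_prime primeideal_subset_m[of "P (Suc i)"]
    by (auto simp: prime_rel_def P'_def)
  hence "(P' 0, P' ?d) \<in> prime_rel ^^ ?d" unfolding relpow_fun_conv by blast
  hence ch: "(P' 0, \<mm>) \<in> prime_rel ^^ card G" using G(3) by (simp add: P'_def)
  have "primeideal (P' 0) R" by (rule prime_rel_relpow_prime[OF ch m_prime])
  hence z: "{\<zero>} \<subseteq> P' 0" using ideal_zero_closed[OF primeideal_ideal] by blast
  have m: "\<mm> = Idl ({\<zero>} \<union> G)"
  proof (rule subset_antisym)
    show "\<mm> \<subseteq> Idl ({\<zero>} \<union> G)" unfolding G(4) using G(1) by (intro Idl_mono) auto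
    show "Idl ({\<zero>} \<union> G) \<subseteq> \<mm>"
      using ideal_zero_closed[OF m_ideal] genideal_self[OF G(1)] G(4) by (intro genideal_minimal[OF m_ideal]) auto
  qed
  \<comment> \<open>Nothing is known about the bottom of the chain until
    \<open>regular_chain\<close> with \<open>K = 0\<close> forces it to be zero.\<close>
  have "P' 0 = {\<zero>}" using regular_chain[OF G(2,1) zeroideal m z ch] by blast
  hence "regular_system R \<mm> G"
    using ch G(1,2,4) by unfold_locales auto
  thus ?thesis by (rule that)
qed

context regular_system begin

text \<open>Parameters are adjoined to zero one at a time, and \<open>regular_chain\<close> applies
  at each stage. Since every subset of \<open>G\<close> is covered, the parameters form a regular
  sequence in any order.\<close>

lemma Idl_parameters:
  assumes "Y \<subseteq> G"
  shows "(Idl Y, \<mm>) \<in> prime_rel ^^ card (G - Y) \<and> (\<forall>z\<in>G - Y. z \<notin> Idl Y)"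
proof -
  have "finite Y" using assms finite_G by (rule finite_subset)
  have step: "\<forall>z\<in>G - Y. z \<notin> Idl Y \<and> (Idl (insert z (Idl Y)), \<mm>) \<in> prime_rel ^^ (card (G - Y) - 1)"
    if Y: "Y \<subseteq> G" and ch: "(Idl Y, \<mm>) \<in> prime_rel ^^ card (G - Y)" for Y
  proof -
    have Yc: "Y \<subseteq> carrier R" using Y G_carrier by blast
    have "Idl (Idl Y \<union> (G - Y)) = Idl (Y \<union> (G - Y))"
      by (rule Idl_Un_Idl) (use Yc G_carrier in auto)
    hence "\<mm> = Idl (Idl Y \<union> (G - Y))" using Y m_gen by (simp add: Un_absorb1)
    from regular_chain[OF _ _ genideal_ideal[OF Yc] this subset_refl ch]
    show ?thesis using finite_G G_carrier by auto
  qed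
  from \<open>finite Y\<close> assms have "(Idl Y, \<mm>) \<in> prime_rel ^^ card (G - Y)"
  proof (induction Y)
    case empty
    have "Idl {} = {\<zero>}"
      using genideal_minimal[OF zeroideal, of "{}"] ideal_zero_closed[OF genideal_ideal, of "{}"] by blast
    thus ?case using G_chain by simp
  next
    case (insert z Y)
    have zY: "z \<in> G - Y" using insert by blast
    have Yc: "Y \<subseteq> carrier R" "z \<in> carrier R" using insert G_carrier by auto
    have "(Idl (insert z (Idl Y)), \<mm>) \<in> prime_rel ^^ (card (G - Y) - 1)"
      using step[of Y] insert zY by blast
    moreover have "Idl (insert z (Idl Y)) = Idl (insert z Y)"
      using Idl_Un_Idl[of Y "{z}"] Yc by simp
    moreover have "card (G - Y) - 1 = card (G - insert z Y)"
      using zY finite_G by (metis Diff_insert card_Diff_singleton)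
    ultimately show ?case by simp
  qed
  thus ?thesis using step[OF assms] by blast
qed

lemma prime_Idl_parameters: "Y \<subseteq> G \<Longrightarrow> primeideal (Idl Y) R"
  using Idl_parameters prime_rel_relpow_prime m_prime by blast

lemma parameter_notin_Idl: "\<lbrakk>Y \<subseteq> G; z \<in> G; z \<notin> Y\<rbrakk> \<Longrightarrow> z \<notin> Idl Y"
  using Idl_parameters by blast

lemma regular_domain: "domain R"
proof (rule zeroprimeideal_domainI)
  show "primeideal {\<zero>} R" by (rule prime_rel_relpow_prime[OF G_chain m_prime])
qed

end

section \<open>Frobenius powers and ideals generated by powers of parameters\<close>

lemma (in cring) binomial:
  assumes a: "a \<in> carrier R" and b: "b \<in> carrier R"
  shows "(a \<oplus> b) [^] (n::nat) = (\<Oplus>k\<in>{..n}. add_pow R (n choose k) (b [^] k \<otimes> a [^] (n - k)))"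
proof (induction n)
  case 0
  show ?case by simp
next
  case (Suc n)
  define t where "t n k = add_pow R (n choose k) (b [^] k \<otimes> a [^] (n - k))" for n k :: nat
  have tc [simp]: "t n k \<in> carrier R" for n k unfolding t_def using a b by simp
  have pascal: "t (Suc n) (Suc k) = t n (Suc k) \<otimes> a \<oplus> t n k \<otimes> b" if "k \<le> n" for k
  proof -
    let ?u = "b [^] Suc k \<otimes> a [^] (n - k)"
    have u: "?u \<in> carrier R" using a b by simp
    have "t n k \<otimes> b = add_pow R (n choose k) ?u"
      unfolding t_def using a b by (simp add: add_pow_ldistr add_pow_rdistr m_ac)
    moreover have "t n (Suc k) \<otimes> a = add_pow R (n choose Suc k) ?u"
    proof (cases "k = n")
      case True
      thus ?thesis unfolding t_def using a b by (simp add: binomial_eq_0)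
    next
      case False
      hence "n - k = Suc (n - Suc k)" using that by simp
      thus ?thesis unfolding t_def using a b by (simp add: add_pow_ldistr add_pow_rdistr m_ac)
    qed
    moreover have "t (Suc n) (Suc k) = add_pow R ((n choose Suc k) + (n choose k)) ?u"
      unfolding t_def by (simp add: add.commute)
    ultimately show ?thesis using add.nat_pow_mult[OF u] by simp
  qed
  \<comment> \<open>This zero term extends the first of the two sums up to \<open>Suc n\<close>, so
    that it can be shifted and matched with the second by Pascal's rule.\<close>
  have top: "t n (Suc n) = \<zero>" unfolding t_def by (simp add: binomial_eq_0)
  have zero: "t (Suc n) 0 = t n 0 \<otimes> a" unfolding t_def using a b by simp
  have "(a \<oplus> b) [^] Suc n = (\<Oplus>k\<in>{..n}. t n k) \<otimes> (a \<oplus> b)" using Suc by (simp add: t_def)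
  also have "\<dots> = (\<Oplus>k\<in>{..n}. t n k) \<otimes> a \<oplus> (\<Oplus>k\<in>{..n}. t n k) \<otimes> b"
    using a b by (simp add: r_distr finsum_closed)
  also have "(\<Oplus>k\<in>{..n}. t n k) \<otimes> a = (\<Oplus>k\<in>{..n}. t n k \<otimes> a)"
    using a by (intro finsum_ldistr) auto
  also have "(\<Oplus>k\<in>{..n}. t n k) \<otimes> b = (\<Oplus>k\<in>{..n}. t n k \<otimes> b)"
    using b by (intro finsum_ldistr) auto
  also have "(\<Oplus>k\<in>{..n}. t n k \<otimes> a) = (\<Oplus>k\<in>{..Suc n}. t n k \<otimes> a)"
    using a by (subst finsum_Suc) (auto simp: top finsum_closed)
  also have "\<dots> = (\<Oplus>k\<in>{..n}. t n (Suc k) \<otimes> a) \<oplus> t n 0 \<otimes> a"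
    using a by (intro finsum_Suc2) auto
  also have "\<dots> \<oplus> (\<Oplus>k\<in>{..n}. t n k \<otimes> b)
      = ((\<Oplus>k\<in>{..n}. t n (Suc k) \<otimes> a) \<oplus> (\<Oplus>k\<in>{..n}. t n k \<otimes> b)) \<oplus> t n 0 \<otimes> a"
    using a b by (simp add: a_ac finsum_closed)
  also have "(\<Oplus>k\<in>{..n}. t n (Suc k) \<otimes> a) \<oplus> (\<Oplus>k\<in>{..n}. t n k \<otimes> b)
      = (\<Oplus>k\<in>{..n}. t n (Suc k) \<otimes> a \<oplus> t n k \<otimes> b)"
    using a b by (intro finsum_addf[symmetric]) auto
  also have "\<dots> = (\<Oplus>k\<in>{..n}. t (Suc n) (Suc k))"
    using a b by (intro finsum_cong') (auto simp: pascal)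
  also have "\<dots> \<oplus> t n 0 \<otimes> a = (\<Oplus>k\<in>{..Suc n}. t (Suc n) k)"
    using a by (subst finsum_Suc2) (auto simp: zero)
  finally show ?case unfolding t_def .
qed

locale frobenius_ring = cring R for R (structure) +
  fixes p :: nat
  assumes prime_p: "Factorial_Ring.prime p" and char_p: "has_characteristic R p"
begin

lemma add_pow_char:
  assumes "p dvd n" "x \<in> carrier R" shows "add_pow R n x = \<zero>"
proof -
  have "add_pow R n x = (add_pow R n \<one>) \<otimes> x" using assms(2) by (simp add: add_pow_ldistr)
  moreover have "add_pow R n \<one> = \<zero>" using assms(1) char_p unfolding has_characteristic_def by blast
  ultimately show ?thesis using assms(2) by simp
qed

lemma frobenius_add_prime:
  assumes a: "a \<in> carrier R" and b: "b \<in> carrier R"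
  shows "(a \<oplus> b) [^] p = a [^] p \<oplus> b [^] p"
proof -
  obtain q where q: "p = Suc (Suc q)"
    using prime_ge_2_nat[OF prime_p] by (metis Suc_1 Suc_le_D le_Suc_ex add_2_eq_Suc)
  define f where "f k = add_pow R (p choose k) (b [^] k \<otimes> a [^] (p - k))" for k :: nat
  have fc [simp]: "f k \<in> carrier R" for k unfolding f_def using a b by simp
  have f0: "f (Suc i) = \<zero>" if "i \<le> q" for i
    unfolding f_def using a b dvd_choose_prime[OF _ _ _ prime_p, of "Suc i"] that q by (intro add_pow_char) auto
  have "(a \<oplus> b) [^] p = (\<Oplus>k\<in>{..p}. f k)" unfolding f_def by (rule binomial[OF a b])
  also have "\<dots> = f p \<oplus> (\<Oplus>k\<in>{..Suc q}. f k)" unfolding q by (rule finsum_Suc) auto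
  also have "(\<Oplus>k\<in>{..Suc q}. f k) = (\<Oplus>k\<in>{..q}. f (Suc k)) \<oplus> f 0" by (rule finsum_Suc2) auto
  also have "(\<Oplus>k\<in>{..q}. f (Suc k)) = \<zero>" by (rule add.finprod_one_eqI) (auto simp: f0)
  also have "f p \<oplus> (\<zero> \<oplus> f 0) = a [^] p \<oplus> b [^] p"
    unfolding f_def using a b by (simp add: a_comm)
  finally show ?thesis .
qed

lemma frobenius_add:
  assumes a: "a \<in> carrier R" and b: "b \<in> carrier R"
  shows "(a \<oplus> b) [^] (p ^ e) = a [^] (p ^ e) \<oplus> b [^] (p ^ e)"
proof (induction e)
  case (Suc e)
  have pw: "c [^] (p ^ Suc e) = (c [^] (p ^ e)) [^] p" if "c \<in> carrier R" for c
    using that by (simp add: nat_pow_pow mult.commute)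
  show ?case using a b pw Suc frobenius_add_prime by simp
qed (use a b in simp)

text \<open>The \<open>p ^ e\<close>-th power map is a ring endomorphism, and this is the preimage
  of an ideal. Membership of such powers therefore need only be checked on generators.\<close>

lemma frobenius_preimage_ideal:
  assumes L: "ideal L R"
  shows "ideal {r \<in> carrier R. r [^] (p ^ e) \<in> L} R" (is "ideal ?A R")
proof (rule idealI[OF ring_axioms])
  have mult: "x \<otimes> a \<in> ?A" if "a \<in> ?A" "x \<in> carrier R" for a x
    using that ideal.I_l_closed[OF L] by (simp add: nat_pow_distrib)
  show "subgroup ?A (add_monoid R)"
  proof (rule add.subgroupI)
    have "p ^ e > 0" using prime_gt_0_nat[OF prime_p] by simp
    hence "\<zero> \<in> ?A" using ideal_zero_closed[OF L] nat_pow_zero[of "p ^ e"] by simp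
    thus "?A \<noteq> {}" by blast
    fix a assume a: "a \<in> ?A"
    \<comment> \<open>Multiplying by \<open>\<ominus> \<one>\<close> avoids computing the power of a
      negative, whose sign depends on the parity of \<open>p\<close>.\<close>
    have "\<ominus> \<one> \<otimes> a \<in> ?A" using mult[OF a] by simp
    thus "\<ominus> a \<in> ?A" using a by (simp add: l_minus)
    fix b assume "b \<in> ?A"
    thus "a \<oplus> b \<in> ?A" using a ideal_add_closed[OF L] by (simp add: frobenius_add)
  qed blast
  fix a x assume a: "a \<in> ?A" and x: "x \<in> carrier R"
  show "x \<otimes> a \<in> ?A" by (rule mult[OF a x])
  thus "a \<otimes> x \<in> ?A" using a x m_comm by simp
qed

lemma pow_image_carrier: "S \<subseteq> carrier R \<Longrightarrow> (\<lambda>s. s [^] (q::nat)) ` S \<subseteq> carrier R"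
  by auto

lemma frobenius_power_ideal: "A \<subseteq> carrier R \<Longrightarrow> ideal (frobenius_power R A q) R"
  unfolding frobenius_power_def by (intro genideal_ideal pow_image_carrier)

lemma pow_mem_frobenius_power: "\<lbrakk>A \<subseteq> carrier R; a \<in> A\<rbrakk> \<Longrightarrow> a [^] q \<in> frobenius_power R A q"
  unfolding frobenius_power_def using genideal_self[OF pow_image_carrier] by blast

lemma frobenius_power_minimal:
  "\<lbrakk>ideal L R; \<And>a. a \<in> A \<Longrightarrow> a [^] q \<in> L\<rbrakk> \<Longrightarrow> frobenius_power R A q \<subseteq> L"
  unfolding frobenius_power_def by (intro genideal_minimal) auto

lemma frobenius_power_mono:
  "\<lbrakk>A \<subseteq> B; B \<subseteq> carrier R\<rbrakk> \<Longrightarrow> frobenius_power R A q \<subseteq> frobenius_power R B q"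
  unfolding frobenius_power_def by (intro Idl_mono image_mono pow_image_carrier)

lemma pow_mem_of_generators:
  assumes L: "ideal L R" and "S \<subseteq> carrier R" and gen: "\<And>s. s \<in> S \<Longrightarrow> s [^] (p ^ e) \<in> L" and r: "r \<in> Idl S"
  shows "r [^] (p ^ e) \<in> L"
proof -
  have "Idl S \<subseteq> {r \<in> carrier R. r [^] (p ^ e) \<in> L}"
    by (rule genideal_minimal[OF frobenius_preimage_ideal[OF L]]) (use assms in auto)
  thus ?thesis using r by blast
qed

lemma frobenius_power_pow:
  assumes A: "A \<subseteq> carrier R" and a: "a \<in> frobenius_power R A q"
  shows "a [^] (p ^ e) \<in> frobenius_power R A (q * p ^ e)"
proof (rule pow_mem_of_generators[OF frobenius_power_ideal[OF A] pow_image_carrier[OF A] _ a[unfolded frobenius_power_def]])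
  fix s assume "s \<in> (\<lambda>a. a [^] q) ` A"
  then obtain b where "b \<in> A" "s = b [^] q" by blast
  thus "s [^] (p ^ e) \<in> frobenius_power R A (q * p ^ e)"
    using A pow_mem_frobenius_power[OF A, of b "q * p ^ e"] by (auto simp: nat_pow_pow)
qed

end

text \<open>Induction on \<open>n\<close>. If \<open>z r\<close> is in \<open>K + (x^(n+1))\<close>,
  regularity modulo \<open>K + (x)\<close> gives \<open>r = k + a x\<close>; cancelling
  \<open>x\<close> modulo \<open>K\<close> then leaves \<open>z a\<close> in
  \<open>K + (x^n)\<close>.\<close>

lemma (in cring) regular_mod_power:
  assumes K: "ideal K R" and x: "x \<in> carrier R" and z: "z \<in> carrier R"
    and zx: "\<And>r. \<lbrakk>r \<in> carrier R; z \<otimes> r \<in> Idl (insert x K)\<rbrakk> \<Longrightarrow> r \<in> Idl (insert x K)"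
    and xK: "\<And>r. \<lbrakk>r \<in> carrier R; x \<otimes> r \<in> K\<rbrakk> \<Longrightarrow> r \<in> K"
    and r: "r \<in> carrier R" "z \<otimes> r \<in> Idl (insert (x [^] (n::nat)) K)"
  shows "r \<in> Idl (insert (x [^] n) K)"
  using r
proof (induction n arbitrary: r)
  case 0
  have "r = \<zero> \<oplus> r \<otimes> \<one>" using 0 by simp
  thus ?case using 0 ideal_zero_closed[OF K] unfolding nat_pow_0 mem_ideal_insert[OF one_closed K] by blast
next
  case (Suc n)
  have pc: "x [^] m \<in> carrier R" for m :: nat using x by simp
  note mem = mem_ideal_insert[OF pc K] and memx = mem_ideal_insert[OF x K]
  from Suc.prems(2) obtain k' b where k': "k' \<in> K" "b \<in> carrier R" "z \<otimes> r = k' \<oplus> b \<otimes> x [^] Suc n"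
    unfolding mem by blast
  have k'c: "k' \<in> carrier R" using k' ideal.Icarr[OF K] by blast
  have "z \<otimes> r = k' \<oplus> (b \<otimes> x [^] n) \<otimes> x" using k' x k'c by (simp add: m_assoc)
  hence "z \<otimes> r \<in> Idl (insert x K)" using k' pc unfolding memx by blast
  hence "r \<in> Idl (insert x K)" by (rule zx[OF Suc.prems(1)])
  then obtain k a where k: "k \<in> K" "a \<in> carrier R" "r = k \<oplus> a \<otimes> x" unfolding memx by blast
  have kc: "k \<in> carrier R" using k ideal.Icarr[OF K] by blast
  let ?y = "x [^] n"
  have eq: "z \<otimes> (k \<oplus> a \<otimes> x) = k' \<oplus> b \<otimes> (?y \<otimes> x)" using k'(3) k(3) by simp
  have "x \<otimes> (z \<otimes> a \<ominus> b \<otimes> ?y) = z \<otimes> (k \<oplus> a \<otimes> x) \<ominus> z \<otimes> k \<ominus> b \<otimes> (?y \<otimes> x)"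
    using x z k(2) k'(2) kc pc[of n] by algebra
  also have "\<dots> = k' \<ominus> z \<otimes> k" unfolding eq using x z k(2) k'(2) kc k'c pc[of n] by algebra
  also have "\<dots> \<in> K" using k(1) k'(1) z by (simp add: ideal_closed[OF K])
  finally have "z \<otimes> a \<ominus> b \<otimes> ?y \<in> K" by (rule xK[rotated]) (use x z k k' pc in simp)
  moreover have "z \<otimes> a = (z \<otimes> a \<ominus> b \<otimes> ?y) \<oplus> b \<otimes> ?y" using z k(2) k'(2) pc[of n] by algebra
  ultimately have "z \<otimes> a \<in> Idl (insert ?y K)" using k'(2) unfolding mem by blast
  from Suc.IH[OF k(2) this] obtain k2 c where k2: "k2 \<in> K" "c \<in> carrier R" "a = k2 \<oplus> c \<otimes> ?y"
    unfolding mem by blast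
  have k2c: "k2 \<in> carrier R" using k2 ideal.Icarr[OF K] by blast
  have "r = (k \<oplus> k2 \<otimes> x) \<oplus> c \<otimes> (?y \<otimes> x)"
    unfolding k(3) k2(3) using x kc k2c k2(2) pc[of n] by algebra
  hence "r = (k \<oplus> k2 \<otimes> x) \<oplus> c \<otimes> x [^] Suc n" by simp
  moreover have "k \<oplus> k2 \<otimes> x \<in> K" using k(1) k2(1) x by (simp add: ideal_closed[OF K])
  ultimately show ?case using k2(2) unfolding mem by blast
qed

section \<open>Colons and socles of ideals generated by powers of parameters\<close>

context regular_system begin

text \<open>The exponent may vary with the parameter because a colon by one parameter lowers its
  exponent alone.\<close>

definition powers :: "('a \<Rightarrow> nat) \<Rightarrow> 'a set \<Rightarrow> 'a set" where
  "powers a Y = Idl ((\<lambda>x. x [^] a x) ` Y)"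

lemma parameter_carrier: "x \<in> G \<Longrightarrow> x \<in> carrier R"
  using G_carrier by blast

lemma pw_image_carrier: "Y \<subseteq> G \<Longrightarrow> (\<lambda>x. x [^] (a x :: nat)) ` Y \<subseteq> carrier R"
  using G_carrier by auto

lemma powers_ideal: "Y \<subseteq> G \<Longrightarrow> ideal (powers a Y) R"
  unfolding powers_def by (intro genideal_ideal pw_image_carrier)

lemma pow_mem_powers: "\<lbrakk>Y \<subseteq> G; x \<in> Y\<rbrakk> \<Longrightarrow> x [^] a x \<in> powers a Y"
  unfolding powers_def using genideal_self[OF pw_image_carrier] by blast

lemma powers_mono: "\<lbrakk>Y \<subseteq> Z; Z \<subseteq> G\<rbrakk> \<Longrightarrow> powers a Y \<subseteq> powers a Z"
  unfolding powers_def by (intro Idl_mono image_mono pw_image_carrier)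

lemma powers_minimal: "\<lbrakk>ideal L R; \<And>x. x \<in> Y \<Longrightarrow> x [^] a x \<in> L\<rbrakk> \<Longrightarrow> powers a Y \<subseteq> L"
  unfolding powers_def by (intro genideal_minimal) auto

lemma powers_cong: "(\<And>x. x \<in> Y \<Longrightarrow> a x = b x) \<Longrightarrow> powers a Y = powers b Y"
  unfolding powers_def by (intro arg_cong[of _ _ "genideal R"] image_cong) auto

lemma powers_split:
  assumes "x \<in> Y" "Y \<subseteq> G"
  shows "powers a Y = Idl (insert (x [^] a x) (powers a (Y - {x})))"
proof -
  have sub: "(\<lambda>x. x [^] a x) ` (Y - {x}) \<subseteq> carrier R" using assms by (intro pw_image_carrier) auto
  have xc: "{x [^] a x} \<subseteq> carrier R" using assms parameter_carrier by auto
  have "insert (x [^] a x) ((\<lambda>x. x [^] a x) ` (Y - {x})) = (\<lambda>x. x [^] a x) ` Y" using assms by auto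
  thus ?thesis unfolding powers_def using Idl_Un_Idl[OF sub xc] by simp
qed

text \<open>The set \<open>T\<close> of first powers makes the induction on \<open>S\<close> work:
  \<open>regular_mod_power\<close> needs \<open>z\<close> to be regular with \<open>i\<close> moved
  into \<open>T\<close>, and \<open>i\<close> to be regular with it left out. At the start
  \<open>(T)\<close> is a prime ideal without \<open>z\<close>.\<close>

lemma parameter_regular_mixed:
  assumes "finite S" "S \<subseteq> G" "T \<subseteq> G" "S \<inter> T = {}" "z \<in> G" "z \<notin> S" "z \<notin> T"
    "r \<in> carrier R" "z \<otimes> r \<in> Idl ((\<lambda>x. x [^] (a x :: nat)) ` S \<union> T)"
  shows "r \<in> Idl ((\<lambda>x. x [^] a x) ` S \<union> T)"
  using assms
proof (induction S arbitrary: T z r rule: finite_induct)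
  case empty
  hence "z \<notin> Idl T" using parameter_notin_Idl by blast
  moreover have "z \<otimes> r \<in> Idl T" using empty by simp
  ultimately have "r \<in> Idl T"
    using primeideal.I_prime[OF prime_Idl_parameters[OF empty(2)]] empty parameter_carrier by blast
  thus ?case by simp
next
  case (insert i S)
  let ?P = "(\<lambda>x. x [^] a x) ` S"
  have ic: "i \<in> carrier R" and zc: "z \<in> carrier R" using insert.prems parameter_carrier by auto
  have PT: "?P \<union> T \<subseteq> carrier R" using insert.prems G_carrier by auto
  let ?K = "Idl (?P \<union> T)"
  have K: "ideal ?K R" by (rule genideal_ideal[OF PT])
  have ins: "Idl (insert y ?K) = Idl (insert y (?P \<union> T))" if "y \<in> carrier R" for y
    using Idl_Un_Idl[OF PT, of "{y}"] that by simp
  have 1: "r \<in> Idl (insert i ?K)" if "r \<in> carrier R" "z \<otimes> r \<in> Idl (insert i ?K)" for r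
    using insert.IH[of "insert i T" z r] insert.prems insert.hyps that ins[OF ic] by auto
  have 2: "r \<in> ?K" if "r \<in> carrier R" "i \<otimes> r \<in> ?K" for r
    using insert.IH[of T i r] insert.prems insert.hyps that by auto
  have img: "(\<lambda>x. x [^] a x) ` insert i S \<union> T = insert (i [^] a i) (?P \<union> T)" by auto
  have "r \<in> Idl (insert (i [^] a i) ?K)"
    by (rule regular_mod_power[OF K ic zc 1 2 insert.prems(7)])
       (use insert.prems(8) ins[of "i [^] a i"] ic img in auto)
  thus ?case using ins[of "i [^] a i"] ic img by simp
qed

lemma parameter_regular:
  assumes "x \<in> G" "r \<in> carrier R" "x \<otimes> r \<in> powers a (G - {x})"
  shows "r \<in> powers a (G - {x})"
  using parameter_regular_mixed[of "G - {x}" "{}" x r a] assms finite_G unfolding powers_def by simp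

text \<open>Modulo the ideal \<open>?K\<close> of the other powers, \<open>x r\<close> is a multiple
  of \<open>x^(n+1)\<close>, and \<open>x\<close> can be cancelled there.\<close>

lemma colon_parameter:
  assumes x: "x \<in> G" and r: "r \<in> carrier R" and m: "x \<otimes> r \<in> powers a G" and ax: "a x = Suc n"
  shows "r \<in> powers (a(x := n)) G"
proof -
  let ?K = "powers a (G - {x})"
  have K: "ideal ?K R" by (rule powers_ideal) auto
  have xc: "x \<in> carrier R" and pc: "x [^] m \<in> carrier R" for m :: nat using x parameter_carrier by auto
  have "x \<otimes> r \<in> Idl (insert (x [^] Suc n) ?K)" using m powers_split[OF x, of a] ax by simp
  then obtain k b where k: "k \<in> ?K" "b \<in> carrier R" "x \<otimes> r = k \<oplus> b \<otimes> (x [^] n \<otimes> x)"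
    unfolding mem_ideal_insert[OF pc K] by auto
  have kc: "k \<in> carrier R" using k ideal.Icarr[OF K] by blast
  have "x \<otimes> (r \<ominus> b \<otimes> x [^] n) = x \<otimes> r \<ominus> b \<otimes> (x [^] n \<otimes> x)"
    using xc r k(2) pc[of n] by algebra
  also have "\<dots> = k" unfolding k(3) using kc k(2) pc[of n] xc by algebra
  finally have "x \<otimes> (r \<ominus> b \<otimes> x [^] n) \<in> ?K" using k by simp
  hence "r \<ominus> b \<otimes> x [^] n \<in> ?K" by (rule parameter_regular[OF x, rotated]) (use r k pc in simp)
  moreover have "r = (r \<ominus> b \<otimes> x [^] n) \<oplus> b \<otimes> x [^] n" using r k(2) pc[of n] by algebra
  ultimately have "r \<in> Idl (insert (x [^] n) ?K)" using k(2) unfolding mem_ideal_insert[OF pc K] by blast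
  moreover have "powers (a(x := n)) (G - {x}) = ?K" by (rule powers_cong) auto
  ultimately show ?thesis using powers_split[OF x, of "a(x := n)"] by simp
qed

lemma colon_parameter_pow:
  assumes x: "x \<in> G" and "r \<in> carrier R" and "x [^] n \<otimes> r \<in> powers a G" and "a x = n + m"
  shows "r \<in> powers (a(x := m)) G"
  using assms(2-)
proof (induction n arbitrary: a)
  case 0
  have "a(x := m) = a" using 0 by auto
  thus ?case using 0 by simp
next
  case (Suc n)
  have xc: "x \<in> carrier R" using x parameter_carrier by blast
  have "x \<otimes> (x [^] n \<otimes> r) \<in> powers a G" using Suc.prems xc by (simp add: m_ac)
  hence "x [^] n \<otimes> r \<in> powers (a(x := n + m)) G"
    by (rule colon_parameter[OF x, rotated]) (use Suc.prems xc in auto)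
  hence "r \<in> powers ((a(x := n + m))(x := m)) G" by (rule Suc.IH[OF Suc.prems(1)]) simp
  thus ?case unfolding fun_upd_upd .
qed

definition prod_pow :: "'a set \<Rightarrow> nat \<Rightarrow> 'a" where
  "prod_pow S n = (\<Otimes>x\<in>S. x [^] n)"

lemma prod_pow_closed [simp]: "S \<subseteq> G \<Longrightarrow> prod_pow S n \<in> carrier R"
  unfolding prod_pow_def using G_carrier by (intro finprod_closed) auto

lemma prod_pow_empty [simp]: "prod_pow {} n = \<one>"
  by (simp add: prod_pow_def)

lemma prod_pow_insert:
  "\<lbrakk>insert x S \<subseteq> G; x \<notin> S\<rbrakk> \<Longrightarrow> prod_pow (insert x S) n = x [^] n \<otimes> prod_pow S n"
  unfolding prod_pow_def using G_carrier finite_G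
  by (intro finprod_insert) (auto intro: finite_subset)

lemma prod_pow_split:
  assumes "S \<subseteq> G" "x \<in> S" shows "prod_pow S n = x [^] n \<otimes> prod_pow (S - {x}) n"
  using prod_pow_insert[of x "S - {x}" n] assms by (simp add: insert_absorb)

lemma prod_pow_pow:
  assumes "S \<subseteq> G" shows "prod_pow S n [^] (m::nat) = prod_pow S (n * m)"
proof -
  have "finite S" using assms finite_G by (rule finite_subset)
  thus ?thesis using assms
  proof (induction S)
    case (insert x S)
    thus ?case using parameter_carrier by (simp add: prod_pow_insert nat_pow_distrib nat_pow_pow)
  qed simp
qed

lemma colon_prod_pow:
  assumes "S \<subseteq> G" "r \<in> carrier R" "prod_pow S n \<otimes> r \<in> powers a G" "\<And>x. x \<in> S \<Longrightarrow> n \<le> a x"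
  shows "r \<in> powers (\<lambda>x. if x \<in> S then a x - n else a x) G"
proof -
  have "finite S" using assms(1) finite_G by (rule finite_subset)
  thus ?thesis using assms
  proof (induction S arbitrary: a)
    case empty
    thus ?case by simp
  next
    case (insert y S)
    have yc: "y \<in> carrier R" and yG: "y \<in> G" and S: "S \<subseteq> G" using insert.prems parameter_carrier by auto
    have "y [^] n \<otimes> (prod_pow S n \<otimes> r) \<in> powers a G"
      using insert.prems(3) prod_pow_insert[OF insert.prems(1) insert.hyps(2)] yc S insert.prems(2)
      by (simp add: m_assoc)
    hence 1: "prod_pow S n \<otimes> r \<in> powers (a(y := a y - n)) G"
      by (rule colon_parameter_pow[OF yG, rotated]) (use insert.prems S in auto)
    have "r \<in> powers (\<lambda>x. if x \<in> S then (a(y := a y - n)) x - n else (a(y := a y - n)) x) G"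
      by (rule insert.IH[OF S insert.prems(2) 1]) (use insert in auto)
    moreover have "(\<lambda>x. if x \<in> S then (a(y := a y - n)) x - n else (a(y := a y - n)) x)
        = (\<lambda>x. if x \<in> insert y S then a x - n else a x)"
      using insert.hyps by auto
    ultimately show ?case by simp
  qed
qed

text \<open>The elementary inclusion opposite to \<open>colon_prod_pow\<close>.\<close>

lemma prod_pow_mult_powers:
  assumes "S \<subseteq> G" "Y \<subseteq> G" "\<And>x. x \<in> S \<Longrightarrow> n \<le> a x"
    and r: "r \<in> powers (\<lambda>x. if x \<in> S then a x - n else a x) Y"
  shows "prod_pow S n \<otimes> r \<in> powers a Y"
proof -
  have i: "ideal (powers a Y) R" by (rule powers_ideal[OF assms(2)])
  have "powers (\<lambda>x. if x \<in> S then a x - n else a x) Y \<subseteq> colon (powers a Y) (prod_pow S n)"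
  proof (rule powers_minimal[OF colon_ideal[OF i]])
    fix y assume y: "y \<in> Y"
    have yc: "y \<in> carrier R" using y assms(2) parameter_carrier by blast
    have yy: "y [^] a y \<in> powers a Y" using pow_mem_powers[OF assms(2) y] .
    show "y [^] (if y \<in> S then a y - n else a y) \<in> colon (powers a Y) (prod_pow S n)"
    proof (cases "y \<in> S")
      case True
      have c: "prod_pow (S - {y}) n \<in> carrier R" using assms(1) by (intro prod_pow_closed) auto
      have "y [^] (a y - n) \<otimes> prod_pow S n = (y [^] (a y - n) \<otimes> y [^] n) \<otimes> prod_pow (S - {y}) n"
        using prod_pow_split[OF assms(1) True] yc c by (simp add: m_assoc)
      also have "\<dots> = y [^] a y \<otimes> prod_pow (S - {y}) n"
        using assms(3)[OF True] yc by (simp add: nat_pow_mult)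
      also have "\<dots> \<in> powers a Y" using yy c ideal.I_r_closed[OF i] by blast
      finally show ?thesis using True yc by (simp add: colon_def)
    next
      case False
      thus ?thesis using yy yc assms(1) ideal.I_r_closed[OF i] by (simp add: colon_def)
    qed
  qed (use assms(1) in simp)
  hence "r \<in> colon (powers a Y) (prod_pow S n)" using r by blast
  thus ?thesis using assms(1) by (simp add: colon_def m_comm)
qed

text \<open>The parameters are treated one at a time: modulo the ideal of \<open>t\<close>-th
  powers, \<open>u\<close> is a multiple of \<open>prod_pow S (t - 1)\<close> for growing
  \<open>S\<close>, until \<open>S\<close> is all of \<open>G\<close>.\<close>

lemma socle_powers:
  assumes t: "t \<ge> 1" and u: "u \<in> carrier R" and soc: "\<And>x. x \<in> G \<Longrightarrow> x \<otimes> u \<in> powers (\<lambda>_. t) G"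
  obtains k v where "k \<in> powers (\<lambda>_. t) G" "v \<in> carrier R" "u = k \<oplus> v \<otimes> prod_pow G (t - 1)"
proof -
  let ?Q = "powers (\<lambda>_. t) G"
  have Q: "ideal ?Q R" by (rule powers_ideal) simp
  note Qc = ideal.Icarr[OF Q]
  have "\<exists>k\<in>?Q. \<exists>v\<in>carrier R. u = k \<oplus> v \<otimes> prod_pow S (t - 1)" if "finite S" "S \<subseteq> G" for S
    using that
  proof (induction S)
    case empty
    have "u = \<zero> \<oplus> u \<otimes> prod_pow {} (t - 1)" using u by simp
    thus ?case using u ideal_zero_closed[OF Q] by blast
  next
    case (insert l S)
    have S: "S \<subseteq> G" and lG: "l \<in> G" and lc: "l \<in> carrier R" using insert.prems parameter_carrier by auto
    obtain k v where k: "k \<in> ?Q" "v \<in> carrier R" "u = k \<oplus> v \<otimes> prod_pow S (t - 1)"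
      using insert.IH[OF S] by blast
    \<comment> \<open>The exponents of the colon of \<open>?Q\<close> by \<open>l\<close>, in which
      \<open>u\<close> lies because \<open>l \<otimes> u\<close> is in \<open>?Q\<close>.\<close>
    define a where "a = (\<lambda>_::'a. t)(l := t - 1)"
    let ?s = "prod_pow S (t - 1)"
    have sc: "?s \<in> carrier R" using S by simp
    have pc: "l [^] (t - 1) \<in> carrier R" using lc by simp
    have "u \<in> powers a G"
      unfolding a_def using colon_parameter[OF lG u soc[OF lG], of "t - 1"] t by simp
    moreover have Qa: "?Q \<subseteq> powers a G"
    proof (rule powers_minimal)
      fix x assume x: "x \<in> G"
      have i: "ideal (powers a G) R" by (rule powers_ideal) simp
      have "x [^] t = x [^] (t - a x) \<otimes> x [^] a x"
        using x parameter_carrier by (simp add: nat_pow_mult a_def)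
      thus "x [^] t \<in> powers a G"
        using pow_mem_powers[OF subset_refl x, of a] ideal.I_l_closed[OF i] x parameter_carrier by simp
    qed (rule powers_ideal, simp)
    ultimately have "u \<ominus> k \<in> powers a G"
      using k(1) ideal_minus_closed[OF powers_ideal[OF subset_refl]] by blast
    also have "u \<ominus> k = ?s \<otimes> v" unfolding k(3) using Qc[OF k(1)] k(2) sc by algebra
    \<comment> \<open>Dividing by \<open>?s\<close> leaves exponent \<open>1\<close> on
      \<open>S\<close>, \<open>t - 1\<close> at \<open>l\<close> and \<open>t\<close> elsewhere. The
      power of \<open>l\<close> becomes the new factor, and multiplication by \<open>?s\<close>
      returns the rest to \<open>?Q\<close>.\<close>
    finally have "v \<in> powers (\<lambda>x. if x \<in> S then a x - (t - 1) else a x) G" (is "_ \<in> powers ?a' G")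
      by (intro colon_prod_pow[OF S k(2)]) (use insert.hyps in \<open>auto simp: a_def\<close>)
    also have "\<dots> = Idl (insert (l [^] (t - 1)) (powers ?a' (G - {l})))"
      using powers_split[OF lG subset_refl, of ?a'] insert.hyps(2) by (simp add: a_def)
    finally obtain k' w where k': "k' \<in> powers ?a' (G - {l})" "w \<in> carrier R" "v = k' \<oplus> w \<otimes> l [^] (t - 1)"
      unfolding mem_ideal_insert[OF pc powers_ideal[of "G - {l}", OF Diff_subset]] by blast
    have k'c: "k' \<in> carrier R" using k'(1) ideal.Icarr[OF powers_ideal[OF Diff_subset]] by blast
    have "?s \<otimes> k' \<in> powers a (G - {l})"
      by (rule prod_pow_mult_powers[OF S _ _ k'(1)]) (use insert.hyps in \<open>auto simp: a_def\<close>)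
    also have "powers a (G - {l}) = powers (\<lambda>_. t) (G - {l})"
      by (rule powers_cong) (simp add: a_def)
    also have "\<dots> \<subseteq> ?Q" by (rule powers_mono) auto
    finally have "k \<oplus> ?s \<otimes> k' \<in> ?Q" using k(1) ideal_add_closed[OF Q] by blast
    moreover have "u = (k \<oplus> ?s \<otimes> k') \<oplus> w \<otimes> (l [^] (t - 1) \<otimes> ?s)"
      unfolding k(3) k'(3) using Qc[OF k(1)] k'c k'(2) sc pc by algebra
    ultimately show ?case
      using k'(2) prod_pow_insert[OF insert.prems insert.hyps(2)] by auto
  qed
  from this[OF finite_G subset_refl] show ?thesis using that by blast
qed

end

section \<open>Duality and tight closure in regular local rings\<close>

context cring begin

text \<open>This is \<open>(Q : E)\<close>; for ideals \<open>Q\<close> contained in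
  \<open>E\<close> it represents, modulo \<open>Q\<close>, the homomorphisms from \<open>R/E\<close>
  to \<open>R/Q\<close>, the dual in the duality argument.\<close>

definition annih :: "'a set \<Rightarrow> 'a set \<Rightarrow> 'a set" where
  "annih Q E = {y \<in> carrier R. \<forall>e\<in>E. y \<otimes> e \<in> Q}"

lemma annih_ideal:
  assumes Q: "ideal Q R" and E: "E \<subseteq> carrier R"
  shows "ideal (annih Q E) R"
proof (rule idealI[OF ring_axioms])
  have Ec: "e \<in> carrier R" if "e \<in> E" for e using that E by blast
  show "subgroup (annih Q E) (add_monoid R)"
  proof (rule add.subgroupI)
    show "annih Q E \<subseteq> carrier R" unfolding annih_def by blast
    have "\<zero> \<in> annih Q E" using Ec ideal_zero_closed[OF Q] by (simp add: annih_def)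
    thus "annih Q E \<noteq> {}" by blast
  qed (use Ec in \<open>auto simp: annih_def l_minus l_distr ideal_closed[OF Q]\<close>)
  fix a x assume a: "a \<in> annih Q E" and x: "x \<in> carrier R"
  thus 1: "x \<otimes> a \<in> annih Q E"
    using Ec ideal.I_l_closed[OF Q] by (simp add: annih_def m_assoc)
  thus "a \<otimes> x \<in> annih Q E" using a x m_comm by (simp add: annih_def)
qed

lemma annih_antimono: "E \<subseteq> E' \<Longrightarrow> annih Q E' \<subseteq> annih Q E"
  unfolding annih_def by blast

lemma subset_annih: "\<lbrakk>ideal Q R; E \<subseteq> carrier R\<rbrakk> \<Longrightarrow> Q \<subseteq> annih Q E"
  unfolding annih_def using ideal.I_r_closed[of Q R] ideal.Icarr[of Q R] by blast

lemma annih_self: "ideal Q R \<Longrightarrow> annih Q Q = carrier R"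
  unfolding annih_def using ideal.I_l_closed[of Q R] by blast

lemma annih_carrier:
  assumes "ideal Q R" shows "annih Q (carrier R) = Q"
proof
  show "annih Q (carrier R) \<subseteq> Q" unfolding annih_def by (auto dest: bspec[of _ _ \<one>])
qed (use subset_annih[OF assms] in blast)

end

context noetherian_local_ring begin

lemma simple_ext_insert:
  assumes B: "ideal B R" and x: "x \<in> carrier R" "x \<notin> B" and mx: "\<And>a. a \<in> \<mm> \<Longrightarrow> a \<otimes> x \<in> B"
  shows "simple_ext \<mm> B (Idl (insert x B))"
  unfolding simple_ext_def
proof (intro conjI ballI)
  note ins = ideal_insert[OF x(1) B]
  show "B \<subset> Idl (insert x B)" using ins x(2) by blast
  fix e e' assume e: "e \<in> Idl (insert x B) - B" and e': "e' \<in> Idl (insert x B)"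
  from e have "e \<in> Idl (insert x B)" by blast
  then obtain b r where b: "b \<in> B" "r \<in> carrier R" "e = b \<oplus> r \<otimes> x"
    unfolding mem_ideal_insert[OF x(1) B] by blast
  from e' obtain b' r' where b': "b' \<in> B" "r' \<in> carrier R" "e' = b' \<oplus> r' \<otimes> x"
    unfolding mem_ideal_insert[OF x(1) B] by blast
  note bc = ideal.Icarr[OF B b(1)] ideal.Icarr[OF B b'(1)]
  have "r \<notin> \<mm>"
  proof
    assume "r \<in> \<mm>"
    hence "e \<in> B" using mx b ideal_add_closed[OF B] by simp
    thus False using e by blast
  qed
  moreover have "r \<otimes> e' \<ominus> r' \<otimes> e = r \<otimes> b' \<ominus> r' \<otimes> b"
    unfolding b(3) b'(3) using b(2) b'(2) bc x(1) by algebra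
  moreover have "r \<otimes> b' \<ominus> r' \<otimes> b \<in> B" using b b' by (simp add: ideal_closed[OF B])
  ultimately show "\<exists>s\<in>carrier R - \<mm>. \<exists>r\<in>carrier R. s \<otimes> e' \<ominus> r \<otimes> e \<in> B"
    using b(2) b'(2) by (intro bexI[of _ r] bexI[of _ r']) auto
qed

text \<open>The assumptions on \<open>z\<close> say that it generates the socle of \<open>R / Q\<close>.\<close>

lemma annih_simple_ext:
  assumes Q: "ideal Q R" and sig: "z \<in> carrier R"
    and socle: "\<And>u. \<lbrakk>u \<in> carrier R; \<And>a. a \<in> \<mm> \<Longrightarrow> a \<otimes> u \<in> Q\<rbrakk>
                  \<Longrightarrow> \<exists>k\<in>Q. \<exists>v\<in>carrier R. u = k \<oplus> v \<otimes> z"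
    and E: "ideal E R" and E': "ideal E' R" and S: "simple_ext \<mm> E E'" and msig: "\<And>a. a \<in> \<mm> \<Longrightarrow> a \<otimes> z \<in> Q"
  shows "annih Q E' = annih Q E \<or> simple_ext \<mm> (annih Q E') (annih Q E)"
proof (rule disjCI)
  assume not: "\<not> simple_ext \<mm> (annih Q E') (annih Q E)"
  have EE': "E \<subset> E'" using S by (simp add: simple_ext_def)
  have sub: "annih Q E' \<subseteq> annih Q E" using EE' by (intro annih_antimono) auto
  obtain e where e: "e \<in> E'" "e \<notin> E" using EE' by blast
  have ec: "e \<in> carrier R" using e ideal.Icarr[OF E'] by blast
  \<comment> \<open>Simplicity applied to \<open>a \<otimes> e\<close> outside \<open>E\<close>
    would put a unit multiple of \<open>e\<close> into \<open>E\<close>.\<close>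
  have me: "a \<otimes> e \<in> E" if a: "a \<in> \<mm>" for a
  proof (rule ccontr)
    assume n: "a \<otimes> e \<notin> E"
    have ac: "a \<in> carrier R" using m_carr[OF a] .
    obtain s r where s: "s \<in> carrier R" "s \<notin> \<mm>" "r \<in> carrier R" "s \<otimes> e \<ominus> r \<otimes> (a \<otimes> e) \<in> E"
      by (rule simple_extD[OF S ideal.I_l_closed[OF E' e(1) ac] n e(1)])
    have "s \<otimes> e \<ominus> r \<otimes> (a \<otimes> e) = (s \<ominus> r \<otimes> a) \<otimes> e" using s(1,3) ac ec by algebra
    hence "(s \<ominus> r \<otimes> a) \<otimes> e \<in> E" using s(4) by simp
    moreover have "s \<ominus> r \<otimes> a \<notin> \<mm>"
      using ideal_minus_cancel[OF m_ideal s(1)] s(2) ideal.I_l_closed[OF m_ideal a s(3)] by blast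
    ultimately have "e \<in> E" by (intro cancel_unit[OF E _ _ ec]) (use s(1,3) ac in auto)
    thus False using e by blast
  qed
  have whole: "y \<in> annih Q E'" if y: "y \<in> annih Q E" and ye: "y \<otimes> e \<in> Q" for y
    unfolding annih_def
  proof (intro CollectI conjI ballI)
    show yc: "y \<in> carrier R" using y by (simp add: annih_def)
    fix e' assume e': "e' \<in> E'"
    have e'c: "e' \<in> carrier R" using e' ideal.Icarr[OF E'] by blast
    obtain s r where s: "s \<in> carrier R" "s \<notin> \<mm>" "r \<in> carrier R" "s \<otimes> e' \<ominus> r \<otimes> e \<in> E"
      by (rule simple_extD[OF S e(1,2) e'])
    have "s \<otimes> (y \<otimes> e') = y \<otimes> (s \<otimes> e' \<ominus> r \<otimes> e) \<oplus> r \<otimes> (y \<otimes> e)"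
      using s(1,3) yc ec e'c by algebra
    moreover have "y \<otimes> (s \<otimes> e' \<ominus> r \<otimes> e) \<in> Q" using y s(4) by (simp add: annih_def)
    ultimately have "s \<otimes> (y \<otimes> e') \<in> Q" using ye s(3) by (simp add: ideal_closed[OF Q])
    thus "y \<otimes> e' \<in> Q" by (rule cancel_unit[OF Q s(1,2), rotated]) (use yc e'c in simp)
  qed
  \<comment> \<open>Together with \<open>whole\<close>: multiplication by \<open>e\<close> embeds
    \<open>annih Q E\<close> modulo \<open>annih Q E'\<close> into the socle of \<open>R/Q\<close>,
    which \<open>z\<close> generates.\<close>
  have soc: "\<exists>k\<in>Q. \<exists>v\<in>carrier R. y \<otimes> e = k \<oplus> v \<otimes> z" if y: "y \<in> annih Q E" for y
  proof (rule socle)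
    have yc: "y \<in> carrier R" using y by (simp add: annih_def)
    thus "y \<otimes> e \<in> carrier R" using ec by simp
    fix a assume a: "a \<in> \<mm>"
    have "a \<otimes> (y \<otimes> e) = y \<otimes> (a \<otimes> e)" using m_carr[OF a] yc ec by (simp add: m_lcomm)
    thus "a \<otimes> (y \<otimes> e) \<in> Q" using me[OF a] y by (simp add: annih_def)
  qed
  have "\<not> annih Q E' \<subset> annih Q E"
  proof
    assume strict: "annih Q E' \<subset> annih Q E"
    have "simple_ext \<mm> (annih Q E') (annih Q E)"
      unfolding simple_ext_def
    proof (intro conjI ballI)
      fix y y' assume y: "y \<in> annih Q E - annih Q E'" and y': "y' \<in> annih Q E"
      have yc: "y \<in> carrier R" "y' \<in> carrier R" using y y' by (auto simp: annih_def)
      obtain k v where k: "k \<in> Q" "v \<in> carrier R" "y \<otimes> e = k \<oplus> v \<otimes> z" using soc y by blast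
      obtain k' v' where k': "k' \<in> Q" "v' \<in> carrier R" "y' \<otimes> e = k' \<oplus> v' \<otimes> z" using soc y' by blast
      note kc = ideal.Icarr[OF Q k(1)] ideal.Icarr[OF Q k'(1)]
      have "v \<notin> \<mm>"
      proof
        assume "v \<in> \<mm>"
        hence "y \<otimes> e \<in> Q" using k msig ideal_add_closed[OF Q] by simp
        thus False using whole y by blast
      qed
      moreover have "(v \<otimes> y' \<ominus> v' \<otimes> y) \<otimes> e = v \<otimes> (y' \<otimes> e) \<ominus> v' \<otimes> (y \<otimes> e)"
        using k(2) k'(2) yc ec by algebra
      hence "(v \<otimes> y' \<ominus> v' \<otimes> y) \<otimes> e = v \<otimes> k' \<ominus> v' \<otimes> k"
        unfolding k(3) k'(3) using k(2) k'(2) kc sig by algebra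
      hence "(v \<otimes> y' \<ominus> v' \<otimes> y) \<otimes> e \<in> Q" using k(1,2) k'(1,2) by (simp add: ideal_closed[OF Q])
      moreover have "v \<otimes> y' \<ominus> v' \<otimes> y \<in> annih Q E"
      proof -
        have iA: "ideal (annih Q E) R" by (rule annih_ideal[OF Q ideal_subset_carrier[OF E]])
        show ?thesis using y y' k(2) k'(2) by (simp add: ideal_closed[OF iA])
      qed
      ultimately show "\<exists>s\<in>carrier R - \<mm>. \<exists>r\<in>carrier R. s \<otimes> y' \<ominus> r \<otimes> y \<in> annih Q E'"
        using whole k(2) k'(2) by blast
    qed (rule strict)
    thus False using not by blast
  qed
  thus "annih Q E' = annih Q E" using sub by blast
qed

text \<open>Duality over the zero-dimensional Gorenstein ring \<open>R / Q\<close>. Along a composition series from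
  \<open>Q\<close> to \<open>R\<close> the annihilators descend from \<open>R\<close> to \<open>Q\<close> by steps of length at most one, so every
  step is strict.\<close>

lemma gorenstein_duality:
  assumes Q: "ideal Q R" and primes: "\<And>P. \<lbrakk>primeideal P R; Q \<subseteq> P\<rbrakk> \<Longrightarrow> P = \<mm>"
    and sig: "z \<in> carrier R" and msig: "\<And>a. a \<in> \<mm> \<Longrightarrow> a \<otimes> z \<in> Q"
    and socle: "\<And>u. \<lbrakk>u \<in> carrier R; \<And>a. a \<in> \<mm> \<Longrightarrow> a \<otimes> u \<in> Q\<rbrakk>
                  \<Longrightarrow> \<exists>k\<in>Q. \<exists>v\<in>carrier R. u = k \<oplus> v \<otimes> z"
    and B: "ideal B R" "Q \<subseteq> B" and x: "x \<in> carrier R" "x \<notin> B" and mx: "\<And>a. a \<in> \<mm> \<Longrightarrow> a \<otimes> x \<in> B"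
  obtains y where "y \<in> carrier R" "\<And>b. b \<in> B \<Longrightarrow> y \<otimes> b \<in> Q" "y \<otimes> x \<notin> Q"
proof -
  let ?B' = "Idl (insert x B)"
  note ins = ideal_insert[OF x(1) B(1)]
  have S: "simple_ext \<mm> B ?B'" by (rule simple_ext_insert[OF B(1) x mx])
  have prim: "P = \<mm>" if "primeideal P R" "Q \<subseteq> P" "P \<subseteq> \<mm>" for P using primes that by blast
  obtain len :: "'a set \<Rightarrow> nat" where
    len: "\<And>E E'. \<lbrakk>contracted \<mm> E; contracted \<mm> E'; Q \<subseteq> E; E \<subset> E'\<rbrakk> \<Longrightarrow> len E < len E'"
    and len1: "\<And>E E'. \<lbrakk>contracted \<mm> E; contracted \<mm> E'; simple_ext \<mm> E E'\<rbrakk> \<Longrightarrow> len E' \<le> Suc (len E)"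
    by (rule exists_length[OF m_prime _ prim]) (use Q contracted_m in auto)
  have iA: "ideal (annih Q E) R" if "ideal E R" for E
    by (rule annih_ideal[OF Q ideal_subset_carrier[OF that]])
  have up: "Q \<subseteq> E' \<and> len E + k \<le> len E' \<and> len (annih Q E) \<le> len (annih Q E') + k"
    if "(E, E') \<in> simple_rel \<mm> ^^ k" "Q \<subseteq> E" for E E' k
    using that(1)
  proof (induction k arbitrary: E')
    case 0
    thus ?case using that(2) by simp
  next
    case (Suc k)
    obtain F where F: "(E, F) \<in> simple_rel \<mm> ^^ k" "(F, E') \<in> simple_rel \<mm>"
      using Suc.prems by (rule relpow_Suc_E)
    have FE: "ideal F R" "ideal E' R" "simple_ext \<mm> F E'"
      using F(2) by (simp_all add: simple_rel_def contracted_m)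
    note IH = Suc.IH[OF F(1)]
    have sub: "F \<subset> E'" using FE(3) by (simp add: simple_ext_def)
    hence "len F < len E'" using len IH FE by (simp add: contracted_m)
    moreover have "len (annih Q F) \<le> Suc (len (annih Q E'))"
      using annih_simple_ext[OF Q sig socle FE msig] len1[of "annih Q E'" "annih Q F"] iA FE(1,2)
      by (auto simp: contracted_m)
    ultimately show ?case using IH sub by auto
  qed
  have "(Q, B) \<in> (simple_rel \<mm>)\<^sup>*"
    by (rule composition_series[OF m_prime _ _ B(2) prim]) (use Q B contracted_m in auto)
  then obtain k1 where k1: "(Q, B) \<in> simple_rel \<mm> ^^ k1" unfolding rtrancl_power by blast
  have "(?B', carrier R) \<in> (simple_rel \<mm>)\<^sup>*"
  proof (rule composition_series[OF m_prime _ contracted_carrier])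
    show "contracted \<mm> ?B'" using ins contracted_m by blast
    show "?B' \<subseteq> carrier R" by (rule ideal_subset_carrier[OF ins(1)])
    show "P = \<mm>" if "primeideal P R" "?B' \<subseteq> P" "P \<subseteq> \<mm>" for P
      using primes[OF that(1)] that(2) ins(2) B(2) by blast
  qed
  then obtain k2 where k2: "(?B', carrier R) \<in> simple_rel \<mm> ^^ k2" unfolding rtrancl_power by blast
  note u1 = up[OF k1 subset_refl] and u2 = up[OF k2]
  have QB': "Q \<subseteq> ?B'" using B(2) ins(2) by blast
  have BB': "len B < len ?B'" using len[of B ?B'] B ins S by (simp add: contracted_m simple_ext_def)
  \<comment> \<open>If they were equal, the lengths of \<open>R\<close> and \<open>Q\<close> would
    differ by at most \<open>k1 + k2\<close>, counted through annihilators, but by at least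
    \<open>k1 + k2 + 1\<close>, counted along the series through \<open>B\<close> and
    \<open>?B'\<close>.\<close>
  have "annih Q ?B' \<noteq> annih Q B"
    using u1 u2[OF QB'] BB' annih_self[OF Q] annih_carrier[OF Q] by auto
  moreover have "annih Q ?B' \<subseteq> annih Q B" by (rule annih_antimono[OF ins(2)])
  ultimately obtain y where y: "y \<in> annih Q B" "y \<notin> annih Q ?B'" by blast
  have yc: "y \<in> carrier R" and yB: "\<And>b. b \<in> B \<Longrightarrow> y \<otimes> b \<in> Q" using y(1) by (auto simp: annih_def)
  obtain e where e: "e \<in> ?B'" "y \<otimes> e \<notin> Q" using y(2) yc by (auto simp: annih_def)
  then obtain b r where b: "b \<in> B" "r \<in> carrier R" "e = b \<oplus> r \<otimes> x"
    unfolding mem_ideal_insert[OF x(1) B(1)] by blast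
  have bc: "b \<in> carrier R" using b ideal.Icarr[OF B(1)] by blast
  have "y \<otimes> e = y \<otimes> b \<oplus> r \<otimes> (y \<otimes> x)" unfolding b(3) using b(2) bc yc x(1) by algebra
  hence "y \<otimes> x \<notin> Q" using e(2) yB[OF b(1)] b(2) by (auto simp: ideal_closed[OF Q])
  thus ?thesis using that yc yB by blast
qed

text \<open>This takes the place of Krull's intersection theorem: elements outside \<open>A\<close> are detected by
  \<open>\<mm>\<close>-primary ideals.\<close>

lemma exists_primary_avoiding:
  assumes A: "ideal A R" and x: "x \<in> carrier R" "x \<notin> A"
  obtains B where "ideal B R" "A \<subseteq> B" "x \<notin> B" "\<And>a. a \<in> \<mm> \<Longrightarrow> a \<otimes> x \<in> B"
    "\<And>a. a \<in> \<mm> \<Longrightarrow> \<exists>k::nat. a [^] k \<in> B"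
proof -
  let ?F = "{B. ideal B R \<and> A \<subseteq> B \<and> x \<notin> B}"
  have ne: "?F \<noteq> {}" using A x by blast
  obtain B where B: "B \<in> ?F" "\<And>J. \<lbrakk>J \<in> ?F; B \<subseteq> J\<rbrakk> \<Longrightarrow> J = B"
    by (rule maximal_ideal_in_family[OF ne]) auto
  have iB: "ideal B R" and AB: "A \<subseteq> B" and xB: "x \<notin> B" using B(1) by auto
  have mem: "x \<in> Idl (insert z B)" if z: "z \<in> carrier R" "z \<notin> B" for z
    using B(2)[of "Idl (insert z B)"] ideal_insert[OF z(1) iB] AB z(2) by blast
  have mx: "a \<otimes> x \<in> B" if a: "a \<in> \<mm>" for a
  proof (rule ccontr)
    assume n: "a \<otimes> x \<notin> B"
    have ac: "a \<in> carrier R" by (rule m_carr[OF a])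
    have axc: "a \<otimes> x \<in> carrier R" using ac x by simp
    obtain b r where b: "b \<in> B" "r \<in> carrier R" "x = b \<oplus> r \<otimes> (a \<otimes> x)"
      using mem[OF axc n] unfolding mem_ideal_insert[OF axc iB] by blast
    have bc: "b \<in> carrier R" using b ideal.Icarr[OF iB] by blast
    have "(\<one> \<ominus> r \<otimes> a) \<otimes> x = x \<ominus> r \<otimes> (a \<otimes> x)" using b(2) ac x(1) by algebra
    also have "\<dots> = (b \<oplus> r \<otimes> (a \<otimes> x)) \<ominus> r \<otimes> (a \<otimes> x)" using b(3) by simp
    also have "\<dots> = b" using bc b(2) ac x(1) by algebra
    finally have "(\<one> \<ominus> r \<otimes> a) \<otimes> x \<in> B" using b(1) by simp
    moreover have "\<one> \<ominus> r \<otimes> a \<notin> \<mm>"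
      by (rule one_minus_notin_m[OF ideal.I_l_closed[OF m_ideal a b(2)]])
    ultimately have "x \<in> B" by (intro cancel_unit[OF iB _ _ x(1)]) (use b(2) ac in auto)
    thus False using xB by blast
  qed
  \<comment> \<open>The colons \<open>(B : a^k)\<close> become constant at some \<open>k\<close>.
    Were \<open>a^k\<close> outside \<open>B\<close>, then \<open>x = b + r a^k\<close>; as
    \<open>a x\<close> is in \<open>B\<close>, \<open>r\<close> is in
    \<open>(B : a^(k+1)) = (B : a^k)\<close>, and \<open>x\<close> would be in
    \<open>B\<close>.\<close>
  moreover have "\<exists>k::nat. a [^] k \<in> B" if a: "a \<in> \<mm>" for a
  proof -
    have ac: "a \<in> carrier R" by (rule m_carr[OF a])
    hence pc: "a [^] k \<in> carrier R" for k :: nat by simp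
    let ?C = "range (\<lambda>k::nat. colon B (a [^] k))"
    have C: "?C \<noteq> {}" by blast
    obtain M where M: "M \<in> ?C" "\<And>J. \<lbrakk>J \<in> ?C; M \<subseteq> J\<rbrakk> \<Longrightarrow> J = M"
      by (rule maximal_ideal_in_family[OF C]) (use colon_ideal[OF iB pc] in auto)
    then obtain k :: nat where k: "M = colon B (a [^] k)" by blast
    have "colon B (a [^] k) \<subseteq> colon B (a [^] Suc k)"
    proof
      fix r assume r: "r \<in> colon B (a [^] k)"
      hence rc: "r \<in> carrier R" "r \<otimes> a [^] k \<in> B" by (auto simp: colon_def)
      have "r \<otimes> a [^] Suc k = (r \<otimes> a [^] k) \<otimes> a" using rc ac by (simp add: m_assoc)
      thus "r \<in> colon B (a [^] Suc k)" using rc ac ideal.I_r_closed[OF iB] by (simp add: colon_def)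
    qed
    hence eq: "colon B (a [^] Suc k) = colon B (a [^] k)"
      using M(2)[of "colon B (a [^] Suc k)"] k by blast
    have "a [^] k \<in> B"
    proof (rule ccontr)
      assume n: "a [^] k \<notin> B"
      obtain b r where b: "b \<in> B" "r \<in> carrier R" "x = b \<oplus> r \<otimes> a [^] k"
        using mem[OF pc n] unfolding mem_ideal_insert[OF pc iB] by blast
      have bc: "b \<in> carrier R" using b ideal.Icarr[OF iB] by blast
      have "r \<otimes> (a [^] k \<otimes> a) = a \<otimes> (b \<oplus> r \<otimes> a [^] k) \<ominus> a \<otimes> b"
        using b(2) bc ac pc[of k] by algebra
      hence "r \<otimes> (a [^] k \<otimes> a) = a \<otimes> x \<ominus> a \<otimes> b" using b(3) by simp
      moreover have "a \<otimes> x \<ominus> a \<otimes> b \<in> B" using mx[OF a] b(1) ac by (simp add: ideal_closed[OF iB])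
      ultimately have "r \<in> colon B (a [^] Suc k)" using b(2) by (simp add: colon_def)
      hence "r \<in> colon B (a [^] k)" using eq by blast
      hence "r \<otimes> a [^] k \<in> B" by (simp add: colon_def)
      hence "x \<in> B" using b ideal_add_closed[OF iB] by simp
      thus False using xB by blast
    qed
    thus ?thesis by blast
  qed
  ultimately show ?thesis using that[OF iB AB xB] by blast
qed

end

context regular_system begin

lemma exists_avoiding_above_powers:
  assumes A: "ideal A R" and x: "x \<in> carrier R" "x \<notin> A"
  obtains B t where "ideal B R" "A \<subseteq> B" "x \<notin> B" "\<And>a. a \<in> \<mm> \<Longrightarrow> a \<otimes> x \<in> B"
    "t \<ge> 1" "powers (\<lambda>_. t) G \<subseteq> B"
proof -
  obtain B where B: "ideal B R" "A \<subseteq> B" "x \<notin> B" "\<And>a. a \<in> \<mm> \<Longrightarrow> a \<otimes> x \<in> B"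
    "\<And>a. a \<in> \<mm> \<Longrightarrow> \<exists>k::nat. a [^] k \<in> B"
    using exists_primary_avoiding[OF A x] by metis
  have Gm: "g \<in> \<mm>" if "g \<in> G" for g using genideal_self[OF G_carrier] that m_gen by blast
  then obtain k :: "'a \<Rightarrow> nat" where k: "\<And>g. g \<in> G \<Longrightarrow> g [^] k g \<in> B" using B(5) by metis
  \<comment> \<open>The sum dominates every \<open>k g\<close>; the successor ensures
    \<open>t \<ge> 1\<close>.\<close>
  define t where "t = Suc (sum k G)"
  have "powers (\<lambda>_. t) G \<subseteq> B"
  proof (rule powers_minimal[OF B(1)])
    fix g assume g: "g \<in> G"
    have "k g \<le> t" unfolding t_def using member_le_sum[of g G k] g finite_G by simp
    hence "g [^] t = g [^] (t - k g) \<otimes> g [^] k g"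
      using parameter_carrier[OF g] by (simp add: nat_pow_mult)
    thus "g [^] t \<in> B" using k[OF g] ideal.I_l_closed[OF B(1)] parameter_carrier[OF g] by simp
  qed
  thus ?thesis using that[OF B(1-4), of t] by (simp add: t_def)
qed

lemma powers_antimono: "s \<le> t \<Longrightarrow> powers (\<lambda>_. t) G \<subseteq> powers (\<lambda>_. s) G"
proof (rule powers_minimal)
  show i: "ideal (powers (\<lambda>_. s) G) R" by (rule powers_ideal) simp
  fix g assume st: "s \<le> t" and g: "g \<in> G"
  have "g [^] t = g [^] (t - s) \<otimes> g [^] s" using parameter_carrier[OF g] st by (simp add: nat_pow_mult)
  thus "g [^] t \<in> powers (\<lambda>_. s) G"
    using pow_mem_powers[OF subset_refl g, of "\<lambda>_. s"] ideal.I_l_closed[OF i] parameter_carrier[OF g] by simp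
qed

lemma prime_above_powers:
  assumes P: "primeideal P R" and sub: "powers (\<lambda>_. t) G \<subseteq> P"
  shows "P = \<mm>"
proof
  show "P \<subseteq> \<mm>" by (rule primeideal_subset_m[OF P])
  have "g \<in> P" if g: "g \<in> G" for g
    using prime_pow_mem[OF P parameter_carrier[OF g], of t] pow_mem_powers[OF subset_refl g, of "\<lambda>_. t"] sub by auto
  thus "\<mm> \<subseteq> P" unfolding m_gen by (intro genideal_minimal primeideal_ideal[OF P]) auto
qed

lemma m_mult_powers:
  assumes i: "ideal Q R" and u: "u \<in> carrier R" and gen: "\<And>g. g \<in> G \<Longrightarrow> g \<otimes> u \<in> Q" and a: "a \<in> \<mm>"
  shows "a \<otimes> u \<in> Q"
proof -
  have "\<mm> \<subseteq> colon Q u"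
    unfolding m_gen by (rule genideal_minimal[OF colon_ideal[OF i u]]) (use gen parameter_carrier in \<open>auto simp: colon_def\<close>)
  thus ?thesis using a by (auto simp: colon_def)
qed

text \<open>Duality reduces the claim to \<open>((x\<^sup>t\<^sup>q) : \<sigma>\<^sup>q) = (x\<^sup>q)\<close> for the generator \<open>\<sigma>\<close> of the socle of
  \<open>R / (x\<^sup>t)\<close>, the product of all \<open>x\<^bsup>t-1\<^esup>\<close>.\<close>

theorem regular_tight:
  assumes F: "frobenius_ring R p" and A: "ideal A R" and x: "x \<in> carrier R"
    and c: "c \<in> carrier R" "c \<noteq> \<zero>"
    and tight: "\<And>e. e \<ge> e0 \<Longrightarrow> c \<otimes> x [^] (p ^ e) \<in> frobenius_power R A (p ^ e)"
  shows "x \<in> A"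
proof (rule ccontr)
  interpret F: frobenius_ring R p by (rule F)
  assume "x \<notin> A"
  obtain B t where B: "ideal B R" "A \<subseteq> B" "x \<notin> B" "\<And>a. a \<in> \<mm> \<Longrightarrow> a \<otimes> x \<in> B"
    and t: "t \<ge> 1" "powers (\<lambda>_. t) G \<subseteq> B"
    using exists_avoiding_above_powers[OF A x \<open>x \<notin> A\<close>] by metis
  let ?Q = "powers (\<lambda>_. t) G" and ?s = "prod_pow G (t - 1)"
  have Q: "ideal ?Q R" by (rule powers_ideal) simp
  have sc: "?s \<in> carrier R" by simp
  have gs: "g \<otimes> ?s \<in> ?Q" if g: "g \<in> G" for g
  proof -
    have gc: "g \<in> carrier R" by (rule parameter_carrier[OF g])
    have rc: "prod_pow (G - {g}) (t - 1) \<in> carrier R" by (rule prod_pow_closed) auto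
    have "g \<otimes> ?s = (g \<otimes> g [^] (t - 1)) \<otimes> prod_pow (G - {g}) (t - 1)"
      using prod_pow_split[OF subset_refl g] gc rc by (simp add: m_assoc)
    also have "g \<otimes> g [^] (t - 1) = g [^] t" using t(1) gc nat_pow_Suc2[OF gc, of "t - 1"] by simp
    finally show ?thesis
      using pow_mem_powers[OF subset_refl g, of "\<lambda>_. t"] rc ideal.I_r_closed[OF Q] by simp
  qed
  have ms: "a \<otimes> ?s \<in> ?Q" if "a \<in> \<mm>" for a by (rule m_mult_powers[OF Q sc gs that])
  have socle: "\<exists>k\<in>?Q. \<exists>v\<in>carrier R. u = k \<oplus> v \<otimes> ?s"
    if "u \<in> carrier R" "\<And>a. a \<in> \<mm> \<Longrightarrow> a \<otimes> u \<in> ?Q" for u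
  proof -
    have "g \<otimes> u \<in> ?Q" if "g \<in> G" for g
      using that \<open>\<And>a. a \<in> \<mm> \<Longrightarrow> a \<otimes> u \<in> ?Q\<close> genideal_self[OF G_carrier] m_gen by blast
    from socle_powers[OF t(1) \<open>u \<in> carrier R\<close> this] show ?thesis by metis
  qed
  \<comment> \<open>Multiplication by \<open>y\<close> carries \<open>B\<close>, hence
    \<open>A\<close>, into \<open>?Q\<close> but turns \<open>x\<close> into a nonzero socle element
    modulo \<open>?Q\<close>, so into a unit multiple of \<open>?s\<close>.\<close>
  obtain y where y: "y \<in> carrier R" "\<And>b. b \<in> B \<Longrightarrow> y \<otimes> b \<in> ?Q" "y \<otimes> x \<notin> ?Q"
    by (rule gorenstein_duality[OF Q prime_above_powers sc ms socle B(1) t(2) x B(3,4)]) auto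
  have yxc: "y \<otimes> x \<in> carrier R" using y x by simp
  have "a \<otimes> (y \<otimes> x) \<in> ?Q" if a: "a \<in> \<mm>" for a
  proof -
    have "a \<otimes> (y \<otimes> x) = y \<otimes> (a \<otimes> x)" using y x m_carr[OF a] by (simp add: m_lcomm)
    thus ?thesis using y(2) B(4)[OF a] by simp
  qed
  then obtain k v where k: "k \<in> ?Q" "v \<in> carrier R" "y \<otimes> x = k \<oplus> v \<otimes> ?s" using socle[OF yxc] by blast
  have kc: "k \<in> carrier R" using k ideal.Icarr[OF Q] by blast
  have vm: "v \<notin> \<mm>" using k ms y(3) ideal_add_closed[OF Q] by auto
  \<comment> \<open>Modulo the ideal of \<open>t q\<close>-th powers, the \<open>q\<close>-th power
    of \<open>y \<otimes> x\<close> is a unit multiple of that of \<open>?s\<close>. So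
    \<open>c\<close> carries the latter into this ideal, and the colon formula gives the
    claim.\<close>
  have key: "c \<in> powers (\<lambda>_. p ^ e) G" if e: "e \<ge> e0" for e
  proof -
    let ?q = "p ^ e" and ?Qq = "powers (\<lambda>_. t * p ^ e) G"
    have Qq: "ideal ?Qq R" by (rule powers_ideal) simp
    have froQ: "r [^] ?q \<in> ?Qq" if "r \<in> ?Q" for r
    proof (rule F.pow_mem_of_generators[OF Qq pw_image_carrier[OF subset_refl] _ that[unfolded powers_def]])
      fix s assume "s \<in> (\<lambda>x. x [^] t) ` G"
      then obtain g where g: "g \<in> G" "s = g [^] t" by blast
      thus "s [^] ?q \<in> ?Qq"
        using pow_mem_powers[OF subset_refl g(1), of "\<lambda>_. t * ?q"] parameter_carrier by (simp add: nat_pow_pow)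
    qed
    have Bc: "B \<subseteq> carrier R" by (rule ideal_subset_carrier[OF B(1)])
    have "frobenius_power R A ?q \<subseteq> frobenius_power R B ?q" by (rule F.frobenius_power_mono[OF B(2) Bc])
    also have "\<dots> \<subseteq> colon ?Qq (y [^] ?q)"
    proof (rule F.frobenius_power_minimal[OF colon_ideal[OF Qq]])
      fix b assume b: "b \<in> B"
      hence bc: "b \<in> carrier R" using Bc by blast
      have "b [^] ?q \<otimes> y [^] ?q = (y \<otimes> b) [^] ?q" using bc y(1) by (simp add: nat_pow_distrib m_comm)
      thus "b [^] ?q \<in> colon ?Qq (y [^] ?q)" using froQ[OF y(2)[OF b]] bc by (simp add: colon_def)
    qed (use y(1) in simp)
    finally have "(c \<otimes> x [^] ?q) \<otimes> y [^] ?q \<in> ?Qq" using tight[OF e] by (auto simp: colon_def)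
    moreover have "(c \<otimes> x [^] ?q) \<otimes> y [^] ?q = c \<otimes> (y \<otimes> x) [^] ?q"
      using c(1) x y(1) by (simp add: nat_pow_distrib m_ac)
    ultimately have 1: "c \<otimes> (k \<oplus> v \<otimes> ?s) [^] ?q \<in> ?Qq" using k(3) by simp
    have pk: "k [^] ?q \<in> carrier R" "v [^] ?q \<in> carrier R" "?s [^] ?q \<in> carrier R"
      using kc k(2) sc by simp_all
    have "(k \<oplus> v \<otimes> ?s) [^] ?q = k [^] ?q \<oplus> v [^] ?q \<otimes> ?s [^] ?q"
      using F.frobenius_add[OF kc, of "v \<otimes> ?s" e] k(2) sc by (simp add: nat_pow_distrib)
    hence "c \<otimes> (k \<oplus> v \<otimes> ?s) [^] ?q = v [^] ?q \<otimes> (c \<otimes> ?s [^] ?q) \<oplus> c \<otimes> k [^] ?q"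
      using c(1) pk by (simp add: r_distr m_ac a_ac)
    hence "v [^] ?q \<otimes> (c \<otimes> ?s [^] ?q) \<oplus> c \<otimes> k [^] ?q \<in> ?Qq" using 1 by simp
    hence A: "v [^] ?q \<otimes> (c \<otimes> ?s [^] ?q) \<in> ?Qq"
      using ideal_add_cancel[OF Qq _ ideal.I_l_closed[OF Qq froQ[OF k(1)] c(1)]] c(1) pk by simp
    have N: "v [^] ?q \<notin> \<mm>" using vm prime_pow_mem[OF m_prime k(2), of ?q] by (rule contrapos_nn)
    have C: "c \<otimes> ?s [^] ?q \<in> carrier R" using c(1) pk by simp
    have "c \<otimes> ?s [^] ?q \<in> ?Qq" by (rule cancel_unit[OF Qq pk(2) N C A])
    hence "prod_pow G ((t - 1) * ?q) \<otimes> c \<in> ?Qq" using c(1) by (simp add: prod_pow_pow m_comm)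
    hence "c \<in> powers (\<lambda>x. if x \<in> G then t * ?q - (t - 1) * ?q else t * ?q) G"
      by (intro colon_prod_pow c(1)) auto
    moreover have "t * ?q - (t - 1) * ?q = ?q" using t(1) by (simp add: diff_mult_distrib)
    moreover have "powers (\<lambda>x. if x \<in> G then t * ?q - (t - 1) * ?q else t * ?q) G
        = powers (\<lambda>_. t * ?q - (t - 1) * ?q) G" by (rule powers_cong) simp
    ultimately show ?thesis by simp
  qed
  \<comment> \<open>Some ideal of \<open>t'\<close>-th powers lies in an ideal avoiding the nonzero
    \<open>c\<close>, so \<open>c\<close> cannot satisfy \<open>key\<close> for all exponents;
    \<open>max e0 t'\<close> is admissible and makes \<open>p ^ e\<close> exceed
    \<open>t'\<close>.\<close>
  have "c \<notin> {\<zero>}" using c by simp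
  then obtain B' t' where B': "c \<notin> B'" "powers (\<lambda>_. t') G \<subseteq> B'"
    using exists_avoiding_above_powers[OF zeroideal c(1)] by metis
  have "c \<in> powers (\<lambda>_. p ^ max e0 t') G" by (rule key) simp
  also have "\<dots> \<subseteq> powers (\<lambda>_. t') G"
  proof (rule powers_antimono)
    have "t' < p ^ t'" using prime_gt_1_nat[OF F.prime_p] by (simp add: power_gt_expt)
    also have "p ^ t' \<le> p ^ max e0 t'" using prime_gt_0_nat[OF F.prime_p] by (intro power_increasing) auto
    finally show "t' \<le> p ^ max e0 t'" by simp
  qed
  finally show False using B' by blast
qed

end

section \<open>Weakly F-regular rings and ideal powers\<close>

text \<open>The common form of both alternatives. In a domain zero is the only minimal prime, so the
  multipliers of tight closure are the nonzero elements.\<close>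

locale F_regular_local = noetherian_local_ring R \<mm> + domain R + frobenius_ring R p
  for R (structure) and \<mm> and p +
  assumes tightly_closed:
    "\<lbrakk>ideal A R; x \<in> carrier R; c \<in> carrier R; c \<noteq> \<zero>;
      \<And>e. e \<ge> e0 \<Longrightarrow> c \<otimes> x [^] (p ^ e) \<in> frobenius_power R A (p ^ e)\<rbrakk> \<Longrightarrow> x \<in> A"

lemma (in regular_system) regular_F_regular:
  assumes "frobenius_ring R p"
  shows "F_regular_local R \<mm> p"
proof (intro F_regular_local.intro F_regular_local_axioms.intro)
  show "noetherian_local_ring R \<mm>" ..
  show "domain R" by (rule regular_domain)
  show "frobenius_ring R p" by fact
  fix A x c and e0 :: nat
  assume *: "ideal A R" "x \<in> carrier R" "c \<in> carrier R" "c \<noteq> \<zero>"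
    "\<And>e. e \<ge> e0 \<Longrightarrow> c \<otimes> x [^] (p ^ e) \<in> frobenius_power R A (p ^ e)"
  show "x \<in> A" by (rule regular_tight[OF assms *])
qed

text \<open>A minimal \<open>P\<close> is the annihilator of some \<open>u\<close> modulo the
  saturation of zero. If it contained \<open>c\<close>, then \<open>s u c = 0\<close> for some
  \<open>s\<close> outside \<open>P\<close>, hence \<open>s u = 0\<close>, and \<open>u\<close>
  would lie in that saturation.\<close>

lemma (in noetherian_cring) nonzerodivisor_notin_minimal_prime:
  assumes c: "c \<in> carrier R" and nzd: "\<And>z. \<lbrakk>z \<in> carrier R; z \<otimes> c = \<zero>\<rbrakk> \<Longrightarrow> z = \<zero>"
    and P: "minimal_prime R P"
  shows "c \<notin> P"
proof
  assume cP: "c \<in> P"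
  have pP: "primeideal P R" and minP: "\<And>Q. \<lbrakk>primeideal Q R; Q \<subseteq> P\<rbrakk> \<Longrightarrow> Q = P"
    using P unfolding minimal_prime_def by auto
  note iP = primeideal_ideal[OF pP]
  let ?J = "saturation P {\<zero>}"
  have J: "contracted P ?J" by (rule contracted_saturation[OF zeroideal pP])
  have "\<one> \<notin> ?J"
  proof
    assume "\<one> \<in> ?J"
    then obtain s where "s \<in> carrier R" "s \<notin> P" "s \<otimes> \<one> = \<zero>" unfolding saturation_def by auto
    thus False using ideal_zero_closed[OF iP] by simp
  qed
  hence "\<not> carrier R \<subseteq> ?J" by blast
  then obtain u where u: "u \<in> carrier R" "u \<notin> ?J" "primeideal (colon ?J u) R" "colon ?J u \<subseteq> P"
    by (rule associated_prime[OF contracted_ideal[OF J] oneideal _ contracted_saturated[OF J]])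
  have "c \<in> colon ?J u" using minP[OF u(3,4)] cP by simp
  then obtain s where s: "s \<in> carrier R" "s \<notin> P" "s \<otimes> (c \<otimes> u) = \<zero>"
    unfolding colon_def saturation_def by auto
  have "(s \<otimes> u) \<otimes> c = s \<otimes> (c \<otimes> u)" using s(1) u(1) c by (simp add: m_ac)
  hence "s \<otimes> u = \<zero>" using nzd[of "s \<otimes> u"] s u(1) by simp
  hence "u \<in> ?J" using s u(1) unfolding saturation_def by blast
  thus False using u(2) by blast
qed

text \<open>The pair is chosen with maximal double annihilator of \<open>x \<oplus> y\<close>. A
  nonzero \<open>z\<close> killing the sum could be added to \<open>y\<close>, which would enlarge
  this ideal.\<close>

lemma (in noetherian_cring) reduced_nonzerodivisor_sum:
  assumes red: "\<And>z. \<lbrakk>z \<in> carrier R; z \<otimes> z = \<zero>\<rbrakk> \<Longrightarrow> z = \<zero>"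
    and ab: "a \<in> carrier R" "b \<in> carrier R" "a \<noteq> \<zero>" "b \<noteq> \<zero>" "a \<otimes> b = \<zero>"
  obtains x y where "x \<in> carrier R" "y \<in> carrier R" "x \<noteq> \<zero>" "y \<noteq> \<zero>" "x \<otimes> y = \<zero>"
    "\<forall>z\<in>carrier R. z \<otimes> (x \<oplus> y) = \<zero> \<longrightarrow> z = \<zero>"
proof -
  define D where "D = {(x, y). x \<in> carrier R \<and> y \<in> carrier R \<and> x \<noteq> \<zero> \<and> y \<noteq> \<zero> \<and> x \<otimes> y = \<zero>}"
  define H where "H = (\<lambda>(x, y). annih {\<zero>} (annih {\<zero>} {x \<oplus> y}))"
  have iH: "ideal (H d) R" for d
  proof (cases d)
    case (Pair a b)
    show ?thesis unfolding Pair H_def prod.case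
      by (rule annih_ideal[OF zeroideal]) (auto simp: annih_def)
  qed
  have ne: "H ` D \<noteq> {}" using ab unfolding D_def by blast
  obtain M where M: "M \<in> H ` D" "\<And>J. \<lbrakk>J \<in> H ` D; M \<subseteq> J\<rbrakk> \<Longrightarrow> J = M"
    by (rule maximal_ideal_in_family[OF ne]) (use iH in auto)
  then obtain x y where xy: "(x, y) \<in> D" "M = H (x, y)" by (metis imageE surj_pair)
  have c: "x \<in> carrier R" "y \<in> carrier R" and nz: "x \<noteq> \<zero>" "y \<noteq> \<zero>" and x0: "x \<otimes> y = \<zero>"
    using xy(1) by (auto simp: D_def)
  have "z = \<zero>" if z: "z \<in> carrier R" "z \<otimes> (x \<oplus> y) = \<zero>" for z
  proof (rule ccontr)
    assume znz: "z \<noteq> \<zero>"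
    \<comment> \<open>Since \<open>x y = 0\<close>, killing the sum makes \<open>z x\<close> square
      to zero, and reducedness then separates the summands. The same device serves for
      \<open>w\<close> below.\<close>
    have "(z \<otimes> x) \<otimes> (z \<otimes> x) = (z \<otimes> x) \<otimes> (z \<otimes> (x \<oplus> y)) \<ominus> (z \<otimes> z) \<otimes> (x \<otimes> y)"
      using z(1) c by algebra
    hence "(z \<otimes> x) \<otimes> (z \<otimes> x) = \<zero>" using z c x0 by simp
    hence zx: "z \<otimes> x = \<zero>" using red[of "z \<otimes> x"] z c by simp
    hence zy: "z \<otimes> y = \<zero>" using z c by (simp add: r_distr)
    have zz: "z \<otimes> z \<noteq> \<zero>" using red[OF z(1)] znz by blast
    have zyz: "z \<otimes> (y \<oplus> z) = z \<otimes> z" using z(1) c zy by (simp add: r_distr)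
    have "y \<oplus> z \<noteq> \<zero>" using zyz zz z(1) by auto
    moreover have "x \<otimes> (y \<oplus> z) = \<zero>" using z(1) c x0 zx by (simp add: r_distr m_comm)
    ultimately have D': "(x, y \<oplus> z) \<in> D" using c z(1) nz by (simp add: D_def)
    have "annih {\<zero>} {x \<oplus> (y \<oplus> z)} \<subseteq> annih {\<zero>} {x \<oplus> y}"
    proof
      fix w assume "w \<in> annih {\<zero>} {x \<oplus> (y \<oplus> z)}"
      hence w: "w \<in> carrier R" "w \<otimes> (x \<oplus> (y \<oplus> z)) = \<zero>" by (auto simp: annih_def)
      have "(w \<otimes> x) \<otimes> (w \<otimes> x) = (w \<otimes> x) \<otimes> (w \<otimes> (x \<oplus> (y \<oplus> z))) \<ominus> (w \<otimes> w) \<otimes> (x \<otimes> y) \<ominus> (w \<otimes> w) \<otimes> (z \<otimes> x)"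
        using w(1) z(1) c by algebra
      hence "(w \<otimes> x) \<otimes> (w \<otimes> x) = \<zero>" using w z c x0 zx by simp
      hence wx: "w \<otimes> x = \<zero>" using red[of "w \<otimes> x"] w c by simp
      have "(w \<otimes> y) \<otimes> (w \<otimes> y) = (w \<otimes> y) \<otimes> (w \<otimes> (x \<oplus> (y \<oplus> z))) \<ominus> (w \<otimes> w) \<otimes> (x \<otimes> y) \<ominus> (w \<otimes> w) \<otimes> (z \<otimes> y)"
        using w(1) z(1) c by algebra
      hence "(w \<otimes> y) \<otimes> (w \<otimes> y) = \<zero>" using w z c x0 zy by simp
      hence "w \<otimes> y = \<zero>" using red[of "w \<otimes> y"] w c by simp
      thus "w \<in> annih {\<zero>} {x \<oplus> y}" using w c wx by (simp add: annih_def r_distr)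
    qed
    hence "M \<subseteq> H (x, y \<oplus> z)" unfolding xy(2) H_def by (auto intro: subsetD[OF annih_antimono])
    hence "H (x, y \<oplus> z) = M" using M(2) D' by blast
    \<comment> \<open>By maximality this element also lies in \<open>H (x, y)\<close>, so
      \<open>z\<close> kills it. But \<open>z\<close> kills \<open>x\<close> and \<open>y\<close>,
      so the product is \<open>z \<otimes> z\<close>, which is not zero.\<close>
    moreover have "x \<oplus> (y \<oplus> z) \<in> H (x, y \<oplus> z)"
      unfolding H_def using c z(1) by (auto simp: annih_def m_comm)
    moreover have "z \<in> annih {\<zero>} {x \<oplus> y}" using z by (simp add: annih_def)
    ultimately have "(x \<oplus> (y \<oplus> z)) \<otimes> z = \<zero>" unfolding xy(2) H_def annih_def by auto
    moreover have "(x \<oplus> (y \<oplus> z)) \<otimes> z = z \<otimes> x \<oplus> z \<otimes> y \<oplus> z \<otimes> z" using z(1) c by algebra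
    ultimately show False using zx zy zz z(1) by simp
  qed
  thus ?thesis using that c nz x0 by blast
qed

text \<open>If \<open>x y = 0\<close> with \<open>x + y\<close> a nonzerodivisor, then \<open>(x + y) x\<^sup>q = (x + y)\<^sup>q x\<close>, so \<open>x\<close> lies in
  the tight closure of \<open>(x + y)\<close>.\<close>

lemma (in noetherian_local_ring) weakly_F_regular_domain:
  assumes F: "frobenius_ring R p" and W: "weakly_F_regular R p"
  shows "domain R"
proof -
  interpret F: frobenius_ring R p by (rule F)
  have tc: "x \<in> A" if "ideal A R" "x \<in> tight_closure R p A" for x A
    using W that unfolding weakly_F_regular_def by blast
  \<comment> \<open>For \<open>e \<ge> 1\<close> the \<open>p ^ e\<close>-th power of a square-zero
    element vanishes, so the element is in the tight closure of zero with multiplier one.\<close>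
  have red: "z = \<zero>" if z: "z \<in> carrier R" "z \<otimes> z = \<zero>" for z
  proof -
    have "z \<in> tight_closure R p {\<zero>}"
      unfolding tight_closure_def
    proof (intro CollectI conjI bexI[of _ \<one>] exI[of _ 1] allI impI)
      show "\<one> \<notin> P" if "minimal_prime R P" for P
        using that primeideal_one_notin unfolding minimal_prime_def by blast
      fix e :: nat assume e: "1 \<le> e"
      have "p ^ 1 \<le> p ^ e" using e prime_gt_0_nat[OF F.prime_p] by (intro power_increasing) auto
      hence "2 \<le> p ^ e" using prime_ge_2_nat[OF F.prime_p] by simp
      hence "p ^ e = Suc (Suc (p ^ e - 2))" by simp
      hence "z [^] (p ^ e) = z [^] (p ^ e - 2) \<otimes> z \<otimes> z" by (metis nat_pow_Suc)
      hence "z [^] (p ^ e) = \<zero>" using z by (simp add: m_assoc)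
      moreover have "\<zero> \<in> frobenius_power R {\<zero>} (p ^ e)"
        by (rule ideal_zero_closed[OF F.frobenius_power_ideal]) simp
      ultimately show "\<one> \<otimes> z [^] (p ^ e) \<in> frobenius_power R {\<zero>} (p ^ e)" by simp
    qed (use z in auto)
    thus ?thesis using tc[OF zeroideal] by blast
  qed
  show ?thesis
  proof (rule ccontr)
    assume "\<not> domain R"
    moreover have "\<one> \<noteq> \<zero>" using one_notin_m ideal_zero_closed[OF m_ideal] by auto
    ultimately obtain a b where ab: "a \<in> carrier R" "b \<in> carrier R" "a \<noteq> \<zero>" "b \<noteq> \<zero>" "a \<otimes> b = \<zero>"
      using is_cring unfolding domain_def domain_axioms_def by blast
    obtain x y where xy: "x \<in> carrier R" "y \<in> carrier R" "x \<noteq> \<zero>" "y \<noteq> \<zero>" "x \<otimes> y = \<zero>"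
      and "\<forall>z\<in>carrier R. z \<otimes> (x \<oplus> y) = \<zero> \<longrightarrow> z = \<zero>"
      by (rule reduced_nonzerodivisor_sum[OF red ab])
    hence nzd: "z = \<zero>" if "z \<in> carrier R" "z \<otimes> (x \<oplus> y) = \<zero>" for z using that by blast
    let ?c = "x \<oplus> y" and ?A = "Idl (insert (x \<oplus> y) {\<zero>})"
    have cc: "?c \<in> carrier R" using xy by simp
    note ins = ideal_insert[OF cc zeroideal]
    have Ac: "?A \<subseteq> carrier R" by (rule ideal_subset_carrier[OF ins(1)])
    have "x \<in> tight_closure R p ?A"
      unfolding tight_closure_def
    proof (intro CollectI conjI bexI[of _ ?c] exI[of _ 0] allI impI)
      show "?c \<notin> P" if "minimal_prime R P" for P
        by (rule nonzerodivisor_notin_minimal_prime[OF cc nzd that])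
      fix e :: nat
      have q: "p ^ e = Suc (p ^ e - 1)" using prime_gt_0_nat[OF F.prime_p] by simp
      have pow0: "u [^] (p ^ e) \<otimes> v = \<zero>" if "u \<otimes> v = \<zero>" "u \<in> carrier R" "v \<in> carrier R" for u v
      proof -
        have "u [^] (p ^ e) = u [^] (p ^ e - 1) \<otimes> u" by (subst q) (rule nat_pow_Suc)
        thus ?thesis using that by (simp add: m_assoc)
      qed
      have "?c \<otimes> x [^] (p ^ e) = x [^] (p ^ e) \<otimes> x \<oplus> x [^] (p ^ e) \<otimes> y"
        using xy by (simp add: l_distr m_comm)
      also have "\<dots> = x [^] (p ^ e) \<otimes> x \<oplus> y [^] (p ^ e) \<otimes> x"
        using pow0[of x y] pow0[of y x] xy m_comm by simp
      also have "\<dots> = ?c [^] (p ^ e) \<otimes> x" using xy by (simp add: F.frobenius_add l_distr)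
      also have "\<dots> \<in> frobenius_power R ?A (p ^ e)"
        using F.pow_mem_frobenius_power[OF Ac ins(3), of "p ^ e"]
          ideal.I_r_closed[OF F.frobenius_power_ideal[OF Ac]] xy(1) by blast
      finally show "?c \<otimes> x [^] (p ^ e) \<in> frobenius_power R ?A (p ^ e)" .
    qed (use xy in auto)
    hence "x \<in> ?A" by (rule tc[OF ins(1)])
    then obtain r where r: "r \<in> carrier R" "x = \<zero> \<oplus> r \<otimes> (x \<oplus> y)"
      unfolding mem_ideal_insert[OF cc zeroideal] by auto
    hence eq: "x = r \<otimes> (x \<oplus> y)" using xy by simp
    have cancel: "u = \<zero>" if u: "u \<in> carrier R" and s: "s \<in> carrier R" "s \<notin> \<mm>" and su: "s \<otimes> (u \<otimes> u) = \<zero>" for u s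
    proof -
      have "u \<otimes> u \<in> {\<zero>}" by (rule cancel_unit[OF zeroideal s]) (use u su in auto)
      thus ?thesis using red[OF u] by simp
    qed
    \<comment> \<open>From \<open>x = r (x + y)\<close> and \<open>x y = 0\<close> follow
      \<open>(1 - r) x^2 = 0\<close> and \<open>r y^2 = 0\<close>, and one of \<open>r\<close> and
      \<open>1 - r\<close> is a unit.\<close>
    show False
    proof (cases "r \<in> \<mm>")
      case True
      have "(\<one> \<ominus> r) \<otimes> (x \<otimes> x) = x \<otimes> x \<ominus> x \<otimes> (r \<otimes> (x \<oplus> y)) \<oplus> r \<otimes> (x \<otimes> y)"
        using xy(1,2) r(1) by algebra
      also have "\<dots> = x \<otimes> x \<ominus> x \<otimes> x \<oplus> r \<otimes> (x \<otimes> y)" using eq by simp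
      also have "\<dots> = \<zero>" using xy(1,5) r(1) by (simp add: a_minus_def r_neg)
      finally have "x = \<zero>" by (intro cancel[OF xy(1) _ one_minus_notin_m[OF True]]) (use r(1) in auto)
      thus False using xy by blast
    next
      case False
      have "r \<otimes> (y \<otimes> y) = y \<otimes> (r \<otimes> (x \<oplus> y)) \<ominus> r \<otimes> (x \<otimes> y)" using xy(1,2) r(1) by algebra
      also have "\<dots> = y \<otimes> x \<ominus> r \<otimes> (x \<otimes> y)" using eq by simp
      also have "\<dots> = \<zero>" using xy(1,2,5) r(1) m_comm[OF xy(2,1)] by (simp add: a_minus_def)
      finally have "y = \<zero>" by (intro cancel[OF xy(2) r(1) False])
      thus False using xy by blast
    qed
  qed
qed

lemma (in noetherian_local_ring) weakly_F_regular_F_regular_local: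
  assumes F: "frobenius_ring R p" and W: "weakly_F_regular R p"
  shows "F_regular_local R \<mm> p"
proof (intro F_regular_local.intro F_regular_local_axioms.intro)
  show "noetherian_local_ring R \<mm>" ..
  show dom: "domain R" by (rule weakly_F_regular_domain[OF F W])
  show "frobenius_ring R p" by (rule F)
  fix A x c and e0 :: nat
  assume *: "ideal A R" "x \<in> carrier R" "c \<in> carrier R" "c \<noteq> \<zero>"
    "\<And>e. e \<ge> e0 \<Longrightarrow> c \<otimes> x [^] (p ^ e) \<in> frobenius_power R A (p ^ e)"
  have "c \<notin> P" if P: "minimal_prime R P" for P
  proof -
    have "\<zero> \<in> P" using P ideal_zero_closed[OF primeideal_ideal] unfolding minimal_prime_def by blast
    hence "{\<zero>} = P" using P domain.zeroprimeideal[OF dom] unfolding minimal_prime_def by blast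
    thus ?thesis using *(4) by blast
  qed
  hence "x \<in> tight_closure R p A" unfolding tight_closure_def using *(2,3,5) by blast
  thus "x \<in> A" using W *(1) unfolding weakly_F_regular_def by blast
qed

section \<open>Integral dependence and powers of an ideal\<close>

lemma (in ring) ideal_finsum_closed:
  assumes L: "ideal L R" and "\<And>i. i \<in> S \<Longrightarrow> f i \<in> L"
  shows "(\<Oplus>i\<in>S. f i) \<in> L"
proof (cases "finite S")
  case True
  thus ?thesis using assms(2)
  proof (induction S)
    case (insert i S)
    have "f j \<in> carrier R" if "j \<in> insert i S" for j
      using ideal.Icarr[OF L insert.prems[OF that]] .
    hence "(\<Oplus>j\<in>insert i S. f j) = f i \<oplus> (\<Oplus>j\<in>S. f j)"
      using insert.hyps by (intro finsum_insert) auto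
    thus ?case using insert.IH insert.prems by (simp add: ideal_add_closed[OF L])
  qed (simp add: ideal_zero_closed[OF L])
qed (simp add: finsum_infinite ideal_zero_closed[OF L])

context cring begin

text \<open>An equation of degree \<open>k\<close> expresses \<open>y^N\<close> through terms
  \<open>a i \<otimes> y^(N - i)\<close> with \<open>a i\<close> in \<open>J^i\<close>, which leads
  to smaller exponents; below \<open>k\<close> the claim holds as \<open>J^k\<close> lies in
  \<open>J^N\<close>. The point is that one multiplier serves all \<open>N\<close>.\<close>

lemma integral_closure_pow:
  assumes J: "ideal J R" and y: "y \<in> integral_closure R J"
  obtains k :: nat where "\<And>c N. c \<in> ideal_pow R J k \<Longrightarrow> c \<otimes> y [^] (N::nat) \<in> ideal_pow R J N"
proof -
  from y obtain k :: nat and a where yc: "y \<in> carrier R" and k: "1 \<le> k"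
    and a: "\<And>i. i \<in> {1..k} \<Longrightarrow> a i \<in> ideal_pow R J i"
    and eq: "y [^] k \<oplus> (\<Oplus>i\<in>{1..k}. a i \<otimes> y [^] (k - i)) = \<zero>" (is "_ \<oplus> ?sum = _")
    unfolding integral_closure_def by blast
  note iJ = ideal_pow_ideal[OF J]
  have "c \<otimes> y [^] N \<in> ideal_pow R J N" if c: "c \<in> ideal_pow R J k" for c and N :: nat
  proof (induction N rule: less_induct)
    case (less N)
    have cc: "c \<in> carrier R" using c ideal.Icarr[OF iJ] by blast
    show ?case
    proof (cases "N < k")
      case True
      hence "c \<in> ideal_pow R J N" using c ideal_pow_le[OF J, of N k] by auto
      thus ?thesis using yc ideal.I_r_closed[OF iJ] by simp
    next
      case False
      let ?u = "c \<otimes> y [^] (N - k)" and ?L = "ideal_pow R J N"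
      have uc: "?u \<in> carrier R" using cc yc by simp
      note iC = colon_ideal[OF iJ[of N] uc]
      have "?sum \<in> colon ?L ?u"
      proof (rule ideal_finsum_closed[OF iC])
        fix i assume i: "i \<in> {1..k}"
        have ac: "a i \<in> carrier R" using a[OF i] ideal.Icarr[OF iJ] by blast
        have "N = i + (N - i)" using i False by simp
        hence L: "?L = ideal_pow R J i \<cdot> ideal_pow R J (N - i)" using ideal_pow_add[OF J] by metis
        have "c \<otimes> y [^] (N - i) \<in> ideal_pow R J (N - i)" using less i False by simp
        hence "a i \<otimes> (c \<otimes> y [^] (N - i)) \<in> ?L" unfolding L using a[OF i] by (intro ideal_prod.prod)
        moreover have "N - i = (k - i) + (N - k)" using i False by simp
        hence "y [^] (N - i) = y [^] (k - i) \<otimes> y [^] (N - k)" using yc by (simp add: nat_pow_mult)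
        hence "a i \<otimes> (c \<otimes> y [^] (N - i)) = (a i \<otimes> y [^] (k - i)) \<otimes> ?u"
          using ac cc yc by (simp add: m_ac)
        ultimately show "a i \<otimes> y [^] (k - i) \<in> colon ?L ?u" using ac yc by (simp add: colon_def)
      qed
      moreover have "y [^] k = \<ominus> ?sum"
        using eq yc calculation ideal.Icarr[OF iC] by (intro minus_equality[symmetric]) auto
      ultimately have "y [^] k \<in> colon ?L ?u" using ideal_inv_closed[OF iC] by simp
      hence "y [^] k \<otimes> ?u \<in> ?L" by (simp add: colon_def)
      moreover have "N = k + (N - k)" using False by simp
      hence "y [^] N = y [^] k \<otimes> y [^] (N - k)" using yc by (metis nat_pow_mult)
      hence "c \<otimes> y [^] N = y [^] k \<otimes> ?u" using cc yc by (simp add: m_lcomm)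
      ultimately show ?thesis by simp
    qed
  qed
  thus ?thesis using that by blast
qed

text \<open>In a monomial of degree \<open>a + b + 1\<close> either \<open>f\<close> has degree at least \<open>b + 1\<close> or the remaining
  generators have total degree at least \<open>a + 1\<close>.\<close>

lemma ideal_pow_insert_subset:
  assumes K': "ideal K' R" and f: "f \<in> carrier R" and K: "K = Idl (insert f K')"
    and L: "ideal L R"
    and 1: "\<And>u v. \<lbrakk>u \<in> ideal_pow R K' (Suc a); v \<in> ideal_pow R K b\<rbrakk> \<Longrightarrow> u \<otimes> v \<in> L"
    and 2: "\<And>g. g \<in> ideal_pow R K a \<Longrightarrow> f [^] Suc b \<otimes> g \<in> L"
  shows "ideal_pow R K (Suc (a + b)) \<subseteq> L"
  using L 1 2
\<comment> \<open>\<open>L\<close> must vary: a factor \<open>k\<close> or \<open>f\<close> that is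
  split off is absorbed by passing to \<open>(L : k)\<close> or \<open>(L : f)\<close>, which lowers
  \<open>a\<close> or \<open>b\<close>.\<close>
proof (induction "a + b" arbitrary: a b L rule: less_induct)
  case less
  note L = less.prems(1) and 1 = less.prems(2) and 2 = less.prems(3)
  note ins = ideal_insert[OF f K', folded K]
  note iK = ideal_pow_ideal[OF ins(1)] and iK' = ideal_pow_ideal[OF K']
  show ?case
    unfolding ideal_pow_Suc
  proof (rule ideal_prod_subsetI[OF L])
    fix g h assume g: "g \<in> ideal_pow R K (a + b)" and "h \<in> K"
    then obtain k r where k: "k \<in> K'" "r \<in> carrier R" "h = k \<oplus> r \<otimes> f"
      unfolding K mem_ideal_insert[OF f K'] by blast
    have kc: "k \<in> carrier R" by (rule ideal.Icarr[OF K' k(1)])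
    have gc: "g \<in> carrier R" by (rule ideal.Icarr[OF iK g])
    have "g \<otimes> k \<in> L"
    proof (cases a)
      case 0
      have "k \<in> ideal_pow R K' (Suc a)" using k(1) 0 ideal_pow_1[OF K'] by simp
      moreover have "g \<in> ideal_pow R K b" using g 0 by simp
      ultimately have "k \<otimes> g \<in> L" by (rule 1)
      thus ?thesis using m_comm[OF kc gc] by simp
    next
      case (Suc a')
      have "ideal_pow R K (Suc (a' + b)) \<subseteq> colon L k"
      proof (rule less.hyps[OF _ colon_ideal[OF L kc]])
        fix u v assume u: "u \<in> ideal_pow R K' (Suc a')" and v: "v \<in> ideal_pow R K b"
        have uv: "u \<in> carrier R" "v \<in> carrier R" using ideal.Icarr[OF iK' u] ideal.Icarr[OF iK v] .
        have "u \<otimes> k \<in> ideal_pow R K' (Suc a)"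
          unfolding Suc ideal_pow_Suc[of K' "Suc a'"] using u k(1) by (rule ideal_prod.prod)
        hence "(u \<otimes> k) \<otimes> v \<in> L" using v by (rule 1)
        thus "u \<otimes> v \<in> colon L k" using uv kc by (simp add: colon_def m_ac)
      next
        fix u assume u: "u \<in> ideal_pow R K a'"
        have uc: "u \<in> carrier R" by (rule ideal.Icarr[OF iK u])
        have "u \<otimes> k \<in> ideal_pow R K a"
          unfolding Suc ideal_pow_Suc using u k(1) ins(2) by (blast intro: ideal_prod.prod)
        hence "f [^] Suc b \<otimes> (u \<otimes> k) \<in> L" by (rule 2)
        thus "f [^] Suc b \<otimes> u \<in> colon L k" using uc kc f by (simp add: colon_def m_assoc)
      qed (simp add: Suc)
      thus ?thesis using g unfolding Suc by (auto simp: colon_def)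
    qed
    moreover have "g \<otimes> f \<in> L"
    proof (cases b)
      case 0
      have "f [^] Suc b \<otimes> g \<in> L" by (rule 2) (use g 0 in simp)
      thus ?thesis using 0 f gc by (simp add: m_comm)
    next
      case (Suc b')
      have "ideal_pow R K (Suc (a + b')) \<subseteq> colon L f"
      proof (rule less.hyps[OF _ colon_ideal[OF L f]])
        fix u v assume u: "u \<in> ideal_pow R K' (Suc a)" and v: "v \<in> ideal_pow R K b'"
        have uv: "u \<in> carrier R" "v \<in> carrier R" using ideal.Icarr[OF iK' u] ideal.Icarr[OF iK v] .
        have "v \<otimes> f \<in> ideal_pow R K b"
          unfolding Suc ideal_pow_Suc using v ins(3) by (rule ideal_prod.prod)
        hence "u \<otimes> (v \<otimes> f) \<in> L" by (rule 1[OF u])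
        thus "u \<otimes> v \<in> colon L f" using uv f by (simp add: colon_def m_assoc)
      next
        fix u assume u: "u \<in> ideal_pow R K a"
        have uc: "u \<in> carrier R" by (rule ideal.Icarr[OF iK u])
        have "f [^] Suc b \<otimes> u \<in> L" by (rule 2[OF u])
        thus "f [^] Suc b' \<otimes> u \<in> colon L f" using Suc uc f by (simp add: colon_def m_ac)
      qed (simp add: Suc)
      thus ?thesis using g unfolding Suc by (auto simp: colon_def)
    qed
    moreover have "g \<otimes> h = g \<otimes> k \<oplus> r \<otimes> (g \<otimes> f)" unfolding k(3) using gc kc k(2) f by algebra
    ultimately show "g \<otimes> h \<in> L" using k(2) by (simp add: ideal_closed[OF L])
  qed
qed

end

section \<open>Pigeonhole containments in Frobenius powers\<close>

context frobenius_ring begin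

lemma frobenius_power_mult:
  assumes A: "ideal A R" and B: "ideal B R"
  shows "frobenius_power R A q \<cdot> frobenius_power R B q \<subseteq> frobenius_power R (A \<cdot> B) q"
proof -
  let ?L = "frobenius_power R (A \<cdot> B) q"
  note Ac = ideal_subset_carrier[OF A] and Bc = ideal_subset_carrier[OF B]
  have AB: "A \<cdot> B \<subseteq> carrier R" by (rule ideal_subset_carrier[OF ideal_prod_is_ideal[OF A B]])
  note L = frobenius_power_ideal[OF AB, of q]
  show ?thesis
  proof (rule ideal_prod_subsetI[OF L])
    fix u v assume u: "u \<in> frobenius_power R A q" and v: "v \<in> frobenius_power R B q"
    have vc: "v \<in> carrier R" by (rule ideal.Icarr[OF frobenius_power_ideal[OF Bc] v])
    have "frobenius_power R A q \<subseteq> colon ?L v"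
    proof (rule frobenius_power_minimal[OF colon_ideal[OF L vc]])
      fix a assume a: "a \<in> A"
      hence ac: "a \<in> carrier R" using Ac by blast
      hence aq: "a [^] q \<in> carrier R" by simp
      have "frobenius_power R B q \<subseteq> colon ?L (a [^] q)"
      proof (rule frobenius_power_minimal[OF colon_ideal[OF L aq]])
        fix b assume b: "b \<in> B"
        hence bc: "b \<in> carrier R" using Bc by blast
        have "(a \<otimes> b) [^] q \<in> ?L"
          by (rule pow_mem_frobenius_power[OF AB ideal_prod.prod[OF a b]])
        thus "b [^] q \<in> colon ?L (a [^] q)" using ac bc by (simp add: colon_def nat_pow_distrib m_comm)
      qed
      hence "v \<in> colon ?L (a [^] q)" using v by blast
      thus "a [^] q \<in> colon ?L v" using aq vc by (simp add: colon_def m_comm)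
    qed
    thus "u \<otimes> v \<in> ?L" using u by (auto simp: colon_def)
  qed
qed

text \<open>A monomial of degree above \<open>card A * (q - 1)\<close> in the generators is
  divisible by the \<open>q\<close>-th power of one of them. The cofactor is kept so that the step
  can be repeated.\<close>

lemma ideal_pow_subset_frobenius_step:
  assumes "finite A" "A \<subseteq> carrier R" "K = Idl A" "1 \<le> q" "card A * (q - 1) + 1 \<le> m"
  shows "ideal_pow R K m \<subseteq> frobenius_power R K q \<cdot> ideal_pow R K (m - q)"
  using assms
proof (induction A arbitrary: K m rule: finite_induct)
  case empty
  have K: "ideal K R" unfolding empty(2) by (rule genideal_ideal) simp
  have "ideal_pow R K m \<subseteq> ideal_pow R K 1" by (rule ideal_pow_le[OF K]) (use empty in simp)
  also have "\<dots> = K" using ideal_pow_1[OF K] by simp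
  also have "\<dots> \<subseteq> {\<zero>}" unfolding empty(2) by (rule genideal_minimal[OF zeroideal]) simp
  also have "\<dots> \<subseteq> frobenius_power R K q \<cdot> ideal_pow R K (m - q)"
    using ideal_zero_closed[OF ideal_prod_is_ideal[OF frobenius_power_ideal[OF ideal_subset_carrier[OF K]] ideal_pow_ideal[OF K]]]
    by simp
  finally show ?case .
next
  case (insert f A)
  define K' where "K' = Idl A"
  have f: "f \<in> carrier R" and A: "A \<subseteq> carrier R" using insert.prems by auto
  have K': "ideal K' R" unfolding K'_def by (rule genideal_ideal[OF A])
  have KK': "K = Idl (insert f K')"
    using Idl_Un_Idl[OF A, of "{f}"] f insert.prems(2) by (simp add: K'_def)
  note ins = ideal_insert[OF f K', folded KK']
  note Kc = ideal_subset_carrier[OF ins(1)] and K'c = ideal_subset_carrier[OF K']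
  note iK = ideal_pow_ideal[OF ins(1)] and iK' = ideal_pow_ideal[OF K']
  note fK = frobenius_power_ideal[OF Kc] and fK' = frobenius_power_ideal[OF K'c]
  have m: "(card A + 1) * (q - 1) + 1 \<le> m" using insert by simp
  hence qm: "q \<le> m" using insert.prems(3) by (simp add: add_mult_distrib)
  \<comment> \<open>Either the new generator occurs at least \<open>q\<close> times, or the others
    have total degree at least \<open>m - q + 1\<close>, which is enough for \<open>card A\<close>
    generators.\<close>
  define a b where "a = m - q" and "b = q - 1"
  have ab: "m = Suc (a + b)" using qm insert.prems(3) by (simp add: a_def b_def)
  let ?L = "frobenius_power R K q \<cdot> ideal_pow R K (m - q)"
  note L = ideal_prod_is_ideal[OF fK iK]
  have fmono: "frobenius_power R K' q \<subseteq> frobenius_power R K q" by (rule frobenius_power_mono[OF ins(2) Kc])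
  have pmono: "ideal_pow R K' j \<subseteq> ideal_pow R K j" for j
    by (induction j) (simp_all only: ideal_pow_0 ideal_pow_Suc subset_refl ideal_prod_mono ins(2))
  show ?case
    unfolding ab
  proof (rule ideal_pow_insert_subset[OF K' f KK'], unfold ab[symmetric])
    show "ideal ?L R" by (rule L)
    fix u v assume u: "u \<in> ideal_pow R K' (Suc a)" and v: "v \<in> ideal_pow R K b"
    have vc: "v \<in> carrier R" by (rule ideal.Icarr[OF iK v])
    have "card A * (q - 1) + 1 \<le> Suc a" using m ab b_def by (simp add: add_mult_distrib)
    hence "ideal_pow R K' (Suc a) \<subseteq> frobenius_power R K' q \<cdot> ideal_pow R K' (Suc a - q)"
      by (rule insert.IH[OF A K'_def insert.prems(3)])
    also have "\<dots> \<subseteq> colon ?L v"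
    proof (rule ideal_prod_subsetI[OF colon_ideal[OF L vc]])
      fix s h assume s: "s \<in> frobenius_power R K' q" and h: "h \<in> ideal_pow R K' (Suc a - q)"
      have c: "s \<in> carrier R" "h \<in> carrier R" using ideal.Icarr[OF fK' s] ideal.Icarr[OF iK' h] .
      have "h \<otimes> v \<in> ideal_pow R K ((Suc a - q) + b)"
        unfolding ideal_pow_add[OF ins(1)] using h v pmono by (blast intro: ideal_prod.prod)
      also have "\<dots> \<subseteq> ideal_pow R K (m - q)"
        by (rule ideal_pow_le[OF ins(1)]) (use insert.prems(3) in \<open>simp add: a_def b_def\<close>)
      finally have "s \<otimes> (h \<otimes> v) \<in> ?L" using s fmono by (blast intro: ideal_prod.prod)
      thus "s \<otimes> h \<in> colon ?L v" using c vc by (simp add: colon_def m_assoc)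
    qed
    finally show "u \<otimes> v \<in> ?L" using u by (auto simp: colon_def)
  next
    fix g assume g: "g \<in> ideal_pow R K a"
    have "f [^] Suc b = f [^] q" using insert.prems(3) by (simp add: b_def)
    also have "\<dots> \<in> frobenius_power R K q" by (rule pow_mem_frobenius_power[OF Kc ins(3)])
    finally show "f [^] Suc b \<otimes> g \<in> ?L" using g unfolding a_def by (rule ideal_prod.prod)
  qed
qed

text \<open>Each of \<open>w\<close> repetitions of the step consumes degree \<open>q\<close> and
  leaves enough for the last one; \<open>frobenius_power_mult\<close> collects the factors.\<close>

lemma ideal_pow_subset_frobenius_power:
  assumes "finite A" "A \<subseteq> carrier R" "K = Idl A" "1 \<le> q" "card A * (q - 1) + 1 + w * q \<le> m"
  shows "ideal_pow R K m \<subseteq> frobenius_power R (ideal_pow R K (w + 1)) q"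
  using assms(5)
proof (induction w arbitrary: m)
  have K: "ideal K R" unfolding assms(3) by (rule genideal_ideal[OF assms(2)])
  note iK = ideal_pow_ideal[OF K] and fK = frobenius_power_ideal[OF ideal_subset_carrier[OF K]]
  case 0
  have "ideal_pow R K m \<subseteq> frobenius_power R K q \<cdot> ideal_pow R K (m - q)"
    by (rule ideal_pow_subset_frobenius_step[OF assms(1-4)]) (use 0 in simp)
  also have "\<dots> \<subseteq> frobenius_power R K q" using ideal_prod_inter[OF fK iK] by blast
  finally show ?case using ideal_pow_1[OF K] by simp
next
  have K: "ideal K R" unfolding assms(3) by (rule genideal_ideal[OF assms(2)])
  note iK = ideal_pow_ideal[OF K]
  case (Suc w)
  have "ideal_pow R K m \<subseteq> frobenius_power R K q \<cdot> ideal_pow R K (m - q)"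
    by (rule ideal_pow_subset_frobenius_step[OF assms(1-4)]) (use Suc.prems in simp)
  also have "\<dots> \<subseteq> frobenius_power R K q \<cdot> frobenius_power R (ideal_pow R K (w + 1)) q"
    by (rule ideal_prod_mono[OF subset_refl Suc.IH]) (use Suc.prems in simp)
  also have "\<dots> \<subseteq> frobenius_power R (K \<cdot> ideal_pow R K (w + 1)) q" by (rule frobenius_power_mult[OF K iK])
  also have "K \<cdot> ideal_pow R K (w + 1) = ideal_pow R K (Suc w + 1)"
    using ideal_prod_commute[OF K iK, of "w + 1"] ideal_pow_Suc[of K "w + 1"] by simp
  finally show ?case .
qed

end

section \<open>The special part of the integral closure\<close>

lemma (in domain) nat_pow_nonzero: "\<lbrakk>a \<in> carrier R; a \<noteq> \<zero>\<rbrakk> \<Longrightarrow> a [^] (n::nat) \<noteq> \<zero>"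
  by (induction n) (auto simp: integral_iff)

lemma (in cring) integral_over_zero:
  assumes "y \<in> integral_closure R {\<zero>}"
  obtains l :: nat where "y [^] l = \<zero>"
proof -
  from assms obtain l :: nat and a where yc: "y \<in> carrier R"
    and a: "\<And>i. i \<in> {1..l} \<Longrightarrow> a i \<in> ideal_pow R {\<zero>} i"
    and eq: "y [^] l \<oplus> (\<Oplus>i\<in>{1..l}. a i \<otimes> y [^] (l - i)) = \<zero>"
    unfolding integral_closure_def by blast
  have "a i = \<zero>" if "i \<in> {1..l}" for i
    using a[OF that] ideal_pow_le[OF zeroideal, of 1 i] ideal_pow_1[OF zeroideal] that by auto
  hence "(\<Oplus>i\<in>{1..l}. a i \<otimes> y [^] (l - i)) \<in> {\<zero>}"
    using yc by (intro ideal_finsum_closed[OF zeroideal]) simp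
  thus ?thesis using that[of l] eq yc by simp
qed

context F_regular_local begin

text \<open>In general \<open>\<mm>\<close> times a Frobenius power of \<open>A\<close> is not
  itself a Frobenius power, so tight closure cannot be applied to it directly. It is applied to
  \<open>A\<close> and to a hyperplane \<open>B\<close> of \<open>A\<close> instead.\<close>

lemma mem_m_mult_of_pow_mem:
  assumes A: "ideal A R" and x: "x \<in> carrier R"
    and pow: "x [^] (p ^ e1) \<in> \<mm> \<cdot> frobenius_power R A (p ^ e1)"
  shows "x \<in> \<mm> \<cdot> A"
proof (rule ccontr)
  assume not: "x \<notin> \<mm> \<cdot> A"
  let ?q = "p ^ e1"
  have Ac: "A \<subseteq> carrier R" by (rule ideal_subset_carrier[OF A])
  \<comment> \<open>Frobenius carries the membership at \<open>e1\<close> to all larger exponents,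
    so the multiplier one suffices.\<close>
  have closed: "x \<in> C" if C: "ideal C R" and m: "x [^] ?q \<in> frobenius_power R C ?q" for C
  proof (rule tightly_closed[OF C x one_closed one_not_zero])
    fix e assume e: "e \<ge> e1"
    have Cc: "C \<subseteq> carrier R" by (rule ideal_subset_carrier[OF C])
    have pe: "p ^ e = ?q * p ^ (e - e1)" using e by (simp flip: power_add)
    have "(x [^] ?q) [^] (p ^ (e - e1)) \<in> frobenius_power R C (?q * p ^ (e - e1))"
      by (rule frobenius_power_pow[OF Cc m])
    thus "\<one> \<otimes> x [^] (p ^ e) \<in> frobenius_power R C (p ^ e)" using x pe by (simp add: nat_pow_pow)
  qed
  note fA = frobenius_power_ideal[OF Ac, of ?q]
  have "x \<in> A" using closed[OF A] pow ideal_prod_inter[OF m_ideal fA] by blast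
  note mA = ideal_prod_is_ideal[OF m_ideal A]
  \<comment> \<open>A maximal such \<open>B\<close> is, modulo \<open>\<mm> A\<close>, a hyperplane
    of the vector space \<open>A / \<mm> A\<close> that misses \<open>x\<close>.\<close>
  let ?F = "{B. ideal B R \<and> \<mm> \<cdot> A \<subseteq> B \<and> B \<subseteq> A \<and> x \<notin> B}"
  have "\<mm> \<cdot> A \<in> ?F" using mA not ideal_prod_inter[OF m_ideal A] by blast
  hence ne: "?F \<noteq> {}" by blast
  obtain B where B: "B \<in> ?F" "\<And>J. \<lbrakk>J \<in> ?F; B \<subseteq> J\<rbrakk> \<Longrightarrow> J = B"
    by (rule maximal_ideal_in_family[OF ne]) auto
  have iB: "ideal B R" and mAB: "\<mm> \<cdot> A \<subseteq> B" and BA: "B \<subseteq> A" and xB: "x \<notin> B" using B(1) by auto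
  have Bc: "B \<subseteq> carrier R" by (rule ideal_subset_carrier[OF iB])
  have dec: "z \<in> Idl (insert x B)" if z: "z \<in> A" for z
  proof (cases "z \<in> B")
    case True
    thus ?thesis using ideal_insert[OF x iB] by blast
  next
    case False
    have zc: "z \<in> carrier R" using z Ac by blast
    note ins = ideal_insert[OF zc iB]
    have "Idl (insert z B) \<subseteq> A" by (rule genideal_minimal[OF A]) (use z BA in blast)
    hence "x \<in> Idl (insert z B)" using B(2)[of "Idl (insert z B)"] ins mAB False by blast
    then obtain b r where b: "b \<in> B" "r \<in> carrier R" "x = b \<oplus> r \<otimes> z"
      unfolding mem_ideal_insert[OF zc iB] by blast
    have bc: "b \<in> carrier R" using b Bc by blast
    have "r \<notin> \<mm>"
    proof
      assume "r \<in> \<mm>"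
      hence "r \<otimes> z \<in> B" using z mAB ideal_prod.prod by fast
      thus False using b ideal_add_closed[OF iB] xB by blast
    qed
    moreover have "r \<otimes> z \<in> Idl (insert x B)"
    proof -
      have "r \<otimes> z = (b \<oplus> r \<otimes> z) \<ominus> b" using bc b(2) zc by algebra
      also have "\<dots> = x \<ominus> b" using b(3) by simp
      also have "\<dots> \<in> Idl (insert x B)"
        using ideal_insert[OF x iB] b(1) by (blast intro: ideal_minus_closed)
      finally show ?thesis .
    qed
    ultimately show ?thesis by (rule cancel_unit[OF ideal_insert(1)[OF x iB] b(2) _ zc])
  qed
  let ?X = "x [^] ?q" and ?Bq = "frobenius_power R B ?q"
  have Xc: "?X \<in> carrier R" using x by simp
  have Bq: "ideal ?Bq R" by (rule frobenius_power_ideal[OF Bc])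
  have "frobenius_power R A ?q \<subseteq> Idl (insert ?X ?Bq)"
  proof (rule frobenius_power_minimal[OF ideal_insert(1)[OF Xc Bq]])
    fix a assume "a \<in> A"
    then obtain b r where b: "b \<in> B" "r \<in> carrier R" "a = b \<oplus> r \<otimes> x"
      using dec unfolding mem_ideal_insert[OF x iB] by blast
    have bc: "b \<in> carrier R" using b Bc by blast
    have "a [^] ?q = b [^] ?q \<oplus> r [^] ?q \<otimes> ?X"
      unfolding b(3) using frobenius_add[OF bc, of "r \<otimes> x" e1] b(2) x by (simp add: nat_pow_distrib)
    thus "a [^] ?q \<in> Idl (insert ?X ?Bq)"
      unfolding mem_ideal_insert[OF Xc Bq] using pow_mem_frobenius_power[OF Bc b(1)] b(2) by blast
  qed
  hence "?X \<in> \<mm> \<cdot> (Idl (insert ?X ?Bq))" using pow ideal_prod_mono[OF subset_refl] by blast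
  \<comment> \<open>Nakayama by hand: the factor \<open>\<mm>\<close> ends up in the coefficient of
    \<open>?X\<close>, so \<open>?X = b + u ?X\<close> where \<open>1 - u\<close> is a unit.\<close>
  moreover have "\<exists>b\<in>?Bq. \<exists>u\<in>\<mm>. t = b \<oplus> u \<otimes> ?X" if "t \<in> \<mm> \<cdot> (Idl (insert ?X ?Bq))" for t
    using that
  proof (induction t rule: ideal_prod.induct)
    case (prod i j)
    obtain b r where b: "b \<in> ?Bq" "r \<in> carrier R" "j = b \<oplus> r \<otimes> ?X"
      using prod(2) unfolding mem_ideal_insert[OF Xc Bq] by blast
    have c: "i \<in> carrier R" "b \<in> carrier R" using m_carr[OF prod(1)] ideal.Icarr[OF Bq b(1)] .
    have "i \<otimes> j = i \<otimes> b \<oplus> (i \<otimes> r) \<otimes> ?X" unfolding b(3) using c b(2) Xc by algebra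
    moreover have "i \<otimes> b \<in> ?Bq" by (rule ideal.I_l_closed[OF Bq b(1) c(1)])
    moreover have "i \<otimes> r \<in> \<mm>" by (rule ideal.I_r_closed[OF m_ideal prod(1) b(2)])
    ultimately show ?case by blast
  next
    case (sum t t')
    then obtain b u b' u' where b: "b \<in> ?Bq" "u \<in> \<mm>" "t = b \<oplus> u \<otimes> ?X"
      and b': "b' \<in> ?Bq" "u' \<in> \<mm>" "t' = b' \<oplus> u' \<otimes> ?X" by blast
    note c = ideal.Icarr[OF Bq b(1)] ideal.Icarr[OF Bq b'(1)] m_carr[OF b(2)] m_carr[OF b'(2)]
    have "t \<oplus> t' = (b \<oplus> b') \<oplus> (u \<oplus> u') \<otimes> ?X" unfolding b(3) b'(3) using c Xc by algebra
    thus ?case using ideal_add_closed[OF Bq b(1) b'(1)] ideal_add_closed[OF m_ideal b(2) b'(2)] by blast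
  qed
  ultimately obtain b u where b: "b \<in> ?Bq" "u \<in> \<mm>" "?X = b \<oplus> u \<otimes> ?X" by blast
  have bc: "b \<in> carrier R" "u \<in> carrier R" using ideal.Icarr[OF Bq b(1)] m_carr[OF b(2)] .
  have "(\<one> \<ominus> u) \<otimes> ?X = ?X \<ominus> u \<otimes> ?X" using bc Xc by algebra
  also have "\<dots> = (b \<oplus> u \<otimes> ?X) \<ominus> u \<otimes> ?X" using b(3) by simp
  also have "\<dots> = b" using bc Xc by algebra
  finally have "(\<one> \<ominus> u) \<otimes> ?X \<in> ?Bq" using b(1) by simp
  hence "?X \<in> ?Bq" by (rule cancel_unit[OF Bq _ one_minus_notin_m[OF b(2)] Xc, rotated]) (use bc in simp)
  thus False using closed[OF iB] xB by blast
qed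

text \<open>The condition \<open>0 < n + w\<close> excludes \<open>I = 0\<close> with
  \<open>w = 0\<close>: there the power on the left is \<open>R\<close>, whose special part is
  \<open>\<mm>\<close>, while the right side is zero.\<close>

theorem special_part_subset:
  assumes I: "ideal I R" "I \<noteq> carrier R" and n: "n = min_num_gens R I" and nw: "0 < n + w"
  shows "special_part R \<mm> (ideal_pow R I (n + w)) \<subseteq> \<mm> \<cdot> ideal_pow R I (w + 1)"
proof
  fix x assume "x \<in> special_part R \<mm> (ideal_pow R I (n + w))"
  then obtain s :: nat where x: "x \<in> carrier R" and s: "1 \<le> s"
    and int: "x [^] s \<in> integral_closure R (\<mm> \<cdot> ideal_pow R (ideal_pow R I (n + w)) s)"
    unfolding special_part_def by blast
  note iI = ideal_pow_ideal[OF I(1)] and im = ideal_pow_ideal[OF m_ideal]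
  define J where "J = \<mm> \<cdot> ideal_pow R I ((n + w) * s)"
  have J: "ideal J R" unfolding J_def by (rule ideal_prod_is_ideal[OF m_ideal iI])
  have "x [^] s \<in> integral_closure R J" using int by (simp add: J_def ideal_pow_mult[OF I(1)])
  then obtain k :: nat where k: "\<And>c N. c \<in> ideal_pow R J k \<Longrightarrow> c \<otimes> (x [^] s) [^] (N::nat) \<in> ideal_pow R J N"
    using integral_closure_pow[OF J] by metis
  note target = ideal_prod_is_ideal[OF m_ideal iI[of "w + 1"]]
  obtain A where A: "A \<subseteq> carrier R" "finite A" "card A = n" "I = Idl A"
    using min_num_gens_generators[OF I(1)] n by metis
  have Im: "I \<subseteq> \<mm>" using proper_ideal_subset_m[OF I(1)] ideal.one_imp_carrier[OF I(1)] I(2) by blast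
  show "x \<in> \<mm> \<cdot> ideal_pow R I (w + 1)"
  \<comment> \<open>The multiplier needs a nonzero element of \<open>I\<close>. For
    \<open>I = 0\<close> also \<open>J = 0\<close>, so \<open>x\<close> is nilpotent and hence
    zero.\<close>
  proof (cases "I = {\<zero>}")
    case True
    have "J \<subseteq> {\<zero>}"
    proof -
      have "min_num_gens R I \<le> 0" unfolding min_num_gens_def
      proof (rule Least_le, intro exI conjI)
        show "I = Idl {}" unfolding True
          using genideal_minimal[OF zeroideal, of "{}"] ideal_zero_closed[OF genideal_ideal, of "{}"] by blast
      qed auto
      hence "(n + w) * s \<ge> 1" using n nw s by (simp add: Suc_le_eq)
      hence "ideal_pow R I ((n + w) * s) \<subseteq> ideal_pow R I 1" by (rule ideal_pow_le[OF I(1)])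
      also have "\<dots> = {\<zero>}" using ideal_pow_1[OF I(1)] True by simp
      finally show ?thesis unfolding J_def using ideal_prod_inter[OF m_ideal iI] by blast
    qed
    hence J0: "J = {\<zero>}" using ideal_zero_closed[OF J] by blast
    obtain l :: nat where "(x [^] s) [^] l = \<zero>"
      using integral_over_zero \<open>x [^] s \<in> integral_closure R J\<close> J0 by metis
    hence "x [^] (s * l) = \<zero>" using x by (simp add: nat_pow_pow)
    hence "x = \<zero>" using nat_pow_nonzero[OF x] by blast
    thus ?thesis using ideal_zero_closed[OF target] by simp
  next
    case False
    then obtain f where f: "f \<in> I" "f \<noteq> \<zero>" using ideal_zero_closed[OF I(1)] by blast
    have fc: "f \<in> carrier R" by (rule ideal.Icarr[OF I(1) f(1)])
    have fm: "f \<in> \<mm>" using f Im by blast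
    \<comment> \<open>\<open>N\<close> counts only full multiples of \<open>s\<close> in the
      exponent. As the remainder is below \<open>s\<close>, one factor from
      \<open>I^((n+w)s)\<close> supplies the missing degree.\<close>
    define g where "g = f [^] ((n + w) * s)"
    have g: "g \<in> ideal_pow R I ((n + w) * s)" "g \<in> carrier R" "g \<noteq> \<zero>"
      unfolding g_def using pow_mem_ideal_pow[OF I(1) f(1)] fc nat_pow_nonzero[OF fc f(2)] by auto
    have fgJ: "f \<otimes> g \<in> J" unfolding J_def using fm g(1) by (rule ideal_prod.prod)
    define c where "c = (f \<otimes> g) [^] k"
    have c: "c \<in> ideal_pow R J k" "c \<in> carrier R" "c \<noteq> \<zero>"
      unfolding c_def using pow_mem_ideal_pow[OF J fgJ] fc f(2) g nat_pow_nonzero[of "f \<otimes> g" k]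
      by (auto simp: integral_iff)
    have n0: "n \<ge> 1"
    proof (rule ccontr)
      assume "\<not> n \<ge> 1"
      hence "card A = 0" using A(3) by simp
      hence "A = {}" using A(2) by simp
      hence "I \<subseteq> {\<zero>}" unfolding A(4) by (intro genideal_minimal[OF zeroideal]) simp
      thus False using f by blast
    qed
    obtain M where M: "M \<subseteq> carrier R" "finite M" "\<mm> = Idl M" using finetely_gen[OF m_ideal] by blast
    define mu where "mu = card M"
    have mu0: "mu \<ge> 1"
    proof (rule ccontr)
      assume "\<not> mu \<ge> 1"
      hence "card M = 0" by (simp add: mu_def)
      hence "M = {}" using M(2) by simp
      hence "\<mm> \<subseteq> {\<zero>}" unfolding M(3) by (intro genideal_minimal[OF zeroideal]) simp
      thus False using f fm by blast
    qed
    \<comment> \<open>All that matters is \<open>p ^ e1 \<ge> s * mu\<close>, which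
      \<open>p ^ j > j\<close> provides; this yields \<open>N \<ge> mu * q\<close> below.\<close>
    define e1 where "e1 = s * mu"
    define Q where "Q = p ^ e1"
    have smuQ: "s * mu \<le> Q"
      unfolding Q_def e1_def using power_gt_expt[of p "s * mu"] prime_gt_1_nat[OF prime_p] by simp
    let ?A = "ideal_pow R I (w + 1)"
    have Ac: "?A \<subseteq> carrier R" by (rule ideal_subset_carrier[OF iI])
    note fA = frobenius_power_ideal[OF Ac]
    \<comment> \<open>The pigeonhole bound for both \<open>\<mm>\<close> and \<open>I\<close>; the
      summand one is absorbed because the number of generators is positive.\<close>
    have pq: "a * (q - 1) + 1 + v * q \<le> (a + v) * q" if "a \<ge> 1" "q \<ge> 1" for a q v :: nat
    proof -
      have "a * (q - 1) + a = a * q" using that by (simp add: diff_mult_distrib2)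
      thus ?thesis using that(1) by (simp add: add_mult_distrib)
    qed
    have "x [^] Q \<in> \<mm> \<cdot> frobenius_power R ?A Q"
    proof (rule tightly_closed[of _ _ "g \<otimes> c" 0])
      show "ideal (\<mm> \<cdot> frobenius_power R ?A Q) R" by (rule ideal_prod_is_ideal[OF m_ideal fA])
      show "x [^] Q \<in> carrier R" "g \<otimes> c \<in> carrier R" "g \<otimes> c \<noteq> \<zero>"
        using x g(2,3) c(2,3) by (auto simp: integral_iff)
      fix e :: nat
      let ?q = "p ^ e"
      have q1: "?q \<ge> 1" and Qq1: "Q * ?q \<ge> 1" using prime_gt_0_nat[OF prime_p] by (simp_all add: Q_def Suc_le_eq)
      define N r where "N = Q * ?q div s" and "r = Q * ?q mod s"
      have Nr: "Q * ?q = s * N + r" by (simp add: N_def r_def)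
      have rs: "r < s" unfolding r_def using s by simp
      have Nmu: "mu * ?q \<le> N"
      proof -
        have "s * (mu * ?q) \<le> Q * ?q" using smuQ by (simp flip: mult.assoc)
        hence "s * (mu * ?q) div s \<le> N" unfolding N_def by (rule div_le_mono)
        thus ?thesis using s by simp
      qed
      let ?L = "ideal_pow R \<mm> N \<cdot> ideal_pow R I ((n + w) * (Q * ?q))"
      have "c \<otimes> (x [^] s) [^] N \<in> ideal_pow R J N" by (rule k[OF c(1)])
      also have "ideal_pow R J N = ideal_pow R \<mm> N \<cdot> ideal_pow R I ((n + w) * s * N)"
        unfolding J_def ideal_pow_prod[OF m_ideal iI] ideal_pow_mult[OF I(1), of "(n + w) * s" N] ..
      finally have 1: "c \<otimes> (x [^] s) [^] N \<in> ideal_pow R \<mm> N \<cdot> ideal_pow R I ((n + w) * s * N)" .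
      have L: "ideal ?L R" by (rule ideal_prod_is_ideal[OF im iI])
      have "ideal_pow R \<mm> N \<cdot> ideal_pow R I ((n + w) * s * N) \<subseteq> colon ?L g"
      proof (rule ideal_prod_subsetI[OF colon_ideal[OF L g(2)]])
        fix a b assume a: "a \<in> ideal_pow R \<mm> N" and b: "b \<in> ideal_pow R I ((n + w) * s * N)"
        have abc: "a \<in> carrier R" "b \<in> carrier R" using ideal.Icarr[OF im a] ideal.Icarr[OF iI b] .
        have "b \<otimes> g \<in> ideal_pow R I ((n + w) * s * N + (n + w) * s)"
          unfolding ideal_pow_add[OF I(1)] using b g(1) by (rule ideal_prod.prod)
        also have "\<dots> \<subseteq> ideal_pow R I ((n + w) * (Q * ?q))"
        proof (rule ideal_pow_le[OF I(1)])
          have "(n + w) * (Q * ?q) \<le> (n + w) * (s * N + s)" unfolding Nr using rs by simp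
          thus "(n + w) * (Q * ?q) \<le> (n + w) * s * N + (n + w) * s" by (simp add: algebra_simps)
        qed
        finally have "a \<otimes> (b \<otimes> g) \<in> ?L" using a by (blast intro: ideal_prod.prod)
        thus "a \<otimes> b \<in> colon ?L g" using abc g(2) by (simp add: colon_def m_assoc)
      qed
      hence "(c \<otimes> (x [^] s) [^] N) \<otimes> g \<in> ?L" using 1 by (auto simp: colon_def)
      hence "((c \<otimes> (x [^] s) [^] N) \<otimes> g) \<otimes> x [^] r \<in> ?L" using x ideal.I_r_closed[OF L] by simp
      also have "((c \<otimes> (x [^] s) [^] N) \<otimes> g) \<otimes> x [^] r = (g \<otimes> c) \<otimes> (x [^] Q) [^] ?q"
      proof -
        have "(x [^] Q) [^] ?q = x [^] (s * N) \<otimes> x [^] r"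
          using x by (simp add: nat_pow_pow nat_pow_mult Nr)
        thus ?thesis using x c(2) g(2) by (simp add: nat_pow_pow m_ac)
      qed
      \<comment> \<open>The pigeonhole is used with \<open>q\<close> for \<open>\<mm>\<close> but
        with \<open>Q * q\<close> for \<open>I\<close>; the latter Frobenius power is then regrouped
        as \<open>Q\<close> followed by \<open>q\<close>.\<close>
      also have "?L \<subseteq> frobenius_power R \<mm> ?q \<cdot> frobenius_power R (frobenius_power R ?A Q) ?q"
      proof (rule ideal_prod_mono)
        have "ideal_pow R \<mm> N \<subseteq> frobenius_power R (ideal_pow R \<mm> (0 + 1)) ?q"
          by (rule ideal_pow_subset_frobenius_power[OF M(2,1,3) q1])
             (use pq[OF mu0 q1, of 0] Nmu in \<open>simp add: mu_def\<close>)
        thus "ideal_pow R \<mm> N \<subseteq> frobenius_power R \<mm> ?q" using ideal_pow_1[OF m_ideal] by simp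
        have "ideal_pow R I ((n + w) * (Q * ?q)) \<subseteq> frobenius_power R ?A (Q * ?q)"
          by (rule ideal_pow_subset_frobenius_power[OF A(2,1,4) Qq1])
             (use pq[OF n0 Qq1, of w] A(3) in simp)
        also have "\<dots> \<subseteq> frobenius_power R (frobenius_power R ?A Q) ?q"
        proof (rule frobenius_power_minimal[OF frobenius_power_ideal[OF ideal_subset_carrier[OF fA]]])
          fix a assume a: "a \<in> ?A"
          have "(a [^] Q) [^] ?q \<in> frobenius_power R (frobenius_power R ?A Q) ?q"
            by (rule pow_mem_frobenius_power[OF ideal_subset_carrier[OF fA] pow_mem_frobenius_power[OF Ac a]])
          thus "a [^] (Q * ?q) \<in> frobenius_power R (frobenius_power R ?A Q) ?q"
            using a Ac by (auto simp: nat_pow_pow)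
        qed
        finally show "ideal_pow R I ((n + w) * (Q * ?q)) \<subseteq> frobenius_power R (frobenius_power R ?A Q) ?q" .
      qed
      also have "\<dots> \<subseteq> frobenius_power R (\<mm> \<cdot> frobenius_power R ?A Q) ?q"
        by (rule frobenius_power_mult[OF m_ideal fA])
      finally show "(g \<otimes> c) \<otimes> (x [^] Q) [^] ?q \<in> frobenius_power R (\<mm> \<cdot> frobenius_power R ?A Q) ?q" .
    qed
    thus ?thesis unfolding Q_def by (rule mem_m_mult_of_pow_mem[OF iI x])
  qed
qed

end

theorem corollary7p5:
  fixes R :: "('a, 'b) ring_scheme" and \<mm> I :: "'a set" and p n w :: nat
  assumes "noetherian_local_ring R \<mm>"
    and "Factorial_Ring.prime p" and "has_characteristic R p"
    and "regular_local_ring R \<mm> \<or> weakly_F_regular R p"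
    and "ideal I R" and "I \<noteq> carrier R"
    and "n = min_num_gens R I"
    and "0 < n + w"
  shows "special_part R \<mm> (ideal_pow R I (n + w)) \<subseteq> \<mm> \<cdot>\<^bsub>R\<^esub> ideal_pow R I (w + 1)"
proof -
  interpret noetherian_local_ring R \<mm> by fact
  have F: "frobenius_ring R p" by unfold_locales fact+
  have "F_regular_local R \<mm> p"
    using assms(4)
  proof
    assume "regular_local_ring R \<mm>"
    then obtain G where "regular_system R \<mm> G" by (rule regular_systemI)
    thus ?thesis by (rule regular_system.regular_F_regular[OF _ F])
  next
    assume "weakly_F_regular R p"
    thus ?thesis by (rule weakly_F_regular_F_regular_local[OF F])
  qed
  thus ?thesis using assms(5-8) by (rule F_regular_local.special_part_subset)
qed

end
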